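(* Let $C>0$ be a fixed constant. For all sufficiently large $T$ and all real $k$ with $10\leq k\leq C\log T/\log\log T$, $$\mathbb{E}\big[|M_f(T)|^{2k}\big]= (\log T)^{k^2}\, e^{-k^2\log k-k^2\log\log k+O(k^2)},$$ where the constant implied by $O(k^2)$ is independent of $k$ and $T$.
   Context: Steinhaus random multiplicative function: let $(f(p))_p$, indexed by the primes, be independent random variables each uniformly distributed on the unit circle in $\mathbb{C}$, and set $f(n)=\prod_{p^{v_p}\| n}f(p)^{v_p}$ for $n\in\mathbb{N}$. Put $M_f(T)=\sum_{n\leq T}f(n)/\sqrt n$. *)

theory Defs
  imports "HOL-Probability.Probability" "HOL-Computational_Algebra.Primes"
begin

definition circle_uniform :: "complex measure" where
  "circle_uniform = distr (uniform_measure lborel {0..<2 * pi}) borel cis"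

text \<open>Only the values of \<open>f\<close> at primes are constrained.\<close>

locale steinhaus = prob_space M for M :: "'a measure" +
  fixes f :: "nat \<Rightarrow> 'a \<Rightarrow> complex"
  assumes indep_primes: "indep_vars (\<lambda>_. borel) f {p. prime p}"
    and distr_prime: "\<And>p. prime p \<Longrightarrow> distr M borel (f p) = circle_uniform"

definition mult_ext :: "(nat \<Rightarrow> 'a \<Rightarrow> complex) \<Rightarrow> nat \<Rightarrow> 'a \<Rightarrow> complex" where
  "mult_ext f n \<omega> = (\<Prod>p\<in>prime_factors n. f p \<omega> ^ multiplicity p n)"

definition M_sum :: "(nat \<Rightarrow> 'a \<Rightarrow> complex) \<Rightarrow> real \<Rightarrow> 'a \<Rightarrow> complex" where
  "M_sum f T \<omega> = (\<Sum>n | 1 \<le> n \<and> real n \<le> T. mult_ext f n \<omega> / complex_of_real (sqrt (real n)))"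

end

theory Submission imports Defs
begin

text \<open>Let \<open>F\<close> be the Euler product over the primes \<open>p \<le> T\<close>, shifted to \<open>1/2 + \<sigma>\<close> with
  \<open>\<sigma> = 80 k / ln T\<close>, and compare \<open>E |M_f(T)|^(2k)\<close> with \<open>E |F|^(2k)\<close>, both up to \<open>exp (O(k^2))\<close>.

  Upper bound: \<open>M_f(T)\<close> arises from \<open>F\<close> by cutting off the Dirichlet series at \<open>T\<close> and by Abel
  summation, which costs \<open>T^(2 k \<sigma>) = exp (O(k^2))\<close>. The cut-off is a half-line projection, hence
  bounded on \<open>L^(2k)\<close> with constant \<open>O(k)\<close> by M. Riesz' theorem for real exponents. That
  theorem follows from the subharmonicity of \<open>|w|^(p-2) (a u^2 - v^2)\<close>, where \<open>w = u + i v\<close>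
  and \<open>a = p^2/2 - 1\<close>.

  Lower bound: pair \<open>M_f(T)\<close> with \<open>F^(k-1)\<close> and the conjugate of \<open>F^k\<close>. All Fourier coefficients
  of the product of these two are nonnegative, so Rankin's trick bounds what the cut-off loses.

  Finally \<open>E |F|^(2k)\<close> is a product over primes. The primes below \<open>2 k^2\<close> contribute \<open>exp (O(k^2))\<close>;
  the larger ones contribute \<open>exp (k^2 \<Sum> p^(-1-2\<sigma>) + O(k^2))\<close>, and the sum is
  \<open>ln (1/\<sigma>) - ln (ln k) + O(1)\<close>.\<close>

section \<open>M. Riesz' inequality on the circle\<close>

text \<open>The exponent 2k is real, so the moment cannot be expanded into a divisor sum; and k may
  stay bounded while T grows, so a loss of even a fixed power of ln T would be too large. This is
  why the cut-off is treated as a projection of norm O(k): to the power 2k it costs (2k)^(2k) = exp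
  (O(k^2)). Rotating each f(p) by its own angle h(p) t does not change the joint law, and this
  carries the inequality from one circle to the expectation. The shift has to be of order k / ln T:
  then T^(2 k sigma) is still exp (O(k^2)), while Rankin's factor T^(-sigma/2) = exp (-40 k) beats
  the loss exp (38 k) that comes from replacing sigma by sigma/2. This is the origin of the 80. The
  threshold 2 k^2 is where the local variable k^2 / p falls below 1/2. The upper limit on k gives
  sigma <= 1 and k ln k = O(ln T); the latter keeps ln (ln T / (k ln k)), the exponent per k^2,
  bounded below up to the end of the range.\<close>

lemma DERIV_powr_nonneg:
  fixes f :: "real \<Rightarrow> real"
  assumes f: "(f has_real_derivative f') (at x)" and nonneg: "\<And>t. f t \<ge> 0" and q: "q > 1"
  shows "((\<lambda>t. f t powr q) has_real_derivative q * f x powr (q - 1) * f') (at x)"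
proof -
  \<comment> \<open>Cutting off at 0 gives a function that is differentiable at every y >= 0,
    including 0, where the difference quotient is at most |h|^(q-1). The chain rule then also covers
    points where the base vanishes.\<close>
  define g :: "real \<Rightarrow> real" where "g = (\<lambda>y. max y 0 powr q)"
  have g: "(g has_real_derivative q * y powr (q - 1)) (at y)" if "y \<ge> 0" for y
  proof (cases "y = 0")
    case False
    with that have y: "y > 0" by simp
    have "((\<lambda>y. y powr q) has_real_derivative q * y powr (q - 1)) (at y)"
      using y by (auto intro!: derivative_eq_intros)
    moreover have "eventually (\<lambda>z. z > 0) (nhds y)"
      using y by (rule order_tendstoD(1)[OF filterlim_ident])
    then have "eventually (\<lambda>z. z powr q = g z) (nhds y)"
      by eventually_elim (simp add: g_def)
    ultimately show ?thesis by (subst DERIV_cong_ev[OF refl, of _ "\<lambda>y. y powr q"])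
      (auto elim: eventually_mono)
  next
    case True
    have lim: "((\<lambda>h::real. \<bar>h\<bar> powr (q - 1)) \<longlongrightarrow> 0) (at 0)"
    proof (rule tendsto_zero_powrI)
      show "((\<lambda>h::real. \<bar>h\<bar>) \<longlongrightarrow> 0) (at 0)"
        by (rule tendsto_rabs_zero) (rule tendsto_ident_at)
    qed (use q in auto)
    have "((\<lambda>h. (g (0 + h) - g 0) / h) \<longlongrightarrow> 0) (at 0)"
    proof (rule Lim_null_comparison[OF _ lim], rule always_eventually, rule allI)
      fix h :: real
      show "norm ((g (0 + h) - g 0) / h) \<le> \<bar>h\<bar> powr (q - 1)"
      proof (cases "h > 0")
        case True
        then show ?thesis by (simp add: g_def powr_diff)
      qed (simp add: g_def max_def)
    qed
    then show ?thesis using True q by (simp add: DERIV_def)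
  qed
  have "((\<lambda>t. g (f t)) has_real_derivative q * f x powr (q - 1) * f') (at x)"
    using DERIV_chain2[OF g[OF nonneg] f] .
  moreover have "(\<lambda>t. g (f t)) = (\<lambda>t. f t powr q)"
    using nonneg by (simp add: g_def max_def fun_eq_iff order_antisym)
  ultimately show ?thesis by simp
qed

text \<open>With w = u + i v and p = 2q + 2 this is |w|^(p-2) (a u^2 - v^2); the definitions that
  follow are its partial derivatives.\<close>

definition Phi :: "real \<Rightarrow> real \<Rightarrow> real \<Rightarrow> real \<Rightarrow> real" where
  "Phi q a u v = (u\<^sup>2 + v\<^sup>2) powr q * (a * u\<^sup>2 - v\<^sup>2)"

definition Phi_u :: "real \<Rightarrow> real \<Rightarrow> real \<Rightarrow> real \<Rightarrow> real" where
  "Phi_u q a u v = 2 * q * u * (u\<^sup>2 + v\<^sup>2) powr (q - 1) * (a * u\<^sup>2 - v\<^sup>2)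
     + 2 * a * u * (u\<^sup>2 + v\<^sup>2) powr q"

definition Phi_v :: "real \<Rightarrow> real \<Rightarrow> real \<Rightarrow> real \<Rightarrow> real" where
  "Phi_v q a u v = 2 * q * v * (u\<^sup>2 + v\<^sup>2) powr (q - 1) * (a * u\<^sup>2 - v\<^sup>2)
     - 2 * v * (u\<^sup>2 + v\<^sup>2) powr q"

definition Phi_uu :: "real \<Rightarrow> real \<Rightarrow> real \<Rightarrow> real \<Rightarrow> real" where
  "Phi_uu q a u v = 4 * q * (q - 1) * u\<^sup>2 * (u\<^sup>2 + v\<^sup>2) powr (q - 2) * (a * u\<^sup>2 - v\<^sup>2)
     + 2 * q * (u\<^sup>2 + v\<^sup>2) powr (q - 1) * (a * u\<^sup>2 - v\<^sup>2)
     + 8 * q * a * u\<^sup>2 * (u\<^sup>2 + v\<^sup>2) powr (q - 1) + 2 * a * (u\<^sup>2 + v\<^sup>2) powr q"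

definition Phi_uv :: "real \<Rightarrow> real \<Rightarrow> real \<Rightarrow> real \<Rightarrow> real" where
  "Phi_uv q a u v = 4 * q * (q - 1) * u * v * (u\<^sup>2 + v\<^sup>2) powr (q - 2) * (a * u\<^sup>2 - v\<^sup>2)
     + 4 * q * (a - 1) * u * v * (u\<^sup>2 + v\<^sup>2) powr (q - 1)"

definition Phi_vv :: "real \<Rightarrow> real \<Rightarrow> real \<Rightarrow> real \<Rightarrow> real" where
  "Phi_vv q a u v = 4 * q * (q - 1) * v\<^sup>2 * (u\<^sup>2 + v\<^sup>2) powr (q - 2) * (a * u\<^sup>2 - v\<^sup>2)
     + 2 * q * (u\<^sup>2 + v\<^sup>2) powr (q - 1) * (a * u\<^sup>2 - v\<^sup>2)
     - 8 * q * v\<^sup>2 * (u\<^sup>2 + v\<^sup>2) powr (q - 1) - 2 * (u\<^sup>2 + v\<^sup>2) powr q"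

text \<open>Second derivatives bring in the power q - 2 of u^2 + v^2, and W may have zeros; q > 2
  makes all of them exist and stay continuous there. In terms of p = 2q + 2 this is the condition p
  > 6 of the later inequalities, which p = 2k meets.\<close>

context
  fixes u v u' v' :: "real \<Rightarrow> real" and q a t :: real
  assumes du: "(u has_real_derivative u' t) (at t)" and dv: "(v has_real_derivative v' t) (at t)"
    and q: "q > 2"
begin

lemma DERIV_norm_powr:
  assumes "r > 1"
  shows "((\<lambda>t. ((u t)\<^sup>2 + (v t)\<^sup>2) powr r) has_real_derivative
     r * ((u t)\<^sup>2 + (v t)\<^sup>2) powr (r - 1) * (2 * u t * u' t + 2 * v t * v' t)) (at t)"
  by (rule DERIV_powr_nonneg) (use assms in \<open>auto intro!: derivative_eq_intros du dv\<close>)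

lemma DERIV_Phi:
  "((\<lambda>t. Phi q a (u t) (v t)) has_real_derivative
     Phi_u q a (u t) (v t) * u' t + Phi_v q a (u t) (v t) * v' t) (at t)"
  unfolding Phi_def
  by (rule derivative_eq_intros DERIV_norm_powr du dv refl | use q in simp; fail)+
     (simp add: Phi_u_def Phi_v_def algebra_simps)

lemma DERIV_Phi_u:
  "((\<lambda>t. Phi_u q a (u t) (v t)) has_real_derivative
     Phi_uu q a (u t) (v t) * u' t + Phi_uv q a (u t) (v t) * v' t) (at t)"
  unfolding Phi_u_def
  by (rule derivative_eq_intros DERIV_norm_powr du dv refl | use q in simp; fail)+
     (simp add: Phi_uu_def Phi_uv_def algebra_simps power2_eq_square)

lemma DERIV_Phi_v:
  "((\<lambda>t. Phi_v q a (u t) (v t)) has_real_derivative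
     Phi_uv q a (u t) (v t) * u' t + Phi_vv q a (u t) (v t) * v' t) (at t)"
  unfolding Phi_v_def
  by (rule derivative_eq_intros DERIV_norm_powr du dv refl | use q in simp; fail)+
     (simp add: Phi_vv_def Phi_uv_def algebra_simps power2_eq_square)

end

text \<open>The Laplacian is (u^2 + v^2)^(q-1) times a combination of u^2 and v^2. The chosen a is
  the one that cancels the coefficient of v^2, the least value for which it is nonnegative; in terms
  of p it equals p^2/2 - 1.\<close>

lemma Phi_subharmonic:
  assumes q: "q > 2" and a: "a = 2 * q\<^sup>2 + 4 * q + 1"
  shows "Phi_uu q a u v + Phi_vv q a u v \<ge> 0"
proof -
  define N where "N = u\<^sup>2 + v\<^sup>2"
  have N: "N \<ge> 0" by (simp add: N_def)
  define n where "n = N powr (q - 1)"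
  have n2: "N * N powr (q - 2) = n" and n0: "N powr q = N * n"
    using N powr_mult_base[of N "q - 2"] powr_mult_base[of N "q - 1"] by (simp_all add: n_def)
  have "Phi_uu q a u v + Phi_vv q a u v =
     4 * q * (q - 1) * (N * N powr (q - 2)) * (a * u\<^sup>2 - v\<^sup>2) + 4 * q * n * (a * u\<^sup>2 - v\<^sup>2)
     + 8 * q * n * (a * u\<^sup>2 - v\<^sup>2) + 2 * (a - 1) * (N * n)"
    unfolding Phi_uu_def Phi_vv_def N_def[symmetric] n_def[symmetric] n0
    by (simp add: N_def algebra_simps)
  also have "\<dots> = n * ((4 * q\<^sup>2 + 8 * q) * (a * u\<^sup>2 - v\<^sup>2) + 2 * (a - 1) * N)"
    unfolding n2 by (simp add: algebra_simps power2_eq_square)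
  also have "\<dots> = n * ((4 * q\<^sup>2 + 8 * q) * (a + 1) * u\<^sup>2)"
    unfolding a N_def by (simp add: algebra_simps power2_eq_square)
  also have "\<dots> \<ge> 0"
    using q unfolding a n_def by (intro mult_nonneg_nonneg add_nonneg_nonneg) auto
  finally show ?thesis .
qed

section \<open>Means of \<open>Phi\<close> along a holomorphic function\<close>

context
  fixes W :: "complex \<Rightarrow> complex" and d :: complex and s t :: real
  assumes W: "(W has_field_derivative d) (at (Complex s t))"
begin

lemma DERIV_horizontal:
  "((\<lambda>s. Re (W (Complex s t))) has_real_derivative Re d) (at s)"
  "((\<lambda>s. Im (W (Complex s t))) has_real_derivative Im d) (at s)"
proof -
  have "((\<lambda>s. complex_of_real s + \<i> * of_real t) has_vector_derivative 1) (at s)"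
    by (auto intro!: derivative_eq_intros)
  from field_vector_diff_chain_at[OF this, of W d] W
  have "((\<lambda>s. W (Complex s t)) has_vector_derivative d) (at s)"
    by (simp add: o_def Complex_eq)
  from bounded_linear.has_vector_derivative[OF bounded_linear_Re this] bounded_linear.has_vector_derivative[OF bounded_linear_Im this]
  show "((\<lambda>s. Re (W (Complex s t))) has_real_derivative Re d) (at s)"
    "((\<lambda>s. Im (W (Complex s t))) has_real_derivative Im d) (at s)"
    by (simp_all add: has_real_derivative_iff_has_vector_derivative)
qed

lemma DERIV_vertical:
  "((\<lambda>t. Re (W (Complex s t))) has_real_derivative - Im d) (at t)"
  "((\<lambda>t. Im (W (Complex s t))) has_real_derivative Re d) (at t)"
proof -
  have "((\<lambda>t. complex_of_real s + \<i> * of_real t) has_vector_derivative \<i>) (at t)"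
    by (auto intro!: derivative_eq_intros)
  from field_vector_diff_chain_at[OF this, of W d] W
  have "((\<lambda>t. W (Complex s t)) has_vector_derivative \<i> * d) (at t)"
    by (simp add: o_def Complex_eq)
  from bounded_linear.has_vector_derivative[OF bounded_linear_Re this] bounded_linear.has_vector_derivative[OF bounded_linear_Im this]
  show "((\<lambda>t. Re (W (Complex s t))) has_real_derivative - Im d) (at t)"
    "((\<lambda>t. Im (W (Complex s t))) has_real_derivative Re d) (at t)"
    by (simp_all add: has_real_derivative_iff_has_vector_derivative)
qed

end

lemma continuous_on_norm_powr:
  assumes "r > 0" and u: "continuous_on S u" and v: "continuous_on S v"
  shows "continuous_on S (\<lambda>x. ((u x :: real)\<^sup>2 + (v x)\<^sup>2) powr r)"
  by (rule continuous_on_powr') (use assms in \<open>auto intro!: continuous_intros\<close>)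

lemma continuous_on_Phi:
  assumes q: "q > 2" and uv: "continuous_on S u" "continuous_on S v"
  shows "continuous_on S (\<lambda>x. Phi q a (u x) (v x))" "continuous_on S (\<lambda>x. Phi_u q a (u x) (v x))"
    "continuous_on S (\<lambda>x. Phi_v q a (u x) (v x))" "continuous_on S (\<lambda>x. Phi_uu q a (u x) (v x))"
    "continuous_on S (\<lambda>x. Phi_uv q a (u x) (v x))" "continuous_on S (\<lambda>x. Phi_vv q a (u x) (v x))"
  unfolding Phi_def Phi_u_def Phi_v_def Phi_uu_def Phi_uv_def Phi_vv_def
  by (intro continuous_on_add continuous_on_diff continuous_on_mult continuous_on_power
        continuous_on_const continuous_on_norm_powr uv; use q in simp)+

lemma Phi_abs_le:
  assumes "q > 0" "a \<ge> 1" "w = Complex u v"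
  shows "\<bar>Phi q a u v\<bar> \<le> a * cmod w powr (2 * q + 2)"
proof -
  have N: "u\<^sup>2 + v\<^sup>2 = (cmod w)\<^sup>2" using assms by (simp add: cmod_def)
  have "\<bar>a * u\<^sup>2 - v\<^sup>2\<bar> \<le> a * (u\<^sup>2 + v\<^sup>2)"
  proof -
    have "u\<^sup>2 \<ge> 0" "v\<^sup>2 \<ge> 0" "a * u\<^sup>2 \<ge> 0" "a * v\<^sup>2 \<ge> 1 * v\<^sup>2" "a * u\<^sup>2 \<ge> 1 * u\<^sup>2"
      using assms mult_right_mono[of 1 a "v\<^sup>2"] mult_right_mono[of 1 a "u\<^sup>2"] by simp_all
    then show ?thesis unfolding abs_le_iff distrib_left by linarith
  qed
  then have "\<bar>Phi q a u v\<bar> \<le> (u\<^sup>2 + v\<^sup>2) powr q * (a * (u\<^sup>2 + v\<^sup>2))"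
    unfolding Phi_def abs_mult by (intro mult_mono) auto
  also have "\<dots> = a * (((cmod w)\<^sup>2) powr q * ((cmod w)\<^sup>2) powr 1)" using N by simp
  also have "((cmod w)\<^sup>2) powr q * ((cmod w)\<^sup>2) powr 1 = cmod w powr (2 * q + 2)"
  proof (cases "w = 0")
    case False
    then have "(cmod w)\<^sup>2 = cmod w powr 2" by (simp add: powr_numeral)
    then show ?thesis by (simp only: powr_powr powr_add[symmetric]) (simp add: algebra_simps)
  qed auto
  finally show ?thesis .
qed

text \<open>In the coordinates $z = s + it$ the circular means become integrals over a period in $t$,
  and periodicity makes the $t$-part of the Laplacian integrate to zero, so the means are convex
  in $s$.\<close>

lemma Phi_mean_nonneg:
  fixes W W' W'' :: "complex \<Rightarrow> complex"
  assumes W: "\<And>z. (W has_field_derivative W' z) (at z)"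
    and W': "\<And>z. (W' has_field_derivative W'' z) (at z)"
    and cont: "continuous_on UNIV W''"
    and per: "\<And>s. W (Complex s (2 * pi)) = W (Complex s 0)" "\<And>s. W' (Complex s (2 * pi)) = W' (Complex s 0)"
    and decay: "\<And>s t. s \<le> 0 \<Longrightarrow> cmod (W (Complex s t)) \<le> D * exp s"
    and q: "q > 2" and a: "a = 2 * q\<^sup>2 + 4 * q + 1"
  shows "integral {0..2 * pi} (\<lambda>t. Phi q a (Re (W (Complex 0 t))) (Im (W (Complex 0 t)))) \<ge> 0"
proof -
  define U where "U s t = Re (W (Complex s t))" for s t
  define V where "V s t = Im (W (Complex s t))" for s t
  define U1 where "U1 s t = Re (W' (Complex s t))" for s t
  define V1 where "V1 s t = Im (W' (Complex s t))" for s t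
  define U2 where "U2 s t = Re (W'' (Complex s t))" for s t
  define V2 where "V2 s t = Im (W'' (Complex s t))" for s t
  note ds = DERIV_horizontal[OF W, folded U_def V_def U1_def V1_def]
    DERIV_horizontal[OF W', folded U1_def V1_def U2_def V2_def]
  note dt = DERIV_vertical[OF W, folded U_def V_def U1_def V1_def]
    DERIV_vertical[OF W', folded U1_def V1_def U2_def V2_def]
  have contW: "continuous_on UNIV W" "continuous_on UNIV W'"
    using W W' by (auto intro!: DERIV_continuous_on)
  have contC: "continuous_on A (\<lambda>x. Complex (f x) (g x))"
    if "continuous_on A f" "continuous_on A g" for A :: "'x::topological_space set" and f g
    using that unfolding Complex_eq by (intro continuous_intros)
  have c: "continuous_on A (\<lambda>x. U (f x) (g x))" "continuous_on A (\<lambda>x. V (f x) (g x))"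
    "continuous_on A (\<lambda>x. U1 (f x) (g x))" "continuous_on A (\<lambda>x. V1 (f x) (g x))"
    "continuous_on A (\<lambda>x. U2 (f x) (g x))" "continuous_on A (\<lambda>x. V2 (f x) (g x))"
    if "continuous_on A f" "continuous_on A g" for A :: "'x::topological_space set" and f g
    unfolding U_def V_def U1_def V1_def U2_def V2_def
    by (intro continuous_intros continuous_on_compose2[OF contW(1)] continuous_on_compose2[OF contW(2)]
          continuous_on_compose2[OF cont] contC that subset_UNIV)+
  define \<psi> where "\<psi> s t = Phi q a (U s t) (V s t)" for s t
  define \<psi>1 where "\<psi>1 s t = Phi_u q a (U s t) (V s t) * U1 s t + Phi_v q a (U s t) (V s t) * V1 s t" for s t
  \<comment> \<open>\<open>\<eta>\<close> is the t-derivative of \<open>\<psi>\<close>: along the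
    vertical direction W changes by i W', so U and V change by -V1 and U1.\<close>
  define \<eta> where "\<eta> s t = Phi_u q a (U s t) (V s t) * (- V1 s t) + Phi_v q a (U s t) (V s t) * U1 s t" for s t
  define puu where "puu s t = Phi_uu q a (U s t) (V s t)" for s t
  define puv where "puv s t = Phi_uv q a (U s t) (V s t)" for s t
  define pvv where "pvv s t = Phi_vv q a (U s t) (V s t)" for s t
  define X where "X s t = Phi_u q a (U s t) (V s t) * U2 s t + Phi_v q a (U s t) (V s t) * V2 s t" for s t
  define \<psi>2 where "\<psi>2 s t = (puu s t * U1 s t + puv s t * V1 s t) * U1 s t
     + (puv s t * U1 s t + pvv s t * V1 s t) * V1 s t + X s t" for s t
  define \<eta>1 where "\<eta>1 s t = (puu s t * (- V1 s t) + puv s t * U1 s t) * (- V1 s t)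
     + (puv s t * (- V1 s t) + pvv s t * U1 s t) * U1 s t - X s t" for s t
  have d1: "((\<lambda>s. \<psi> s t) has_real_derivative \<psi>1 s t) (at s)" for s t
    unfolding \<psi>_def \<psi>1_def by (rule DERIV_Phi[OF ds(1,2) q])
  have d2: "((\<lambda>s. \<psi>1 s t) has_real_derivative \<psi>2 s t) (at s)" for s t
    unfolding \<psi>1_def
    by (rule derivative_eq_intros DERIV_Phi_u[OF ds(1,2) q] DERIV_Phi_v[OF ds(1,2) q] ds refl)+
       (simp add: \<psi>2_def X_def puu_def puv_def pvv_def algebra_simps)
  have d3: "(\<eta> s has_real_derivative \<eta>1 s t) (at t)" for s t
    unfolding \<eta>_def
    by (rule derivative_eq_intros DERIV_Phi_u[OF dt(1,2) q] DERIV_Phi_v[OF dt(1,2) q] dt refl)+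
       (simp add: \<eta>1_def X_def puu_def puv_def pvv_def algebra_simps)
  \<comment> \<open>The terms \<open>X\<close> with second derivatives cancel, since W'' appears in
    the s-direction and -W'' in the t-direction. What remains is the Laplacian of \<open>Phi\<close>
    times |W'|^2.\<close>
  have lap: "\<psi>2 s t + \<eta>1 s t \<ge> 0" for s t
  proof -
    have "\<psi>2 s t + \<eta>1 s t = (puu s t + pvv s t) * ((U1 s t)\<^sup>2 + (V1 s t)\<^sup>2)"
      unfolding \<psi>2_def \<eta>1_def by (simp add: algebra_simps power2_eq_square)
    then show ?thesis using Phi_subharmonic[OF q a] by (simp add: puu_def pvv_def)
  qed
  have cc: "continuous_on A (\<lambda>x. \<psi> (f x) (g x))" "continuous_on A (\<lambda>x. \<psi>1 (f x) (g x))"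
    "continuous_on A (\<lambda>x. \<psi>2 (f x) (g x))" "continuous_on A (\<lambda>x. \<eta>1 (f x) (g x))"
    if "continuous_on A f" "continuous_on A g" for A :: "'x::topological_space set" and f g
    unfolding \<psi>_def \<psi>1_def \<psi>2_def \<eta>1_def X_def puu_def puv_def pvv_def
    by (intro continuous_intros continuous_on_Phi[OF q] c that)+
  define J where "J s = integral {0..2*pi} (\<psi> s)" for s
  define J1 where "J1 s = integral {0..2*pi} (\<psi>1 s)" for s
  define J2 where "J2 s = integral {0..2*pi} (\<psi>2 s)" for s
  have int: "\<psi> s integrable_on {0..2*pi}" "\<psi>1 s integrable_on {0..2*pi}"
    "\<psi>2 s integrable_on {0..2*pi}" "\<eta>1 s integrable_on {0..2*pi}" for s
    by (intro integrable_continuous_real cc continuous_intros)+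
  have cpair: "continuous_on A (\<lambda>(s, t). \<psi>1 s t)" "continuous_on A (\<lambda>(s, t). \<psi>2 s t)" for A
    unfolding case_prod_unfold by (intro cc continuous_intros)+
  have dJ: "(J has_real_derivative J1 s) (at s)" for s
    using leibniz_rule_field_derivative[of UNIV 0 "2*pi" \<psi> \<psi>1 s] d1 int cpair
    by (simp add: J_def[abs_def] J1_def)
  have dJ1: "(J1 has_real_derivative J2 s) (at s)" for s
    using leibniz_rule_field_derivative[of UNIV 0 "2*pi" \<psi>1 \<psi>2 s] d2 int cpair
    by (simp add: J1_def[abs_def] J2_def)
  have J2: "J2 s \<ge> 0" for s
  proof -
    have "(\<eta>1 s has_integral (\<eta> s (2*pi) - \<eta> s 0)) {0..2*pi}"
      by (rule fundamental_theorem_of_calculus)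
         (auto intro!: has_vector_derivative_at_within d3[unfolded has_real_derivative_iff_has_vector_derivative])
    moreover have "\<eta> s (2*pi) = \<eta> s 0"
      unfolding \<eta>_def U_def V_def U1_def V1_def per ..
    ultimately have "integral {0..2*pi} (\<eta>1 s) = 0" by (simp add: integral_unique)
    then have "J2 s = integral {0..2*pi} (\<lambda>t. \<psi>2 s t + \<eta>1 s t)"
      unfolding J2_def by (subst integral_add) (use int in auto)
    also have "\<dots> \<ge> 0" by (rule integral_nonneg) (use int lap in \<open>auto intro: integrable_add\<close>)
    finally show ?thesis .
  qed
  have mono1: "J1 s \<le> J1 s'" if "s \<le> s'" for s s'
    by (rule DERIV_nonneg_imp_nondecreasing[OF that]) (use dJ1 J2 in metis)
  have D: "D \<ge> 0" using order_trans[OF norm_ge_zero decay[of 0 0]] by simp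
  have a1: "a \<ge> 1" using a q by simp
  define E where "E = 2 * pi * (a * D powr (2 * q + 2))"
  have E0: "E \<ge> 0" using a1 by (simp add: E_def)
  have Jb: "\<bar>J s\<bar> \<le> E * exp s" if s: "s \<le> 0" for s
  proof -
    have "norm (\<psi> s t) \<le> a * D powr (2 * q + 2) * exp s" for t
    proof -
      have "norm (\<psi> s t) \<le> a * cmod (W (Complex s t)) powr (2 * q + 2)"
        unfolding \<psi>_def real_norm_def
        by (rule Phi_abs_le) (use q a1 in \<open>auto simp: U_def V_def\<close>)
      also have "\<dots> \<le> a * (D * exp s) powr (2 * q + 2)"
        using a1 q decay[OF s] by (intro mult_left_mono powr_mono2) auto
      also have "\<dots> = a * D powr (2 * q + 2) * exp (s * (2 * q + 2))"
        using D by (simp add: powr_mult exp_powr_real)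
      also have "s * (2 * q + 2) \<le> s * 1" using s q by (intro mult_left_mono_neg) auto
      then have "a * D powr (2 * q + 2) * exp (s * (2 * q + 2)) \<le> a * D powr (2 * q + 2) * exp s"
        using a1 by (intro mult_left_mono) auto
      finally show ?thesis .
    qed
    then have "norm (J s) \<le> integral {0..2*pi} (\<lambda>t. a * D powr (2 * q + 2) * exp s)"
      unfolding J_def by (intro integral_norm_bound_integral int) auto
    then show ?thesis by (simp add: E_def mult_ac)
  qed
  \<comment> \<open>A convex function that is bounded on s <= 0 cannot decrease there. Together with
    J -> 0 at minus infinity this gives J 0 >= 0.\<close>
  have J1: "J1 s \<ge> 0" if s: "s \<le> 0" for s
  proof (rule ccontr)
    assume "\<not> J1 s \<ge> 0"
    then have neg: "J1 s < 0" by simp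
    \<comment> \<open>By convexity, going left by \<open>x\<close> from a point with negative slope
      raises J by at least 3E + 1, more than the bounds |J| <= E at both ends allow.\<close>
    define x where "x = (3 * E + 1) / (- J1 s)"
    have x: "x > 0" unfolding x_def using neg E0 by (intro divide_pos_pos) auto
    have "\<exists>z. s - x < z \<and> z < s \<and> J s - J (s - x) = (s - (s - x)) * J1 z"
      by (rule MVT2) (use x dJ in auto)
    then obtain z where z: "z < s" "J s - J (s - x) = x * J1 z" by auto
    have "x * J1 z \<le> x * J1 s" using x z mono1[of z s] by (intro mult_left_mono) auto
    also have "x * J1 s = - (3 * E + 1)" using neg by (simp add: x_def)
    finally have "J s - J (s - x) \<le> - (3 * E + 1)" using z by simp
    moreover have "\<bar>J s\<bar> \<le> E" "\<bar>J (s - x)\<bar> \<le> E"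
      using Jb[of s] Jb[of "s - x"] s x mult_left_mono[OF _ E0, of "exp s" 1]
        mult_left_mono[OF _ E0, of "exp (s - x)" 1] by auto
    ultimately show False using E0 by linarith
  qed
  have "J 0 \<ge> - E * exp s" if s: "s \<le> 0" for s
  proof -
    have "J s \<le> J 0" by (rule DERIV_nonneg_imp_nondecreasing[OF s]) (use dJ J1 in metis)
    with Jb[OF s] show ?thesis by simp
  qed
  moreover have "((\<lambda>s. - E * exp s) \<longlongrightarrow> - E * 0) at_bot"
    by (intro tendsto_intros exp_at_bot)
  ultimately have "J 0 \<ge> - E * 0"
    by (intro tendsto_upperbound[of _ _ at_bot]) (auto simp: eventually_at_bot_linorder intro!: exI[of _ 0])
  then show ?thesis by (simp add: J_def \<psi>_def[abs_def] U_def V_def)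
qed

text \<open>With x = |w| and y = |Re w|, -2 \<open>Phi\<close> equals 2 x^p - x^(p-2) (p y)^2, and
  the mixed term is at most x^p + (p y)^p by comparing p y with x. Integrated against a nonnegative
  mean of \<open>Phi\<close>, this is the M. Riesz inequality with constant p.\<close>

lemma norm_powr_le_Phi:
  assumes p: "p > 2"
  shows "cmod w powr p \<le> (p * \<bar>Re w\<bar>) powr p - 2 * Phi ((p - 2) / 2) (p\<^sup>2 / 2 - 1) (Re w) (Im w)"
proof (cases "w = 0")
  case True
  with p show ?thesis by (simp add: Phi_def)
next
  case False
  define x where "x = cmod w"
  define y where "y = \<bar>Re w\<bar>"
  have x: "x > 0" using False by (simp add: x_def)
  have xx: "(Re w)\<^sup>2 + (Im w)\<^sup>2 = x\<^sup>2" by (simp add: x_def cmod_def)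
  have vv: "(Im w)\<^sup>2 = x\<^sup>2 - y\<^sup>2" using xx by (simp add: y_def)
  have sq: "z\<^sup>2 = z powr 2" if "z > 0" for z :: real using that by (simp add: powr_numeral)
  have "2 * ((p - 2) / 2) = p - 2" by simp
  then have "(x\<^sup>2) powr ((p - 2) / 2) = x powr (p - 2)"
    unfolding sq[OF x] powr_powr by (rule arg_cong)
  then have Phi: "Phi ((p - 2) / 2) (p\<^sup>2 / 2 - 1) (Re w) (Im w)
      = x powr (p - 2) * (p\<^sup>2 / 2 * y\<^sup>2 - x\<^sup>2)"
    unfolding Phi_def xx unfolding vv by (simp add: y_def algebra_simps)
  have xp: "x powr (p - 2) * x\<^sup>2 = x powr p"
    unfolding sq[OF x] powr_add[symmetric] by simp
  have "x powr (p - 2) * (p * y)\<^sup>2 \<le> x powr p + (p * y) powr p"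
  proof (cases "p * y \<le> x")
    case True
    have "x powr (p - 2) * (p * y)\<^sup>2 \<le> x powr (p - 2) * x\<^sup>2"
      using True p by (intro mult_left_mono power_mono) (auto simp: y_def)
    then show ?thesis using xp powr_ge_zero[of "p * y" p] by linarith
  next
    case False
    then have z: "p * y > 0" and le: "x \<le> p * y" using x by auto
    have "x powr (p - 2) * (p * y)\<^sup>2 \<le> (p * y) powr (p - 2) * (p * y)\<^sup>2"
      using le x p by (intro mult_right_mono powr_mono2) auto
    also have "\<dots> = (p * y) powr p" unfolding sq[OF z] powr_add[symmetric] by simp
    finally show ?thesis using powr_ge_zero[of x p] by linarith
  qed
  then have "x powr p \<le> (p * y) powr p - 2 * (x powr (p - 2) * (p\<^sup>2 / 2 * y\<^sup>2 - x\<^sup>2))"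
    unfolding right_diff_distrib xp by (simp add: power_mult_distrib)
  then show ?thesis unfolding Phi by (simp add: x_def y_def)
qed

text \<open>All frequencies are at least 1, so the extension to the left half-plane decays like exp
  s. A constant term would spoil the limit 0 of the means of \<open>Phi\<close>.\<close>

lemma riesz_analytic:
  fixes c :: "'i \<Rightarrow> complex" and n :: "'i \<Rightarrow> nat" and p :: real
  assumes I: "finite I" and n: "\<And>i. i \<in> I \<Longrightarrow> n i \<ge> 1" and p: "p > 6"
  defines "G \<equiv> \<lambda>t. \<Sum>i\<in>I. c i * cis (real (n i) * t)"
  shows "integral {0..2 * pi} (\<lambda>t. cmod (G t) powr p)
     \<le> p powr p * integral {0..2 * pi} (\<lambda>t. \<bar>Re (G t)\<bar> powr p)"
proof -
  define W where "W z = (\<Sum>i\<in>I. c i * exp (of_nat (n i) * z))" for z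
  define W' where "W' z = (\<Sum>i\<in>I. of_nat (n i) * c i * exp (of_nat (n i) * z))" for z
  define W'' where "W'' z = (\<Sum>i\<in>I. (of_nat (n i))\<^sup>2 * c i * exp (of_nat (n i) * z))" for z
  have GW: "W (Complex 0 t) = G t" for t
    unfolding W_def G_def by (intro sum.cong refl) (simp add: cis_conv_exp Complex_eq mult_ac)
  define q where "q = (p - 2) / 2"
  define a where "a = p\<^sup>2 / 2 - 1"
  have q: "q > 2" and a: "a = 2 * q\<^sup>2 + 4 * q + 1"
    using p by (auto simp: q_def a_def field_simps power2_eq_square)
  have per: "exp (of_nat m * Complex s (2 * pi)) = exp (of_nat m * Complex s 0)" for m s
  proof -
    have "of_nat m * Complex s (2 * pi) = of_nat m * Complex s 0 + of_int (int m) * (of_real (2 * pi) * \<i>)"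
      by (simp add: Complex_eq algebra_simps)
    then show ?thesis
      by (metis exp_plus_2pin mult.assoc mult.commute mult_2 of_real_mult of_real_numeral)
  qed
  have ge: "integral {0..2 * pi} (\<lambda>t. Phi q a (Re (W (Complex 0 t))) (Im (W (Complex 0 t)))) \<ge> 0"
  proof (rule Phi_mean_nonneg[where W' = W' and W'' = W'' and D = "\<Sum>i\<in>I. cmod (c i)"])
    show "(W has_field_derivative W' z) (at z)" for z
      unfolding W_def W'_def by (auto intro!: derivative_eq_intros sum.cong)
    show "(W' has_field_derivative W'' z) (at z)" for z
      unfolding W'_def W''_def by (auto intro!: derivative_eq_intros sum.cong simp: power2_eq_square)
    show "continuous_on UNIV W''" unfolding W''_def by (intro continuous_intros)
    show "W (Complex s (2 * pi)) = W (Complex s 0)" "W' (Complex s (2 * pi)) = W' (Complex s 0)" for s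
      unfolding W_def W'_def per by simp_all
    show "cmod (W (Complex s t)) \<le> (\<Sum>i\<in>I. cmod (c i)) * exp s" if s: "s \<le> 0" for s t
      unfolding W_def sum_distrib_right
    proof (rule sum_norm_le)
      fix i assume "i \<in> I"
      then have "real (n i) * s \<le> 1 * s" using n[of i] s by (intro mult_right_mono_neg) auto
      then show "cmod (c i * exp (of_nat (n i) * Complex s t)) \<le> cmod (c i) * exp s"
        by (auto simp: norm_mult intro!: mult_left_mono)
    qed
  qed (use q a in auto)
  have contG: "continuous_on A G" for A unfolding G_def cis_conv_exp by (intro continuous_intros)
  have i1: "(\<lambda>t. cmod (G t) powr p) integrable_on {0..2*pi}"
    and i2: "(\<lambda>t. (p * \<bar>Re (G t)\<bar>) powr p) integrable_on {0..2*pi}"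
    by (rule integrable_continuous_real, rule continuous_on_powr',
        use p in \<open>auto intro!: continuous_intros contG\<close>)+
  have i3: "(\<lambda>t. Phi q a (Re (G t)) (Im (G t))) integrable_on {0..2*pi}"
    by (intro integrable_continuous_real continuous_on_Phi q continuous_intros contG)
  have "integral {0..2 * pi} (\<lambda>t. cmod (G t) powr p)
    \<le> integral {0..2 * pi} (\<lambda>t. (p * \<bar>Re (G t)\<bar>) powr p - 2 * Phi q a (Re (G t)) (Im (G t)))"
    by (rule integral_le) (use i1 i2 i3 norm_powr_le_Phi p in
       \<open>auto simp: q_def a_def intro!: integrable_diff integrable_on_mult_right\<close>)
  also have "\<dots> = integral {0..2 * pi} (\<lambda>t. (p * \<bar>Re (G t)\<bar>) powr p)
      - 2 * integral {0..2 * pi} (\<lambda>t. Phi q a (Re (G t)) (Im (G t)))"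
    using i2 i3 by (subst integral_diff) (auto intro!: integrable_on_mult_right)
  also have "\<dots> \<le> integral {0..2 * pi} (\<lambda>t. (p * \<bar>Re (G t)\<bar>) powr p)"
    using ge by (simp add: GW)
  also have "(\<lambda>t. (p * \<bar>Re (G t)\<bar>) powr p) = (\<lambda>t. p powr p * \<bar>Re (G t)\<bar> powr p)"
    using p by (auto simp: powr_mult fun_eq_iff)
  finally show ?thesis by simp
qed

text \<open>Conjugating the negative frequencies turns a trigonometric polynomial h = A + B into an
  analytic one without changing its real part, so the analytic case applies. A unimodular factor e
  in front of h gives access to both the real and the imaginary part.\<close>

lemma riesz_trigonometric:
  fixes c :: "'i \<Rightarrow> complex" and n :: "'i \<Rightarrow> int" and p :: real
  assumes I: "finite I" and n: "\<And>i. i \<in> I \<Longrightarrow> n i \<noteq> 0" and p: "p > 6"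
  shows "integral {0..2 * pi} (\<lambda>t. cmod (\<Sum>i\<in>{i\<in>I. n i < 0}. c i * cis (of_int (n i) * t)) powr p)
     \<le> 2 * p powr p * integral {0..2 * pi} (\<lambda>t. cmod (\<Sum>i\<in>I. c i * cis (of_int (n i) * t)) powr p)"
proof -
  define h where "h t = (\<Sum>i\<in>I. c i * cis (of_int (n i) * t))" for t
  define A where "A t = (\<Sum>i\<in>{i\<in>I. n i < 0}. c i * cis (of_int (n i) * t))" for t
  define B where "B t = (\<Sum>i\<in>{i\<in>I. \<not> n i < 0}. c i * cis (of_int (n i) * t))" for t
  \<comment> \<open>G e = cnj (e A) + e B has only positive frequencies, and Re (G e) = Re (e
    h).\<close>
  define G where "G e t = (\<Sum>i\<in>I. (if n i < 0 then cnj (e * c i) else e * c i) * cis (real (nat \<bar>n i\<bar>) * t))" for e t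
  have hAB: "h t = A t + B t" for t
    unfolding h_def A_def B_def using I
    by (subst sum.union_disjoint[symmetric]) (auto intro!: sum.cong)
  have G: "G e t = cnj (e * A t) + e * B t" for e t
  proof -
    have "G e t = (\<Sum>i\<in>I. (if n i < 0 then cnj (e * (c i * cis (of_int (n i) * t)))
         else e * (c i * cis (of_int (n i) * t))))"
      unfolding G_def by (intro sum.cong refl) (auto simp: cis_cnj)
    also have "\<dots> = cnj (e * A t) + e * B t"
      unfolding A_def B_def using I by (simp add: sum.If_cases Int_def sum_distrib_left Compl_eq)
    finally show ?thesis .
  qed
  have contG: "continuous_on S (G e)" for S e
    unfolding G_def cis_conv_exp by (intro continuous_intros)
  have conth: "continuous_on S h" "continuous_on S A" for S
    unfolding h_def A_def cis_conv_exp by (intro continuous_intros)+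
  have ic: "(\<lambda>t. \<bar>f t\<bar> powr p) integrable_on {0..2*pi}" if "\<And>S. continuous_on S f" for f :: "real \<Rightarrow> real"
    by (rule integrable_continuous_real, rule continuous_on_powr')
       (use p that in \<open>auto intro!: continuous_intros\<close>)
  have ih: "(\<lambda>t. cmod (h t) powr p) integrable_on {0..2*pi}"
    and iA: "(\<lambda>t. cmod (A t) powr p) integrable_on {0..2*pi}"
    and iG: "(\<lambda>t. cmod (G e t) powr p) integrable_on {0..2*pi}"
    and iR: "(\<lambda>t. \<bar>Re (G e t)\<bar> powr p) integrable_on {0..2*pi}" for e
    using ic[of "\<lambda>t. cmod (h t)"] ic[of "\<lambda>t. cmod (A t)"] ic[of "\<lambda>t. cmod (G e t)"] ic[of "\<lambda>t. Re (G e t)"]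
      conth contG by (auto intro!: continuous_intros)
  have Gb: "integral {0..2 * pi} (\<lambda>t. cmod (G e t) powr p) \<le> p powr p * integral {0..2 * pi} (\<lambda>t. cmod (h t) powr p)"
    if e: "cmod e = 1" for e
  proof -
    have "integral {0..2 * pi} (\<lambda>t. cmod (G e t) powr p)
       \<le> p powr p * integral {0..2 * pi} (\<lambda>t. \<bar>Re (G e t)\<bar> powr p)"
      unfolding G_def by (rule riesz_analytic[OF I]) (use n p in \<open>auto simp: Suc_le_eq\<close>)
    also have "integral {0..2 * pi} (\<lambda>t. \<bar>Re (G e t)\<bar> powr p) \<le> integral {0..2 * pi} (\<lambda>t. cmod (h t) powr p)"
    proof (intro integral_le iR ih powr_mono2)
      fix t
      have "Re (G e t) = Re (e * h t)" unfolding G hAB by (simp add: algebra_simps)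
      also have "\<bar>\<dots>\<bar> \<le> cmod (e * h t)" by (rule abs_Re_le_cmod)
      finally show "\<bar>Re (G e t)\<bar> \<le> cmod (h t)" using e by (simp add: norm_mult)
    qed (use p in auto)
    finally show ?thesis by (simp add: mult_left_mono)
  qed
  have "integral {0..2 * pi} (\<lambda>t. cmod (A t) powr p)
     \<le> integral {0..2 * pi} (\<lambda>t. cmod (G 1 t) powr p + cmod (G \<i> t) powr p)"
  proof (intro integral_le iA integrable_add iG)
    fix t
    \<comment> \<open>Hence |A| is at most the larger of |G 1| and |G i|. Bounding the maximum of
      the p-th powers by their sum produces the factor 2.\<close>
    have "2 * cnj (A t) = G 1 t + \<i> * G \<i> t" unfolding G by (simp add: algebra_simps)
    then have "cmod (2 * cnj (A t)) \<le> cmod (G 1 t) + cmod (G \<i> t)"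
      using norm_triangle_ineq[of "G 1 t" "\<i> * G \<i> t"] by (simp add: norm_mult)
    then have "cmod (A t) \<le> cmod (G 1 t) \<or> cmod (A t) \<le> cmod (G \<i> t)" by (auto simp: norm_mult)
    then have "cmod (A t) powr p \<le> cmod (G 1 t) powr p \<or> cmod (A t) powr p \<le> cmod (G \<i> t) powr p"
      using p by (auto intro: powr_mono2)
    then show "cmod (A t) powr p \<le> cmod (G 1 t) powr p + cmod (G \<i> t) powr p"
      by (auto intro: order_trans)
  qed
  also have "\<dots> = integral {0..2 * pi} (\<lambda>t. cmod (G 1 t) powr p) + integral {0..2 * pi} (\<lambda>t. cmod (G \<i> t) powr p)"
    by (rule integral_add[OF iG iG])
  also have "\<dots> \<le> p powr p * integral {0..2 * pi} (\<lambda>t. cmod (h t) powr p)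
      + p powr p * integral {0..2 * pi} (\<lambda>t. cmod (h t) powr p)"
    by (intro add_mono Gb) auto
  finally show ?thesis by (simp add: A_def h_def)
qed

section \<open>Sums over primes\<close>

definition primes_upto :: "real \<Rightarrow> nat set" where
  "primes_upto x = {p. prime p \<and> real p \<le> x}"

text \<open>The cap J on the exponents keeps the set finite for finite P, so that a truncated Euler
  product is a finite sum. The cap is removed by letting J tend to infinity.\<close>

definition smooth_nats :: "nat set \<Rightarrow> nat \<Rightarrow> nat set" where
  "smooth_nats P J = {n. n > 0 \<and> prime_factors n \<subseteq> P \<and> (\<forall>p\<in>P. multiplicity p n \<le> J)}"

lemma finite_primes_upto [simp]: "finite (primes_upto x)"
proof (rule finite_subset)
  show "primes_upto x \<subseteq> {..nat \<lfloor>x\<rfloor>}" by (auto simp: primes_upto_def le_nat_floor)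
qed simp

lemma prime_primes_upto: "p \<in> primes_upto x \<Longrightarrow> prime p"
  by (simp add: primes_upto_def)

lemma prod_multiplicity:
  fixes h :: "nat \<Rightarrow> 'c::comm_monoid_mult"
  assumes "finite P" "\<And>p. p \<in> P \<Longrightarrow> prime p" "n > 0" "prime_factors n \<subseteq> P"
  shows "(\<Prod>p\<in>P. h p ^ multiplicity p n) = (\<Prod>p\<in>prime_factors n. h p ^ multiplicity p n)"
proof (rule prod.mono_neutral_right)
  show "\<forall>p\<in>P - prime_factors n. h p ^ multiplicity p n = 1"
    using assms by (auto simp: prime_factors_multiplicity)
qed (use assms in auto)

text \<open>Unique factorisation: exponent vectors on P with entries up to J correspond to the
  elements of \<open>smooth_nats\<close>. The general \<open>\<phi>\<close> serves both the real
  sums over primes and the random Euler products.\<close>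

lemma prod_sum_smooth_nats:
  fixes \<phi> :: "nat \<Rightarrow> nat \<Rightarrow> 'c::comm_semiring_1"
  assumes P: "finite P" "\<And>p. p \<in> P \<Longrightarrow> prime p"
  shows "(\<Prod>p\<in>P. \<Sum>j\<le>J. \<phi> p j) = (\<Sum>n\<in>smooth_nats P J. \<Prod>p\<in>P. \<phi> p (multiplicity p n))"
proof -
  define N where "N g = (\<Prod>p\<in>P. p ^ g p)" for g :: "nat \<Rightarrow> nat"
  have mult: "multiplicity p (N g) = (if p \<in> P then g p else 0)" if "prime p" for p g
    unfolding N_def by (rule multiplicity_prod_prime_powers) (use P that in auto)
  have pos: "N g > 0" for g unfolding N_def using P by (auto intro!: prod_pos simp: prime_gt_0_nat)
  have N: "N (restrict (\<lambda>p. multiplicity p n) P) = n" if "n \<in> smooth_nats P J" for n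
  proof -
    have n: "n > 0" "prime_factors n \<subseteq> P" using that by (auto simp: smooth_nats_def)
    have "N (restrict (\<lambda>p. multiplicity p n) P) = (\<Prod>p\<in>P. p ^ multiplicity p n)"
      unfolding N_def by (intro prod.cong) auto
    also have "\<dots> = (\<Prod>p\<in>prime_factors n. p ^ multiplicity p n)"
      by (rule prod_multiplicity) (use P n in auto)
    also have "\<dots> = n" using prod_prime_factors[of n] n by simp
    finally show ?thesis .
  qed
  have "(\<Prod>p\<in>P. \<Sum>j\<le>J. \<phi> p j) = (\<Sum>g\<in>PiE P (\<lambda>_. {..J}). \<Prod>p\<in>P. \<phi> p (g p))"
    by (rule prod_sum_PiE) (use P in auto)
  also have "\<dots> = (\<Sum>n\<in>smooth_nats P J. \<Prod>p\<in>P. \<phi> p (multiplicity p n))"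
  proof (rule sum.reindex_bij_witness[where i = "\<lambda>n. restrict (\<lambda>p. multiplicity p n) P" and j = N])
    fix g assume g: "g \<in> PiE P (\<lambda>_. {..J})"
    show "restrict (\<lambda>p. multiplicity p (N g)) P = g"
      using g P by (auto simp: fun_eq_iff mult PiE_def extensional_def)
    show "N g \<in> smooth_nats P J"
      using g P pos mult by (auto simp: smooth_nats_def prime_factors_multiplicity split: if_splits)
    show "(\<Prod>p\<in>P. \<phi> p (multiplicity p (N g))) = (\<Prod>p\<in>P. \<phi> p (g p))"
      using P by (intro prod.cong) (auto simp: mult)
  next
    fix n assume n: "n \<in> smooth_nats P J"
    then show "restrict (\<lambda>p. multiplicity p n) P \<in> PiE P (\<lambda>_. {..J})"
      by (auto simp: smooth_nats_def)
  qed (use N in auto)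
  finally show ?thesis .
qed

lemma finite_smooth_nats:
  assumes P: "finite P" "\<And>p. p \<in> P \<Longrightarrow> prime p"
  shows "finite (smooth_nats P J)"
proof (rule finite_subset)
  show "smooth_nats P J \<subseteq> {..(\<Prod>p\<in>P. p ^ J)}"
  proof
    fix n assume "n \<in> smooth_nats P J"
    then have n: "n > 0" "prime_factors n \<subseteq> P" "\<And>p. p \<in> P \<Longrightarrow> multiplicity p n \<le> J"
      by (auto simp: smooth_nats_def)
    have "n = (\<Prod>p\<in>P. p ^ multiplicity p n)"
      using prod_prime_factors[of n] prod_multiplicity[of P n "\<lambda>p. p"] P n by simp
    also have "\<dots> \<le> (\<Prod>p\<in>P. p ^ J)"
      using P n by (intro prod_mono conjI power_increasing) (auto simp: Suc_le_eq prime_gt_0_nat)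
    finally show "n \<in> {..(\<Prod>p\<in>P. p ^ J)}" by simp
  qed
qed simp

lemma prod_powr_multiplicity:
  assumes "finite P" "\<And>p. p \<in> P \<Longrightarrow> prime p" "n > 0" "prime_factors n \<subseteq> P"
  shows "(\<Prod>p\<in>P. (real p powr s) ^ multiplicity p n) = real n powr s"
proof -
  have "real n powr s = real (\<Prod>p\<in>P. p ^ multiplicity p n) powr s"
    using prod_prime_factors[of n] prod_multiplicity[of P n "\<lambda>p. p"] assms by simp
  also have "\<dots> = (\<Prod>p\<in>P. (real p powr s) ^ multiplicity p n)"
    by (simp add: prod_powr_distrib powr_realpow[symmetric] powr_powr mult.commute prime_gt_0_nat assms powr_power
        cong: prod.cong)
  finally show ?thesis by simp
qed

text \<open>The cap J >= N never interferes, because the multiplicity of a prime in n is less than 2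
  to that multiplicity, hence less than n.\<close>

lemma atLeastAtMost_subset_smooth_nats:
  assumes "J \<ge> N" "real N \<le> x"
  shows "{1..N} \<subseteq> smooth_nats (primes_upto x) J"
proof
  fix n assume n: "n \<in> {1..N}"
  have "prime_factors n \<subseteq> primes_upto x"
  proof
    fix p assume "p \<in> prime_factors n"
    then have "prime p" "p \<le> n" using n by (auto intro: dvd_imp_le in_prime_factors_imp_dvd)
    then show "p \<in> primes_upto x" using n assms by (auto simp: primes_upto_def)
  qed
  moreover have "multiplicity p n \<le> J" if "p \<in> primes_upto x" for p
  proof -
    have "multiplicity p n < 2 ^ multiplicity p n" by (rule less_exp)
    also have "\<dots> \<le> p ^ multiplicity p n"
      using that by (intro power_mono) (auto simp: primes_upto_def prime_ge_2_nat)
    also have "\<dots> \<le> n" using n by (intro dvd_imp_le multiplicity_dvd) auto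
    finally show ?thesis using n assms by simp
  qed
  ultimately show "n \<in> smooth_nats (primes_upto x) J" using n by (auto simp: smooth_nats_def)
qed

section \<open>Mertens-type estimates for sums over primes\<close>

lemma sum_powr_le_zeta:
  fixes s :: real
  assumes "s > 0" "N \<ge> 1"
  shows "(\<Sum>n=1..N. real n powr (-1 - s)) \<le> 1 + 1 / s - real N powr (- s) / s"
  using assms(2)
proof (induction N rule: dec_induct)
  case base
  then show ?case by simp
next
  case (step N)
  \<comment> \<open>An antiderivative of x^(-1-s). The term N^(-s)/s in the bound is the tail of the
    integral, which lets the induction close.\<close>
  define g where "g x = - (x powr (- s) / s)" for x :: real
  have eq: "- s - 1 = - 1 - s" by simp
  have "\<exists>z. real N < z \<and> z < real N + 1 \<and> g (real N + 1) - g (real N) = (real N + 1 - real N) * z powr (- 1 - s)"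
  proof (rule MVT2)
    fix x assume "real N \<le> x"
    then show "(g has_real_derivative x powr (- 1 - s)) (at x)"
      unfolding g_def using step assms
      by (auto intro!: derivative_eq_intros simp: divide_simps eq)
  qed simp
  then obtain z where z: "real N < z" "z < real N + 1" "g (real N + 1) - g (real N) = z powr (- 1 - s)"
    by auto
  have "(real N + 1) powr (- 1 - s) \<le> z powr (- 1 - s)"
    using z assms by (intro powr_mono2') auto
  with z(3) step show ?case by (simp add: g_def add.commute)
qed

text \<open>The finite Euler product over P is at most zeta(1 + s) <= 1 + 1/s. Taking logarithms and
  using -ln (1 - x) >= x gives the claim.\<close>

lemma sum_primes_powr_le:
  assumes P: "finite P" "\<And>p. p \<in> P \<Longrightarrow> prime p" and s: "s > 0"
  shows "(\<Sum>p\<in>P. real p powr (-1 - s)) \<le> ln (1 + 1 / s)"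
proof -
  define x where "x p = real p powr (-1 - s)" for p :: nat
  have x: "0 < x p" "x p < 1" if "p \<in> P" for p
  proof -
    have "real p > 1" using P(2)[OF that] prime_gt_1_nat by simp
    then show "0 < x p" "x p < 1" using s by (auto simp: x_def powr_less_one)
  qed
  have "(\<Prod>p\<in>P. \<Sum>j\<le>J. x p ^ j) \<le> 1 + 1 / s" for J
  proof -
    have "(\<Prod>p\<in>P. \<Sum>j\<le>J. x p ^ j) = (\<Sum>n\<in>smooth_nats P J. \<Prod>p\<in>P. x p ^ multiplicity p n)"
      by (rule prod_sum_smooth_nats[OF P])
    also have "\<dots> = (\<Sum>n\<in>smooth_nats P J. real n powr (-1 - s))"
      unfolding x_def by (intro sum.cong refl prod_powr_multiplicity P) (auto simp: smooth_nats_def)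
    finally have eq: "(\<Prod>p\<in>P. \<Sum>j\<le>J. x p ^ j) = (\<Sum>n\<in>smooth_nats P J. real n powr (-1 - s))" .
    obtain N where N: "smooth_nats P J \<subseteq> {1..N}" "N \<ge> 1"
    proof
      define N where "N = Suc (Max (smooth_nats P J))"
      show "smooth_nats P J \<subseteq> {1..N}"
      proof
        fix n assume n: "n \<in> smooth_nats P J"
        then have "n \<le> Max (smooth_nats P J)" using finite_smooth_nats[OF P] by (intro Max_ge) auto
        then show "n \<in> {1..N}" using n by (auto simp: N_def smooth_nats_def)
      qed
      show "N \<ge> 1" by (simp add: N_def)
    qed
    have "(\<Sum>n\<in>smooth_nats P J. real n powr (-1 - s)) \<le> (\<Sum>n=1..N. real n powr (-1 - s))"
      using N by (intro sum_mono2) auto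
    also have "\<dots> \<le> 1 + 1 / s - real N powr (- s) / s" using s N by (intro sum_powr_le_zeta)
    also have "\<dots> \<le> 1 + 1 / s" using s by simp
    finally show ?thesis unfolding eq .
  qed
  moreover have "(\<lambda>J. \<Prod>p\<in>P. \<Sum>j\<le>J. x p ^ j) \<longlonglongrightarrow> (\<Prod>p\<in>P. 1 / (1 - x p))"
    using x by (intro tendsto_prod geometric_sums[unfolded sums_def_le]) (auto simp: abs_less_iff intro: less_trans[of _ 0])
  ultimately have "(\<Prod>p\<in>P. 1 / (1 - x p)) \<le> 1 + 1 / s"
    by (intro LIMSEQ_le_const2) auto
  moreover have pos: "(\<Prod>p\<in>P. 1 / (1 - x p)) > 0" using x by (intro prod_pos) auto
  ultimately have "ln (\<Prod>p\<in>P. 1 / (1 - x p)) \<le> ln (1 + 1 / s)"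
    by simp
  also have "ln (\<Prod>p\<in>P. 1 / (1 - x p)) = (\<Sum>p\<in>P. ln (1 / (1 - x p)))"
    using x P by (intro ln_prod) (auto simp: less_imp_neq)
  also have "\<dots> \<ge> (\<Sum>p\<in>P. x p)"
  proof (rule sum_mono)
    fix p assume p: "p \<in> P"
    show "x p \<le> ln (1 / (1 - x p))"
      using x[OF p] ln_le_minus_one[of "1 - x p"] by (simp add: ln_div)
  qed
  finally show ?thesis by (simp add: x_def)
qed

lemma sum_inverse_squares_le:
  assumes "M \<ge> 1"
  shows "(\<Sum>n\<in>{M<..N}. 1 / (real n)\<^sup>2) \<le> 1 / real M"
proof -
  have "(\<Sum>n\<in>{M<..N}. 1 / (real n)\<^sup>2) \<le> 1 / real M - 1 / real N" if "N \<ge> M"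
    using that
  proof (induction N rule: dec_induct)
    case (step N)
    have "{M<..Suc N} = insert (Suc N) {M<..N}" using step by auto
    then have "(\<Sum>n\<in>{M<..Suc N}. 1 / (real n)\<^sup>2)
        \<le> 1 / (real N + 1)\<^sup>2 + (1 / real M - 1 / real N)"
      using step by (simp add: add.commute)
    also have "1 / (real N + 1)\<^sup>2 \<le> 1 / (real N * (real N + 1))"
      using step assms by (intro divide_left_mono) (auto simp: power2_eq_square)
    also have "1 / (real N * (real N + 1)) = 1 / real N - 1 / (real N + 1)"
      using step assms by (simp add: field_simps)
    finally show ?case by (simp add: add.commute)
  qed simp
  then show ?thesis by (cases "N \<ge> M") (auto intro: order_trans)
qed

text \<open>Euler's argument: the harmonic sum up to x is dominated by the product of 1 / (1 - 1/p).
  The constant 2 comes from -ln (1 - y) <= y + 2 y^2 and from the sum of 1/n^2 over n > 1 being at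
  most 1.\<close>

lemma sum_primes_inverse_ge:
  assumes x: "x \<ge> 2"
  shows "(\<Sum>p\<in>primes_upto x. 1 / real p) \<ge> ln (ln x) - 2"
proof -
  define N where "N = nat \<lfloor>x\<rfloor>"
  have N: "real N \<le> x" "x < real N + 1" using x by (auto simp: N_def)
  let ?P = "primes_upto x"
  have y: "0 < 1 / real p" "1 / real p \<le> 1 / 2" if "p \<in> ?P" for p
    using prime_ge_2_nat[OF prime_primes_upto[OF that]] by (auto simp: field_simps)
  have "ln x \<le> ln (real N + 1)" using N x by simp
  also have "\<dots> \<le> harm N" by (rule ln_le_harm)
  also have "\<dots> = (\<Sum>n=1..N. real n powr (-1))" by (simp add: harm_def powr_minus)
  also have "\<dots> \<le> (\<Sum>n\<in>smooth_nats ?P N. real n powr (-1))"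
    using N by (intro sum_mono2 finite_smooth_nats atLeastAtMost_subset_smooth_nats)
      (auto simp: prime_primes_upto)
  also have "\<dots> = (\<Sum>n\<in>smooth_nats ?P N. \<Prod>p\<in>?P. (real p powr (-1)) ^ multiplicity p n)"
    by (intro sum.cong refl prod_powr_multiplicity[symmetric]) (auto simp: smooth_nats_def prime_primes_upto)
  also have "\<dots> = (\<Prod>p\<in>?P. \<Sum>j\<le>N. (real p powr (-1)) ^ j)"
    by (rule prod_sum_smooth_nats[symmetric]) (auto simp: prime_primes_upto)
  also have "\<dots> \<le> (\<Prod>p\<in>?P. 1 / (1 - 1 / real p))"
  proof (intro prod_mono conjI sum_nonneg)
    fix p assume p: "p \<in> ?P"
    have "(\<Sum>j\<le>N. (1 / real p) ^ j) \<le> (\<Sum>j. (1 / real p) ^ j)"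
      by (rule sum_le_suminf[OF summable_geometric]) (use y[OF p] in auto)
    also have "\<dots> = 1 / (1 - 1 / real p)" by (rule suminf_geometric) (use y[OF p] in auto)
    finally show "(\<Sum>j\<le>N. (real p powr (-1)) ^ j) \<le> 1 / (1 - 1 / real p)"
      by (simp add: powr_minus inverse_eq_divide)
  qed auto
  finally have "ln (ln x) \<le> ln (\<Prod>p\<in>?P. 1 / (1 - 1 / real p))"
    using x by (subst ln_le_cancel_iff) (auto intro: less_le_trans[of _ "ln x"])
  also have "\<dots> = (\<Sum>p\<in>?P. ln (1 / (1 - 1 / real p)))"
  proof (rule ln_prod)
    show "1 / (1 - 1 / real p) \<noteq> 0" if "p \<in> ?P" for p using y[OF that] by simp
  qed simp
  also have "\<dots> \<le> (\<Sum>p\<in>?P. 1 / real p + 2 * (1 / (real p)\<^sup>2))"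
  proof (rule sum_mono)
    fix p assume p: "p \<in> ?P"
    show "ln (1 / (1 - 1 / real p)) \<le> 1 / real p + 2 * (1 / (real p)\<^sup>2)"
      using y[OF p] ln_one_minus_pos_lower_bound[of "1 / real p"]
      by (simp add: ln_div power_divide)
  qed
  also have "\<dots> = (\<Sum>p\<in>?P. 1 / real p) + 2 * (\<Sum>p\<in>?P. 1 / (real p)\<^sup>2)"
    by (simp add: sum.distrib sum_distrib_left)
  also have "(\<Sum>p\<in>?P. 1 / (real p)\<^sup>2) \<le> (\<Sum>n\<in>{1<..N}. 1 / (real n)\<^sup>2)"
    by (intro sum_mono2) (auto simp: primes_upto_def N_def le_nat_floor prime_gt_Suc_0_nat)
  also have "\<dots> \<le> 1" using sum_inverse_squares_le[of 1 N] by simp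
  finally show ?thesis by simp
qed

text \<open>Double counting: the sum of ln p over pairs p | m with m <= N is at most N ln N, since
  the primes dividing m multiply to at most m. The factor 2 is the price of replacing N/p by its
  integer part, which is at least 1.\<close>

lemma sum_primes_ln_div_le:
  assumes x: "x \<ge> 1"
  shows "(\<Sum>p\<in>primes_upto x. ln (real p) / real p) \<le> 2 * ln x"
proof -
  define N where "N = nat \<lfloor>x\<rfloor>"
  have N: "real N \<le> x" "N \<ge> 1" using x by (auto simp: N_def le_nat_floor)
  let ?P = "primes_upto x"
  have PN: "p \<in> ?P \<longleftrightarrow> prime p \<and> p \<le> N" for p
    using x N(1) by (auto simp: primes_upto_def N_def intro: le_nat_floor order_trans[OF of_nat_mono])
  have "(\<Sum>p\<in>?P. ln (real p) / real p) * real N \<le> 2 * (\<Sum>p\<in>?P. ln (real p) * real (N div p))"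
    unfolding sum_distrib_right sum_distrib_left
  proof (rule sum_mono)
    fix p assume "p \<in> ?P"
    then have p: "p \<le> N" "p > 1" by (auto simp: PN prime_gt_Suc_0_nat)
    have "N div p \<ge> 1" using p by (simp add: div_greater_zero_iff Suc_le_eq)
    then have "p \<le> p * (N div p)" by simp
    moreover have "N = p * (N div p) + N mod p" "N mod p < p" using p by simp_all
    ultimately have "N \<le> 2 * (p * (N div p))" by linarith
    then have "real N \<le> 2 * (real p * real (N div p))" by (metis of_nat_le_iff of_nat_mult of_nat_numeral)
    then have "real N / real p \<le> 2 * real (N div p)" using p by (simp add: field_simps)
    then have "ln (real p) * (real N / real p) \<le> ln (real p) * (2 * real (N div p))"
      using p by (intro mult_left_mono) auto
    then show "ln (real p) / real p * real N \<le> 2 * (ln (real p) * real (N div p))" by simp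
  qed
  also have "(\<Sum>p\<in>?P. ln (real p) * real (N div p)) = (\<Sum>p\<in>?P. \<Sum>m | m \<in> {1..N} \<and> p dvd m. ln (real p))"
  proof (rule sum.cong[OF refl])
    fix p assume "p \<in> ?P"
    then have p: "p > 0" by (auto simp: PN prime_gt_0_nat)
    have "{m. m \<in> {1..N} \<and> p dvd m} = (\<lambda>i. p * i) ` {1..N div p}"
    proof (intro set_eqI iffI)
      fix m assume "m \<in> {m. m \<in> {1..N} \<and> p dvd m}"
      then obtain i where "m = p * i" "m \<ge> 1" "m \<le> N" by auto
      then show "m \<in> (\<lambda>i. p * i) ` {1..N div p}"
        using p by (intro image_eqI[of _ _ i]) (auto simp: less_eq_div_iff_mult_less_eq mult.commute Suc_le_eq)
    next
      fix m assume "m \<in> (\<lambda>i. p * i) ` {1..N div p}"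
      then show "m \<in> {m. m \<in> {1..N} \<and> p dvd m}"
        using p by (auto simp: less_eq_div_iff_mult_less_eq mult.commute Suc_le_eq)
    qed
    then have "card {m. m \<in> {1..N} \<and> p dvd m} = N div p"
      using p by (simp add: card_image inj_on_def)
    then show "ln (real p) * real (N div p) = (\<Sum>m | m \<in> {1..N} \<and> p dvd m. ln (real p))"
      by simp
  qed
  also have "\<dots> = (\<Sum>m\<in>{1..N}. \<Sum>p | p \<in> ?P \<and> p dvd m. ln (real p))"
    by (rule sum.swap_restrict) auto
  also have "\<dots> \<le> (\<Sum>m\<in>{1..N}. ln (real N))"
  proof (rule sum_mono)
    fix m assume m: "m \<in> {1..N}"
    have eq: "{p. p \<in> ?P \<and> p dvd m} = prime_factors m"
      using m by (auto simp: PN prime_factors_dvd dest: dvd_imp_le)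
    have "(\<Sum>p\<in>prime_factors m. ln (real p)) = ln (\<Prod>p\<in>prime_factors m. real p)"
      by (subst ln_prod) (auto intro!: prime_gt_0_nat)
    also have "\<dots> \<le> ln (real m)"
    proof -
      have "(\<Prod>p\<in>prime_factors m. p) \<le> (\<Prod>p\<in>prime_factors m. p ^ multiplicity p m)"
        using m by (intro prod_mono conjI self_le_power)
          (auto simp: prime_factors_multiplicity prime_gt_0_nat Suc_le_eq)
      also have "\<dots> = m" using prod_prime_factors[of m] m by simp
      finally have "(\<Prod>p\<in>prime_factors m. real p) \<le> real m"
        by (simp flip: of_nat_prod)
      moreover have "(\<Prod>p\<in>prime_factors m. real p) > 0"
        by (intro prod_pos) (auto intro!: prime_gt_0_nat)
      ultimately show ?thesis by simp
    qed
    also have "\<dots> \<le> ln (real N)" using m by simp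
    finally show "(\<Sum>p | p \<in> ?P \<and> p dvd m. ln (real p)) \<le> ln (real N)" unfolding eq .
  qed
  also have "\<dots> = ln (real N) * real N" by simp
  finally have "(\<Sum>p\<in>?P. ln (real p) / real p) * real N \<le> 2 * ln (real N) * real N" by simp
  then have "(\<Sum>p\<in>?P. ln (real p) / real p) \<le> 2 * ln (real N)" using N by simp
  also have "\<dots> \<le> 2 * ln x" using N by simp
  finally show ?thesis .
qed

lemma powr_minus_ge_linear:
  fixes p s :: real
  assumes "p \<ge> 1"
  shows "1 - s * ln p \<le> p powr (- s)"
  using exp_ge_add_one_self[of "- s * ln p"] assms by (simp add: powr_def)

text \<open>Linearising p^(-s) >= 1 - s ln p reduces the loss to s times the sum of ln p /
  p.\<close>

lemma sum_primes_upto_powr_ge: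
  assumes w: "w \<ge> 2" and s: "s \<ge> 0"
  shows "(\<Sum>p\<in>primes_upto w. real p powr (-1 - s)) \<ge> (\<Sum>p\<in>primes_upto w. 1 / real p) - 2 * s * ln w"
proof -
  have "(\<Sum>p\<in>primes_upto w. 1 / real p) - s * (\<Sum>p\<in>primes_upto w. ln (real p) / real p)
     = (\<Sum>p\<in>primes_upto w. 1 / real p * (1 - s * ln (real p)))"
    by (simp add: sum_distrib_left sum_subtractf[symmetric] algebra_simps)
  also have "\<dots> \<le> (\<Sum>p\<in>primes_upto w. real p powr (-1 - s))"
  proof (rule sum_mono)
    fix p assume "p \<in> primes_upto w"
    then have p: "real p \<ge> 1" using prime_ge_1_nat[OF prime_primes_upto] by simp
    have "1 / real p * (1 - s * ln (real p)) \<le> 1 / real p * real p powr (- s)"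
      using powr_minus_ge_linear[OF p] by (intro mult_left_mono) auto
    also have "\<dots> = real p powr (-1 - s)" using p by (simp add: powr_diff powr_minus field_simps)
    finally show "1 / real p * (1 - s * ln (real p)) \<le> real p powr (-1 - s)" .
  qed
  finally show ?thesis
    using mult_left_mono[OF sum_primes_ln_div_le[of w] s] w by simp
qed

text \<open>With the shift 1 / ln w, passing from 1/p to p^(-1-s) costs only 2, and the zeta bound
  becomes ln (1 + ln w).\<close>

lemma sum_primes_inverse_le:
  assumes w2: "w \<ge> 2" and w: "ln w \<ge> 1"
  shows "(\<Sum>p\<in>primes_upto w. 1 / real p) \<le> ln (ln w) + 3"
proof -
  have "(\<Sum>p\<in>primes_upto w. 1 / real p) \<le> (\<Sum>p\<in>primes_upto w. real p powr (-1 - 1 / ln w)) + 2"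
    using sum_primes_upto_powr_ge[OF w2, of "1 / ln w"] w by simp
  also have "(\<Sum>p\<in>primes_upto w. real p powr (-1 - 1 / ln w)) \<le> ln (1 + 1 / (1 / ln w))"
    using w by (intro sum_primes_powr_le) (auto simp: prime_primes_upto)
  also have "ln (1 + 1 / (1 / ln w)) \<le> ln (2 * ln w)" using w by simp
  also have "\<dots> = ln 2 + ln (ln w)" using w by (subst ln_mult) auto
  finally show ?thesis using ln_2_less_1 by linarith
qed

text \<open>The primes up to w may be added to P without changing the part above w, so that part is
  a zeta bound minus the full sum up to w. The 7 is 1 + 2 + 4, where 4 bounds 4 s ln w.\<close>

lemma sum_primes_powr_above_le:
  assumes P: "finite P" "\<And>p. p \<in> P \<Longrightarrow> prime p"
    and w: "w \<ge> 2" and s: "0 < s" "s \<le> 1" "s * ln w \<le> 1"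
  shows "(\<Sum>p\<in>P - primes_upto w. real p powr (-1 - 2 * s)) \<le> ln (1 / s) - ln (ln w) + 7"
proof -
  let ?g = "\<lambda>p. real p powr (-1 - 2 * s)"
  have "sum ?g (P - primes_upto w) + sum ?g (primes_upto w) = sum ?g (P \<union> primes_upto w)"
    using P by (subst sum.union_disjoint[symmetric]) (auto intro!: sum.cong)
  also have "\<dots> \<le> ln (1 + 1 / (2 * s))"
    using P s by (intro sum_primes_powr_le) (auto simp: prime_primes_upto)
  also have "\<dots> \<le> ln (2 * (1 / s))" using s by (subst ln_le_cancel_iff) (auto simp: field_simps intro: add_pos_pos)
  also have "\<dots> = ln 2 + ln (1 / s)" using s by (subst ln_mult) auto
  finally have "sum ?g (P - primes_upto w) + sum ?g (primes_upto w) \<le> 1 + ln (1 / s)"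
    using ln_2_less_1 by linarith
  moreover have "sum ?g (primes_upto w) \<ge> ln (ln w) - 6"
    using sum_primes_upto_powr_ge[OF w, of "2 * s"] sum_primes_inverse_ge[OF w] s by simp
  ultimately show ?thesis by linarith
qed

text \<open>If w lies beyond exp (1/s), the cut-off is lowered to exp (1/s), where the two
  logarithms cancel and O(1) remains.\<close>

lemma sum_primes_powr_above_le':
  assumes P: "finite P" "\<And>p. p \<in> P \<Longrightarrow> prime p"
    and w: "w \<ge> 2" and s: "0 < s" "s \<le> 1"
  shows "(\<Sum>p\<in>P - primes_upto w. real p powr (-1 - 2 * s)) \<le> max 0 (ln (1 / s) - ln (ln w)) + 7"
proof (cases "s * ln w \<le> 1")
  case True
  show ?thesis using sum_primes_powr_above_le[OF P w s True] by simp
next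
  case False
  have e: "exp (1 / s) \<ge> 2" using exp_ge_add_one_self[of "1 / s"] le_divide_eq_1_pos[OF s(1), of 1] s(2) by linarith
  have "1 / s \<le> ln w" using False s by (simp add: field_simps)
  then have "exp (1 / s) \<le> w" using w by (subst ln_ge_iff[symmetric]) auto
  then have "(\<Sum>p\<in>P - primes_upto w. real p powr (-1 - 2 * s))
     \<le> (\<Sum>p\<in>P - primes_upto (exp (1 / s)). real p powr (-1 - 2 * s))"
    using P by (intro sum_mono2) (auto simp: primes_upto_def)
  also have "\<dots> \<le> ln (1 / s) - ln (ln (exp (1 / s))) + 7"
    using s e by (intro sum_primes_powr_above_le P) auto
  finally show ?thesis by simp
qed

text \<open>The primes up to exp (1/s) suffice: on them the shift costs only 4, and all of them are
  at most x. The 9 is 2 + 4 from the range up to exp (1/s) plus 3 from removing the primes up to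
  w.\<close>

lemma sum_primes_powr_above_ge:
  assumes w: "w \<ge> 2" "ln w \<ge> 1" and s: "0 < s" "s \<le> 1" and x: "1 / s \<le> ln x" "x > 0"
  shows "(\<Sum>p\<in>primes_upto x - primes_upto w. real p powr (-1 - 2 * s)) \<ge> ln (1 / s) - ln (ln w) - 9"
proof -
  let ?g = "\<lambda>p. real p powr (-1 - 2 * s)"
  have e: "exp (1 / s) \<ge> 2" using exp_ge_add_one_self[of "1 / s"] le_divide_eq_1_pos[OF s(1), of 1] s(2) by linarith
  have ex: "exp (1 / s) \<le> x" using x by (subst ln_ge_iff[symmetric]) auto
  have "ln (1 / s) - 6 \<le> sum ?g (primes_upto (exp (1 / s)))"
    using sum_primes_upto_powr_ge[OF e, of "2 * s"] sum_primes_inverse_ge[OF e] s by simp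
  also have "\<dots> \<le> sum ?g (primes_upto x)"
    using ex by (intro sum_mono2 finite_primes_upto) (auto simp: primes_upto_def)
  also have "\<dots> = sum ?g (primes_upto x - primes_upto w) + sum ?g (primes_upto x \<inter> primes_upto w)"
    by (subst sum.union_disjoint[symmetric]) (auto intro!: sum.cong)
  also have "sum ?g (primes_upto x \<inter> primes_upto w) \<le> sum ?g (primes_upto w)"
    by (intro sum_mono2) auto
  also have "sum ?g (primes_upto w) \<le> (\<Sum>p\<in>primes_upto w. 1 / real p)"
  proof (rule sum_mono)
    fix p assume "p \<in> primes_upto w"
    then have p: "real p \<ge> 1" using prime_ge_1_nat[OF prime_primes_upto] by simp
    then have "real p powr (-1 - 2 * s) \<le> real p powr (-1)" using s by (intro powr_mono) auto
    then show "real p powr (-1 - 2 * s) \<le> 1 / real p" by (simp add: powr_minus inverse_eq_divide)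
  qed
  also have "\<dots> \<le> ln (ln w) + 3" by (rule sum_primes_inverse_le[OF w])
  finally show ?thesis by linarith
qed

text \<open>Halving the shift changes the prime sum by O(1) only. Up to exp (2/s) each difference is
  at most s ln p / p, in total 4; beyond it the negative term is dropped and the logarithms cancel,
  leaving 7.\<close>

lemma sum_primes_powr_diff_le:
  assumes P: "finite P" "\<And>p. p \<in> P \<Longrightarrow> prime p" and s: "0 < s" "s \<le> 1"
  shows "(\<Sum>p\<in>P. real p powr (-1 - s) - real p powr (-1 - 2 * s)) \<le> 11"
proof -
  define w where "w = exp (2 / s)"
  have w: "w \<ge> 2" using exp_ge_add_one_self[of "2 / s"] le_divide_eq_1_pos[OF s(1), of 2] s(2) unfolding w_def by linarith
  let ?d = "\<lambda>p. real p powr (-1 - s) - real p powr (-1 - 2 * s)"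
  have d: "0 \<le> ?d p" "?d p \<le> s * (ln (real p) / real p)" "?d p \<le> real p powr (-1 - s)" if "prime p" for p
  proof -
    have p: "real p \<ge> 1" using prime_ge_1_nat[OF that] by simp
    have "real p powr (-1 - 2 * s) = real p powr (-1 - s) * real p powr (- s)"
      by (simp add: powr_add[symmetric] algebra_simps)
    then have eq: "?d p = real p powr (-1 - s) * (1 - real p powr (- s))" by (simp add: algebra_simps)
    have "real p powr (- s) \<le> real p powr 0" using p s by (intro powr_mono) auto
    then have le: "real p powr (- s) \<le> 1" using p by simp
    then show "0 \<le> ?d p" unfolding eq by simp
    have "real p powr (-1 - s) * (1 - real p powr (- s)) \<le> real p powr (-1) * (s * ln (real p))"
      using powr_minus_ge_linear[OF p, of s] p s le by (intro mult_mono powr_mono) auto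
    then show "?d p \<le> s * (ln (real p) / real p)"
      unfolding eq by (simp add: powr_minus inverse_eq_divide)
    show "?d p \<le> real p powr (-1 - s)" by simp
  qed
  have "sum ?d P = sum ?d (P \<inter> primes_upto w) + sum ?d (P - primes_upto w)"
    using P by (subst sum.union_disjoint[symmetric]) (auto intro!: sum.cong)
  also have "sum ?d (P \<inter> primes_upto w) \<le> sum ?d (primes_upto w)"
    using d(1) by (intro sum_mono2) (auto simp: prime_primes_upto)
  also have "\<dots> \<le> (\<Sum>p\<in>primes_upto w. s * (ln (real p) / real p))"
    by (intro sum_mono d(2) prime_primes_upto)
  also have "\<dots> = s * (\<Sum>p\<in>primes_upto w. ln (real p) / real p)" by (simp add: sum_distrib_left)
  also have "\<dots> \<le> s * (2 * ln w)" using sum_primes_ln_div_le[of w] w s by (intro mult_left_mono) auto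
  also have "\<dots> = 4" using s by (simp add: w_def)
  also have "sum ?d (P - primes_upto w) \<le> (\<Sum>p\<in>P - primes_upto w. real p powr (-1 - 2 * (s / 2)))"
    using d(3) P by (intro sum_mono) simp
  also have "\<dots> \<le> ln (1 / (s / 2)) - ln (ln w) + 7"
    using s by (intro sum_primes_powr_above_le P w) (auto simp: w_def)
  also have "\<dots> = 7" by (simp add: w_def)
  finally show ?thesis by simp
qed

section \<open>Steinhaus variables\<close>

text \<open>Translation by a exchanges two intervals of a period: [0, T - a) moves to [a, T), and [T
  - a, T) wraps around to [0, a). Both moves preserve length.\<close>

lemma circle_uniform_rotate_aux:
  fixes S :: "real set"
  assumes S [measurable]: "S \<in> sets borel" and per: "\<And>x. x + T \<in> S \<longleftrightarrow> x \<in> S"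
    and a: "0 \<le> a" "a < T"
  shows "emeasure lborel ({0..<T} \<inter> {x. x + a \<in> S}) = emeasure lborel ({0..<T} \<inter> S)"
proof -
  have shift: "emeasure lborel {x. x + c \<in> X} = emeasure lborel X" if [measurable]: "X \<in> sets borel" for c :: real and X
  proof -
    have "emeasure lborel X = emeasure (distr lborel borel ((+) c)) X" by (simp add: lborel_distr_plus)
    also have "\<dots> = emeasure lborel {x. x + c \<in> X}"
      by (subst emeasure_distr) (auto simp: vimage_def add.commute)
    finally show ?thesis by simp
  qed
  have per': "x + (a - T) \<in> S \<longleftrightarrow> x + a \<in> S" for x using per[of "x + (a - T)"] by simp
  have m: "{x. x + c \<in> X} \<in> sets borel" if [measurable]: "X \<in> sets borel" for c :: real and X
    by measurable
  have "{0..<T} \<inter> {x. x + a \<in> S} = {x. x + a \<in> {a..<T} \<inter> S} \<union> {x. x + (a - T) \<in> {0..<a} \<inter> S}"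
    using a per' by auto
  also have "emeasure lborel \<dots> = emeasure lborel {x. x + a \<in> {a..<T} \<inter> S}
      + emeasure lborel {x. x + (a - T) \<in> {0..<a} \<inter> S}"
  proof (rule plus_emeasure[symmetric])
    show "{x. x + a \<in> {a..<T} \<inter> S} \<in> sets lborel" "{x. x + (a - T) \<in> {0..<a} \<inter> S} \<in> sets lborel"
      using m[of "{a..<T} \<inter> S" a] m[of "{0..<a} \<inter> S" "a - T"] by simp_all
  qed auto
  also have "\<dots> = emeasure lborel ({a..<T} \<inter> S) + emeasure lborel ({0..<a} \<inter> S)"
    by (intro arg_cong2[of _ _ _ _ "(+)"] shift) auto
  also have "\<dots> = emeasure lborel (({a..<T} \<inter> S) \<union> ({0..<a} \<inter> S))"
    by (intro plus_emeasure) auto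
  also have "({a..<T} \<inter> S) \<union> ({0..<a} \<inter> S) = {0..<T} \<inter> S" using a by auto
  finally show ?thesis .
qed

lemma measurable_cis [measurable]: "cis \<in> borel_measurable borel"
  by (intro borel_measurable_continuous_onI continuous_intros)

lemma circle_uniform_rotate: "distr circle_uniform borel (\<lambda>z. z * cis \<alpha>) = circle_uniform"
proof (rule measure_eqI)
  fix B assume "B \<in> sets (distr circle_uniform borel (\<lambda>z. z * cis \<alpha>))"
  then have B [measurable]: "B \<in> sets borel" by simp
  define S where "S = cis -` B"
  have S [measurable]: "S \<in> sets borel" unfolding S_def using measurable_sets[OF measurable_cis B] by simp
  define T :: real where "T = 2 * pi"
  have per: "x + T \<in> S \<longleftrightarrow> x \<in> S" for x by (simp add: S_def T_def flip: cis_mult)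
  \<comment> \<open>Reduces the angle modulo 2 pi to a value in [0, 2 pi).\<close>
  define m where "m = \<lfloor>\<alpha> / T\<rfloor>"
  define a where "a = \<alpha> - of_int m * T"
  have T: "T > 0" by (simp add: T_def)
  have a: "0 \<le> a" "a < T"
    using floor_divide_lower[OF T, of \<alpha>] floor_divide_upper[OF T, of \<alpha>]
    unfolding a_def m_def by (auto simp: algebra_simps)
  have cis_m: "cis (of_int m * T) = 1"
    unfolding T_def using cis_multiple_2pi[of "of_int m"] by (simp add: mult.commute)
  have cis_a: "cis a = cis \<alpha>" unfolding a_def by (simp add: cis_divide[symmetric] cis_m)
  have Sa: "x + a \<in> S \<longleftrightarrow> cis x * cis \<alpha> \<in> B" for x by (simp add: S_def cis_mult[symmetric] cis_a)
  have "emeasure (distr circle_uniform borel (\<lambda>z. z * cis \<alpha>)) B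
     = emeasure (uniform_measure lborel {0..<T}) {x. cis x * cis \<alpha> \<in> B}"
    unfolding circle_uniform_def T_def[symmetric]
    by (subst distr_distr) (auto simp: emeasure_distr vimage_def)
  also have "\<dots> = emeasure lborel ({0..<T} \<inter> {x. x + a \<in> S}) / emeasure lborel {0..<T}"
    by (subst emeasure_uniform_measure) (auto simp: Sa)
  also have "\<dots> = emeasure lborel ({0..<T} \<inter> S) / emeasure lborel {0..<T}"
    by (subst circle_uniform_rotate_aux[OF S per a]) simp
  also have "\<dots> = emeasure circle_uniform B"
    unfolding circle_uniform_def T_def[symmetric] S_def
    using S[unfolded S_def] by (simp add: emeasure_distr)
  finally show "emeasure (distr circle_uniform borel (\<lambda>z. z * cis \<alpha>)) B = emeasure circle_uniform B" .
qed (simp add: circle_uniform_def)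

lemma distr_circle_uniform_id:
  assumes [measurable]: "h \<in> borel_measurable borel" and h: "\<And>z. cmod z = 1 \<Longrightarrow> h z = z"
  shows "distr circle_uniform borel h = circle_uniform"
  unfolding circle_uniform_def by (subst distr_distr) (auto intro!: distr_cong simp: h)

lemma AE_circle_uniform: "AE z in circle_uniform. cmod z = 1"
  unfolding circle_uniform_def by (subst AE_distr_iff) auto

text \<open>The modulus is 1 at every sample point rather than almost surely, so that pointwise
  bounds hold everywhere. \<open>unit_version\<close> provides such a family by changing f on a null
  set.\<close>

locale unit_steinhaus = steinhaus +
  assumes norm_f [simp]: "\<And>p \<omega>. prime p \<Longrightarrow> cmod (f p \<omega>) = 1"

context steinhaus
begin

lemma measurable_f [measurable]: "prime p \<Longrightarrow> f p \<in> borel_measurable M"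
  using indep_primes by (auto simp: indep_vars_def)

lemma distr_f_PiM:
  "distr M (PiM {p. prime p} (\<lambda>_. borel)) (\<lambda>\<omega>. \<lambda>p\<in>{p. prime p}. f p \<omega>)
     = PiM {p. prime p} (\<lambda>_. circle_uniform)"
proof -
  have "distr M (PiM {p. prime p} (\<lambda>_. borel)) (\<lambda>\<omega>. \<lambda>p\<in>{p. prime p}. f p \<omega>)
     = PiM {p. prime p} (\<lambda>p. distr M borel (f p))"
    using indep_primes two_is_prime_nat by (subst (asm) indep_vars_iff_distr_eq_PiM') (auto)
  also have "\<dots> = PiM {p. prime p} (\<lambda>_. circle_uniform)"
    by (rule PiM_cong) (auto simp: distr_prime)
  finally show ?thesis .
qed

lemma steinhaus_compose:
  assumes "\<And>p. prime p \<Longrightarrow> h p \<in> borel_measurable borel"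
    and "\<And>p. prime p \<Longrightarrow> distr circle_uniform borel (h p) = circle_uniform"
  shows "steinhaus M (\<lambda>p \<omega>. h p (f p \<omega>))"
proof
  show "indep_vars (\<lambda>_. borel) (\<lambda>p \<omega>. h p (f p \<omega>)) {p. prime p}"
    by (rule indep_vars_compose2[OF indep_primes]) (use assms in auto)
  show "distr M borel (\<lambda>\<omega>. h p (f p \<omega>)) = circle_uniform" if "prime p" for p
  proof -
    note [measurable] = assms(1)[OF that] measurable_f[OF that]
    have "distr M borel (\<lambda>\<omega>. h p (f p \<omega>)) = distr (distr M borel (f p)) borel (h p)"
      by (subst distr_distr) (auto simp: o_def)
    then show ?thesis using assms(2) distr_prime that by simp
  qed
qed

lemma unit_version:
  obtains g where "unit_steinhaus M g" "AE \<omega> in M. \<forall>p. prime p \<longrightarrow> g p \<omega> = f p \<omega>"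
proof
  define h where "h z = (if cmod z = 1 then z else 1)" for z :: complex
  have [measurable]: "h \<in> borel_measurable borel" unfolding h_def by measurable
  interpret g: steinhaus M "\<lambda>p \<omega>. h (f p \<omega>)"
    by (rule steinhaus_compose) (auto intro!: distr_circle_uniform_id simp: h_def)
  show "unit_steinhaus M (\<lambda>p \<omega>. h (f p \<omega>))"
    by unfold_locales (auto simp: h_def)
  have "AE \<omega> in M. h (f p \<omega>) = f p \<omega>" if [measurable]: "prime p" for p
  proof -
    note [measurable] = measurable_f[OF that]
    have "AE z in distr M borel (f p). cmod z = 1"
      unfolding distr_prime[OF that] by (rule AE_circle_uniform)
    then have "AE \<omega> in M. cmod (f p \<omega>) = 1" by (subst (asm) AE_distr_iff) auto
    then show ?thesis by eventually_elim (simp add: h_def)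
  qed
  then show "AE \<omega> in M. \<forall>p. prime p \<longrightarrow> h (f p \<omega>) = f p \<omega>"
    by (subst AE_all_countable) (auto intro: AE_I2 simp: AE_all_countable)
qed

end

lemma mult_ext_cong:
  "(\<And>p. prime p \<Longrightarrow> f p \<omega> = g p \<omega>') \<Longrightarrow> mult_ext f n \<omega> = mult_ext g n \<omega>'"
  unfolding mult_ext_def by (intro prod.cong refl) (auto dest: in_prime_factors_imp_prime)

context unit_steinhaus
begin

lemma norm_mult_ext [simp]: "cmod (mult_ext f n \<omega>) = 1"
  unfolding mult_ext_def by (simp add: prod_norm[symmetric] norm_power in_prime_factors_imp_prime)

lemma measurable_mult_ext [measurable]: "mult_ext f n \<in> borel_measurable M"
  unfolding mult_ext_def[abs_def] by (intro borel_measurable_prod borel_measurable_power)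
    (auto intro: measurable_f in_prime_factors_imp_prime)

text \<open>The joint law of the f(p) is a product of rotation-invariant laws, so each f(p) may be
  turned by its own angle h(p). On f(n) this acts through the completely additive extension of
  h.\<close>

lemma expectation_rotate:
  fixes b :: "nat \<Rightarrow> complex" and h :: "nat \<Rightarrow> real"
  shows "expectation (\<lambda>\<omega>. cmod (\<Sum>n\<in>A. b n * (mult_ext f n \<omega> *
           cis (\<Sum>p\<in>prime_factors n. real (multiplicity p n) * h p))) powr r)
       = expectation (\<lambda>\<omega>. cmod (\<Sum>n\<in>A. b n * mult_ext f n \<omega>) powr r)"
proof -
  let ?I = "{p::nat. prime p}"
  define g where "g p \<omega> = f p \<omega> * cis (h p)" for p \<omega>
  interpret g: steinhaus M g
    unfolding g_def by (rule steinhaus_compose) (auto intro: circle_uniform_rotate)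
  \<comment> \<open>The random quantity as a function of the prime coordinates alone;
    \<open>()\<close> is a dummy sample point.\<close>
  define \<Psi> where "\<Psi> x = cmod (\<Sum>n\<in>A. b n * mult_ext (\<lambda>p _. x p) n ()) powr r" for x :: "nat \<Rightarrow> complex"
  have [measurable]: "(\<lambda>x. mult_ext (\<lambda>p _. x p) n ()) \<in> borel_measurable (PiM ?I (\<lambda>_. borel))" for n
    unfolding mult_ext_def
    by (intro borel_measurable_prod borel_measurable_power measurable_component_singleton)
       (auto intro: in_prime_factors_imp_prime)
  have [measurable]: "\<Psi> \<in> borel_measurable (PiM ?I (\<lambda>_. borel))"
    unfolding \<Psi>_def by measurable
  have mf: "(\<lambda>\<omega>. \<lambda>p\<in>?I. f p \<omega>) \<in> measurable M (PiM ?I (\<lambda>_. borel))"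
    and mg: "(\<lambda>\<omega>. \<lambda>p\<in>?I. g p \<omega>) \<in> measurable M (PiM ?I (\<lambda>_. borel))"
    by (auto intro!: measurable_restrict measurable_f g.measurable_f)
  have rot: "mult_ext g n \<omega> = mult_ext f n \<omega> * cis (\<Sum>p\<in>prime_factors n. real (multiplicity p n) * h p)" for n \<omega>
    unfolding mult_ext_def g_def power_mult_distrib prod.distrib
    by (simp add: cis_conv_exp exp_sum[symmetric] exp_of_nat_mult[symmetric] sum_distrib_left sum_distrib_right mult_ac)
  have "expectation (\<lambda>\<omega>. \<Psi> (\<lambda>p\<in>?I. g p \<omega>)) = integral\<^sup>L (PiM ?I (\<lambda>_. circle_uniform)) \<Psi>"
    unfolding g.distr_f_PiM[symmetric] by (rule integral_distr[symmetric, OF mg]) measurable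
  also have "\<dots> = expectation (\<lambda>\<omega>. \<Psi> (\<lambda>p\<in>?I. f p \<omega>))"
    unfolding distr_f_PiM[symmetric] by (rule integral_distr[OF mf]) measurable
  finally have "expectation (\<lambda>\<omega>. \<Psi> (\<lambda>p\<in>?I. g p \<omega>)) = expectation (\<lambda>\<omega>. \<Psi> (\<lambda>p\<in>?I. f p \<omega>))" .
  moreover have "\<Psi> (\<lambda>p\<in>?I. f p \<omega>) = cmod (\<Sum>n\<in>A. b n * mult_ext f n \<omega>) powr r" for \<omega>
    unfolding \<Psi>_def by (subst mult_ext_cong[where g = f and \<omega>' = \<omega>]) auto
  moreover have "\<Psi> (\<lambda>p\<in>?I. g p \<omega>) = cmod (\<Sum>n\<in>A. b n * mult_ext g n \<omega>) powr r" for \<omega>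
    unfolding \<Psi>_def by (subst mult_ext_cong[where g = g and \<omega>' = \<omega>]) auto
  ultimately show ?thesis unfolding rot by simp
qed

text \<open>Rotation by pi / n preserves the law but turns z^n into -z^n.\<close>

lemma expectation_power_eq_0:
  assumes p: "prime p" and n: "n \<ge> 1"
  shows "expectation (\<lambda>\<omega>. f p \<omega> ^ n) = 0"
proof -
  note [measurable] = measurable_f[OF p]
  have eq: "expectation (\<lambda>\<omega>. f p \<omega> ^ n) = integral\<^sup>L circle_uniform (\<lambda>z. z ^ n)"
    unfolding distr_prime[OF p, symmetric] by (subst integral_distr) auto
  define c where "c = cis (pi / real n)"
  have "integral\<^sup>L circle_uniform (\<lambda>z. z ^ n) = integral\<^sup>L circle_uniform (\<lambda>z. (z * c) ^ n)"
    by (subst circle_uniform_rotate[of "pi / real n", symmetric], subst integral_distr)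
       (auto simp: c_def circle_uniform_def)
  also have "\<dots> = c ^ n * integral\<^sup>L circle_uniform (\<lambda>z. z ^ n)"
    by (simp add: power_mult_distrib mult.commute)
  also have "c ^ n = cis (real n * (pi / real n))" unfolding c_def by (rule Complex.DeMoivre)
  also have "\<dots> = -1" using n by (simp add: cis_pi)
  finally show ?thesis using eq by simp
qed

end

section \<open>Local moments\<close>

text \<open>Coefficients of (1 - z)^(-\<kappa>). For a positive integer \<kappa> this counts the
  factorisations of p^j into \<kappa> factors.\<close>

definition neg_binom :: "real \<Rightarrow> nat \<Rightarrow> real" where
  "neg_binom \<kappa> j = pochhammer \<kappa> j / fact j"

lemma neg_binom_0 [simp]: "neg_binom \<kappa> 0 = 1"
  by (simp add: neg_binom_def)

lemma neg_binom_1: "neg_binom \<kappa> (Suc 0) = \<kappa>"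
  by (simp add: neg_binom_def)

lemma neg_binom_nonneg: "\<kappa> \<ge> 0 \<Longrightarrow> neg_binom \<kappa> j \<ge> 0"
  unfolding neg_binom_def pochhammer_prod by (intro divide_nonneg_nonneg prod_nonneg) auto

text \<open>Consecutive ratios are (\<kappa> + j) / (j + 1), at most \<kappa> because \<kappa> >= 1.
  Local moments are thereby compared with a geometric series.\<close>

lemma neg_binom_le_power:
  assumes "\<kappa> \<ge> 1"
  shows "neg_binom \<kappa> j \<le> \<kappa> ^ j"
proof (induction j)
  case (Suc j)
  have "neg_binom \<kappa> (Suc j) = neg_binom \<kappa> j * ((\<kappa> + real j) / (real j + 1))"
    by (simp add: neg_binom_def pochhammer_Suc field_simps)
  also have "(\<kappa> + real j) / (real j + 1) \<le> \<kappa>"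
    using assms mult_right_mono[of 1 \<kappa> "real j"] by (simp add: field_simps)
  then have "neg_binom \<kappa> j * ((\<kappa> + real j) / (real j + 1)) \<le> \<kappa> ^ j * \<kappa>"
    using assms Suc neg_binom_nonneg[of \<kappa> j] by (intro mult_mono) auto
  finally show ?case by (simp add: mult.commute)
qed simp

lemma neg_binom_sums:
  fixes z :: complex
  assumes "cmod z < 1"
  shows "(\<lambda>j. of_real (neg_binom \<kappa> j) * z ^ j) sums ((1 - z) powr (- of_real \<kappa>))"
proof -
  have "((- complex_of_real \<kappa>) gchoose j) * (- z) ^ j = of_real (neg_binom \<kappa> j) * z ^ j" for j
  proof -
    have "((- complex_of_real \<kappa>) gchoose j) * (- z) ^ j
        = ((-1) ^ j * (-1) ^ j) * (pochhammer (of_real \<kappa>) j / fact j * z ^ j)"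
      unfolding gbinomial_pochhammer power_minus[of z j] by (simp only: minus_minus times_divide_eq_left times_divide_eq_right mult_ac)
    also have "(-1) ^ j * (-1) ^ j = (1 :: complex)" by (simp flip: power_mult_distrib)
    finally show ?thesis by (simp add: neg_binom_def pochhammer_of_real)
  qed
  then show ?thesis using gen_binomial_complex[of "- z" "- of_real \<kappa>"] assms by simp
qed

lemma neg_binom_sums_real:
  assumes "\<bar>r\<bar> < 1"
  shows "(\<lambda>j. neg_binom \<kappa> j * r ^ j) sums ((1 - r) powr (- \<kappa>))"
proof -
  have "((- \<kappa>) gchoose j) * (- r) ^ j = neg_binom \<kappa> j * r ^ j" for j
  proof -
    have "((- \<kappa>) gchoose j) * (- r) ^ j = ((-1) ^ j * (-1) ^ j) * (pochhammer \<kappa> j / fact j * r ^ j)"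
      unfolding gbinomial_pochhammer power_minus[of r j] by (simp only: minus_minus times_divide_eq_left times_divide_eq_right mult_ac)
    also have "(-1) ^ j * (-1) ^ j = (1 :: real)" by (simp flip: power_mult_distrib)
    finally show ?thesis by (simp add: neg_binom_def)
  qed
  then show ?thesis using gen_binomial_real[of "- r" "- \<kappa>"] assms by simp
qed

lemma measurable_cnj [measurable]: "cnj \<in> borel_measurable borel"
  by (intro borel_measurable_continuous_onI continuous_intros)

lemma powr_neg_times_cnj:
  "z powr (- of_real k) * cnj (z powr (- of_real k)) = of_real (cmod z powr (- (2 * k)))"
  by (simp only: complex_norm_square[symmetric])
    (simp add: norm_powr_real_powr' powr_add[symmetric] power2_eq_square)

lemma term_le_suminf:
  fixes g :: "nat \<Rightarrow> real"
  assumes "summable g" "\<And>j. g j \<ge> 0"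
  shows "g n \<le> suminf g"
  using sum_le_suminf[OF assms(1), of "{n}"] assms(2) by simp

context prob_space
begin

lemma integral_suminf_bounded:
  fixes h :: "nat \<Rightarrow> 'a \<Rightarrow> complex"
  assumes [measurable]: "\<And>j. h j \<in> borel_measurable M"
    and h: "\<And>j \<omega>. cmod (h j \<omega>) \<le> c j" and c: "summable c"
  shows "expectation (\<lambda>\<omega>. \<Sum>j. h j \<omega>) = (\<Sum>j. expectation (h j))"
proof (rule integral_suminf)
  have c0: "c j \<ge> 0" for j using h[of j undefined] by (meson norm_ge_zero order_trans)
  show i: "integrable M (h j)" for j
    by (rule integrable_const_bound[of _ "c j"]) (use h in auto)
  show "AE \<omega> in M. summable (\<lambda>j. norm (h j \<omega>))"
    by (rule AE_I2, rule summable_comparison_test[OF _ c]) (use h in auto)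
  show "summable (\<lambda>j. \<integral>\<omega>. norm (h j \<omega>) \<partial>M)"
  proof (rule summable_comparison_test[OF _ c], intro exI allI impI)
    fix j
    have "(\<integral>\<omega>. norm (h j \<omega>) \<partial>M) \<le> (\<integral>\<omega>. c j \<partial>M)"
      by (rule integral_mono) (use i h in auto)
    then show "norm (\<integral>\<omega>. norm (h j \<omega>) \<partial>M) \<le> c j"
      by (simp add: prob_space)
  qed
qed

end

context unit_steinhaus
begin

lemma expectation_power_cnj:
  assumes p: "prime p"
  shows "expectation (\<lambda>\<omega>. f p \<omega> ^ i * cnj (f p \<omega> ^ j)) = of_bool (i = j)"
proof -
  have unit: "f p \<omega> ^ m * cnj (f p \<omega> ^ m) = 1" for m \<omega>
    using p complex_norm_square[of "f p \<omega> ^ m"] by (simp add: norm_power)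
  have diff: "f p \<omega> ^ (d + m) * cnj (f p \<omega> ^ m) = f p \<omega> ^ d" for d m \<omega>
    using unit[of \<omega> m] by (simp add: power_add mult.assoc)
  consider "i = j" | d where "i = d + j" "d \<ge> 1" | d where "j = d + i" "d \<ge> 1"
    by (metis Suc_eq_plus1 add.commute less_imp_Suc_add less_eq_Suc_le nat_neq_iff le_add1 add_Suc_right)
  then show ?thesis
  proof cases
    case 1
    then show ?thesis using unit by (simp add: prob_space)
  next
    case (2 d)
    then show ?thesis using diff expectation_power_eq_0[OF p, of d] by simp
  next
    case (3 d)
    have "f p \<omega> ^ i * cnj (f p \<omega> ^ (d + i)) = cnj (f p \<omega> ^ d)" for \<omega>
      using diff[of \<omega> d i] by (metis complex_cnj_cnj complex_cnj_mult mult.commute)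
    then have "expectation (\<lambda>\<omega>. f p \<omega> ^ i * cnj (f p \<omega> ^ j)) = cnj (expectation (\<lambda>\<omega>. f p \<omega> ^ d))"
      unfolding 3(1) by (simp only: Bochner_Integration.integral_cnj)
    then show ?thesis using 3 expectation_power_eq_0[OF p, of d] by simp
  qed
qed

text \<open>Parseval's identity on the circle, with a shift by v. Summable coefficients justify
  exchanging sum and expectation, once for each of the two series.\<close>

lemma expectation_power_series:
  fixes a b :: "nat \<Rightarrow> real"
  assumes p: "prime p"
    and a: "summable a" "\<And>j. a j \<ge> 0" and b: "summable b" "\<And>j. b j \<ge> 0"
  shows "expectation (\<lambda>\<omega>. f p \<omega> ^ v * (\<Sum>j. of_real (a j) * f p \<omega> ^ j) * cnj (\<Sum>j. of_real (b j) * f p \<omega> ^ j))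
     = of_real (\<Sum>j. a j * b (j + v))"
proof -
  note [measurable] = measurable_f[OF p]
  have sm: "summable (\<lambda>j. of_real (c j) * f p \<omega> ^ j)" if "summable c" "\<And>j. c j \<ge> 0" for c \<omega>
    by (rule summable_comparison_test[OF _ that(1)]) (use that p in \<open>auto simp: norm_mult norm_power\<close>)
  define B where "B \<omega> = (\<Sum>j. of_real (b j) * f p \<omega> ^ j)" for \<omega>
  have [measurable]: "B \<in> borel_measurable M" unfolding B_def by measurable
  have B: "cmod (B \<omega>) \<le> suminf b" for \<omega>
    unfolding B_def by (rule norm_suminf_le[OF _ b(1)]) (use b p in \<open>auto simp: norm_mult norm_power\<close>)
  have coeff: "expectation (\<lambda>\<omega>. f p \<omega> ^ m * cnj (B \<omega>)) = of_real (b m)" for m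
  proof -
    have "expectation (\<lambda>\<omega>. \<Sum>j. of_real (b j) * (f p \<omega> ^ j * cnj (f p \<omega> ^ m)))
       = (\<Sum>j. expectation (\<lambda>\<omega>. of_real (b j) * (f p \<omega> ^ j * cnj (f p \<omega> ^ m))))"
    proof (rule integral_suminf_bounded[OF _ _ b(1)])
      show "(\<lambda>\<omega>. complex_of_real (b j) * (f p \<omega> ^ j * cnj (f p \<omega> ^ m))) \<in> borel_measurable M" for j
        by measurable
    qed (use b p in \<open>auto simp: norm_mult norm_power\<close>)
    also have "\<dots> = (\<Sum>j. if j = m then complex_of_real (b m) else 0)"
      using expectation_power_cnj[OF p] by (intro suminf_cong) simp
    also have "\<dots> = of_real (b m)" using sums_unique[OF sums_single[of m "\<lambda>_. complex_of_real (b m)"]] by simp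
    also have "(\<lambda>\<omega>. \<Sum>j. of_real (b j) * (f p \<omega> ^ j * cnj (f p \<omega> ^ m))) = (\<lambda>\<omega>. B \<omega> * cnj (f p \<omega> ^ m))"
      unfolding B_def suminf_mult2[OF sm[OF b]] by (simp add: mult_ac)
    finally have "expectation (\<lambda>\<omega>. B \<omega> * cnj (f p \<omega> ^ m)) = of_real (b m)" .
    then have "cnj (expectation (\<lambda>\<omega>. B \<omega> * cnj (f p \<omega> ^ m))) = of_real (b m)" by simp
    then show ?thesis by (simp add: Bochner_Integration.integral_cnj[symmetric] mult.commute del: Bochner_Integration.integral_cnj)
  qed
  have "expectation (\<lambda>\<omega>. \<Sum>j. of_real (a j) * (f p \<omega> ^ (j + v) * cnj (B \<omega>)))
     = (\<Sum>j. expectation (\<lambda>\<omega>. of_real (a j) * (f p \<omega> ^ (j + v) * cnj (B \<omega>))))"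
  proof (rule integral_suminf_bounded)
    show "summable (\<lambda>j. a j * suminf b)" using a by (intro summable_mult2)
    show "cmod (of_real (a j) * (f p \<omega> ^ (j + v) * cnj (B \<omega>))) \<le> a j * suminf b" for j \<omega>
      using B[of \<omega>] a p by (auto simp: norm_mult norm_power intro: mult_left_mono)
  qed measurable
  also have "\<dots> = (\<Sum>j. of_real (a j * b (j + v)))"
    using coeff by (intro suminf_cong) simp
  also have "\<dots> = of_real (\<Sum>j. a j * b (j + v))"
  proof (rule suminf_of_real[symmetric])
    have "b (j + v) \<le> suminf b" for j by (rule term_le_suminf[OF b])
    then show "summable (\<lambda>j. a j * b (j + v))"
      using a b by (intro summable_comparison_test[OF _ summable_mult2[OF a(1), of "suminf b"]] exI[of _ 0])
        (auto intro!: mult_left_mono)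
  qed
  also have "(\<lambda>\<omega>. \<Sum>j. of_real (a j) * (f p \<omega> ^ (j + v) * cnj (B \<omega>)))
     = (\<lambda>\<omega>. f p \<omega> ^ v * (\<Sum>j. of_real (a j) * f p \<omega> ^ j) * cnj (B \<omega>))"
    unfolding suminf_mult[OF sm[OF a], symmetric] suminf_mult2[OF summable_mult[OF sm[OF a]]]
    by (simp add: power_add mult_ac)
  finally show ?thesis by (simp add: B_def)
qed

lemma norm_one_minus_ge:
  assumes "prime p" "r \<ge> 0"
  shows "cmod (1 - of_real r * f p \<omega>) \<ge> 1 - r"
  using norm_triangle_ineq2[of 1 "of_real r * f p \<omega>"] assms by (simp add: norm_mult)

lemma expectation_neg_binom:
  assumes p: "prime p" and r: "0 \<le> r" "r < 1" and \<kappa>: "\<kappa> \<ge> 0" "\<kappa>' \<ge> 0"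
  shows "expectation (\<lambda>\<omega>. f p \<omega> ^ v * (1 - of_real r * f p \<omega>) powr (- of_real \<kappa>)
            * cnj ((1 - of_real r * f p \<omega>) powr (- of_real \<kappa>')))
     = of_real (\<Sum>j. (neg_binom \<kappa> j * r ^ j) * (neg_binom \<kappa>' (j + v) * r ^ (j + v)))"
proof -
  have series: "(1 - of_real r * f p \<omega>) powr (- of_real q) = (\<Sum>j. of_real (neg_binom q j * r ^ j) * f p \<omega> ^ j)" for q \<omega>
    using neg_binom_sums[of "of_real r * f p \<omega>" q] r p
    by (simp add: sums_iff norm_mult power_mult_distrib mult_ac)
  have sm: "summable (\<lambda>j. neg_binom q j * r ^ j)" for q
    using neg_binom_sums_real[of r q] r by (auto simp: sums_iff)
  show ?thesis unfolding series
    by (rule expectation_power_series[OF p sm _ sm]) (use r \<kappa> neg_binom_nonneg in auto)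
qed

text \<open>The power series of (1 - r z)^(-\<kappa>) has nonnegative coefficients for \<kappa> >=
  0, hence so does every shifted Parseval sum. This is the local source of the positivity behind the
  lower bound.\<close>

lemma expectation_neg_binom_nonneg:
  assumes p: "prime p" and r: "0 \<le> r" "r < 1" and \<kappa>: "\<kappa> \<ge> 0" "\<kappa>' \<ge> 0"
  shows "\<exists>x\<ge>0. expectation (\<lambda>\<omega>. f p \<omega> ^ v * (1 - of_real r * f p \<omega>) powr (- of_real \<kappa>)
            * cnj ((1 - of_real r * f p \<omega>) powr (- of_real \<kappa>'))) = of_real x"
proof (intro exI conjI)
  show "(\<Sum>j. (neg_binom \<kappa> j * r ^ j) * (neg_binom \<kappa>' (j + v) * r ^ (j + v))) \<ge> 0"
  proof (rule suminf_nonneg)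
    have sm: "summable (\<lambda>j. neg_binom q j * r ^ j)" for q
      using neg_binom_sums_real[of r q] r by (auto simp: sums_iff)
    have "neg_binom \<kappa>' (j + v) * r ^ (j + v) \<le> (\<Sum>j. neg_binom \<kappa>' j * r ^ j)" for j
      using r neg_binom_nonneg[OF \<kappa>(2)] by (intro term_le_suminf[OF sm]) auto
    then show "summable (\<lambda>j. (neg_binom \<kappa> j * r ^ j) * (neg_binom \<kappa>' (j + v) * r ^ (j + v)))"
      using \<kappa> r neg_binom_nonneg
      by (intro summable_comparison_test[OF _ summable_mult2[OF sm[of \<kappa>], of "\<Sum>j. neg_binom \<kappa>' j * r ^ j"]] exI[of _ 0])
        (auto intro!: mult_left_mono)
  qed (use \<kappa> r neg_binom_nonneg in auto)
qed (rule expectation_neg_binom[OF assms])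

definition local_moment :: "nat \<Rightarrow> real \<Rightarrow> real \<Rightarrow> real" where
  "local_moment p q r = expectation (\<lambda>\<omega>. cmod (1 - of_real r * f p \<omega>) powr (- q))"

lemma local_moment_sums:
  assumes p: "prime p" and r: "0 \<le> r" "r < 1" and k: "k \<ge> 0"
  shows "local_moment p (2 * k) r = (\<Sum>j. (neg_binom k j * r ^ j)\<^sup>2)"
proof -
  note eq = powr_neg_times_cnj[of _ k, symmetric]
  have "complex_of_real (local_moment p (2 * k) r)
      = expectation (\<lambda>\<omega>. complex_of_real (cmod (1 - of_real r * f p \<omega>) powr (- (2 * k))))"
    unfolding local_moment_def by simp
  also have "\<dots> = expectation (\<lambda>\<omega>. f p \<omega> ^ 0 * (1 - of_real r * f p \<omega>) powr (- of_real k)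
            * cnj ((1 - of_real r * f p \<omega>) powr (- of_real k)))"
    unfolding eq by simp
  also have "\<dots> = of_real (\<Sum>j. (neg_binom k j * r ^ j)\<^sup>2)"
    by (subst expectation_neg_binom[OF p r k k]) (simp add: power2_eq_square)
  finally show ?thesis by (simp only: of_real_eq_iff)
qed

lemma summable_neg_binom_square:
  assumes r: "0 \<le> r" "r < 1" and k: "k \<ge> 0"
  shows "summable (\<lambda>j. (neg_binom k j * r ^ j)\<^sup>2)"
proof -
  have sm: "summable (\<lambda>j. neg_binom k j * r ^ j)"
    using neg_binom_sums_real[of r k] r by (auto simp: sums_iff)
  show ?thesis unfolding power2_eq_square
    by (rule summable_comparison_test[OF _ summable_mult2[OF sm, of "\<Sum>j. neg_binom k j * r ^ j"]])
       (use r k neg_binom_nonneg term_le_suminf[OF sm] in \<open>auto intro!: exI[of _ 0] mult_left_mono\<close>)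
qed

text \<open>Keeps the terms j = 0 and j = 1 of the Parseval sum.\<close>

lemma local_moment_ge:
  assumes p: "prime p" and r: "0 \<le> r" "r < 1" and k: "k \<ge> 0"
  shows "1 + (k * r)\<^sup>2 \<le> local_moment p (2 * k) r"
proof -
  have "sum (\<lambda>j. (neg_binom k j * r ^ j)\<^sup>2) {..<2} \<le> (\<Sum>j. (neg_binom k j * r ^ j)\<^sup>2)"
    by (rule sum_le_suminf[OF summable_neg_binom_square[OF r k]]) auto
  then show ?thesis unfolding local_moment_sums[OF assms] by (simp add: numeral_2_eq_2 neg_binom_1)
qed

lemma local_moment_le:
  assumes p: "prime p" and r: "0 \<le> r" "r < 1" and k: "k \<ge> 1" and kr: "k * r < 1"
  shows "local_moment p (2 * k) r \<le> 1 / (1 - (k * r)\<^sup>2)"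
proof -
  have x: "(k * r)\<^sup>2 < 1" "0 \<le> (k * r)\<^sup>2" using kr r k by (auto simp: power_less_one_iff abs_square_less_1)
  have "(\<Sum>j. (neg_binom k j * r ^ j)\<^sup>2) \<le> (\<Sum>j. ((k * r)\<^sup>2) ^ j)"
  proof (rule suminf_le)
    show "(neg_binom k j * r ^ j)\<^sup>2 \<le> ((k * r)\<^sup>2) ^ j" for j
    proof -
      have "neg_binom k j * r ^ j \<le> k ^ j * r ^ j"
        using neg_binom_le_power[OF k, of j] r by (intro mult_right_mono) auto
      then have "(neg_binom k j * r ^ j)\<^sup>2 \<le> ((k * r) ^ j)\<^sup>2"
        using k r neg_binom_nonneg[of k j] by (intro power_mono) (auto simp: power_mult_distrib)
      then show ?thesis by (simp add: power_mult[symmetric] mult.commute)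
    qed
    show "summable (\<lambda>j. (neg_binom k j * r ^ j)\<^sup>2)" using r k by (intro summable_neg_binom_square) auto
    show "summable (\<lambda>j. ((k * r)\<^sup>2) ^ j)" using x by (intro summable_geometric) auto
  qed
  also have "\<dots> = 1 / (1 - (k * r)\<^sup>2)" using x by (intro suminf_geometric) auto
  finally show ?thesis using local_moment_sums[of p r k] p r k by simp
qed

text \<open>A pointwise bound without the condition k r < 1, for the primes below the
  threshold.\<close>

lemma local_moment_le':
  assumes p: "prime p" and r: "0 \<le> r" "r < 1" and q: "q \<ge> 0"
  shows "local_moment p q r \<le> (1 - r) powr (- q)"
proof -
  note [measurable] = measurable_f[OF p]
  have b: "cmod (1 - of_real r * f p \<omega>) powr (- q) \<le> (1 - r) powr (- q)" for \<omega>
    using norm_one_minus_ge[OF p r(1), of \<omega>] r q by (intro powr_mono2') auto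
  have "local_moment p q r \<le> expectation (\<lambda>\<omega>. (1 - r) powr (- q))"
    unfolding local_moment_def
    by (intro integral_mono integrable_const_bound[of _ "(1 - r) powr (- q)"]) (use b in auto)
  then show ?thesis by (simp add: prob_space)
qed

lemma indep_vars_prime_functions:
  fixes g :: "nat \<Rightarrow> complex \<Rightarrow> 'b::{real_normed_field, banach, second_countable_topology}"
  assumes P: "finite P" "\<And>p. p \<in> P \<Longrightarrow> prime p"
    and g: "\<And>p. p \<in> P \<Longrightarrow> g p \<in> borel_measurable borel"
    and bound: "\<And>p \<omega>. p \<in> P \<Longrightarrow> norm (g p (f p \<omega>)) \<le> C p"
  shows "expectation (\<lambda>\<omega>. \<Prod>p\<in>P. g p (f p \<omega>)) = (\<Prod>p\<in>P. expectation (\<lambda>\<omega>. g p (f p \<omega>)))"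
proof (rule indep_vars_lebesgue_integral[OF P(1)])
  have "indep_vars (\<lambda>_. borel) f P" by (rule indep_vars_subset[OF indep_primes]) (use P in auto)
  then show "indep_vars (\<lambda>_. borel) (\<lambda>p \<omega>. g p (f p \<omega>)) P"
    by (rule indep_vars_compose2) (use g in auto)
  show "integrable M (\<lambda>\<omega>. g p (f p \<omega>))" if "p \<in> P" for p
    using g[OF that] measurable_f[OF P(2)[OF that]] bound[OF that]
    by (intro integrable_const_bound[of _ "C p"]) auto
qed

end

section \<open>Moments of the Euler product\<close>

definition radius :: "real \<Rightarrow> nat \<Rightarrow> real" where
  "radius s p = real p powr (- 1 / 2 - s)"

text \<open>The worst case is 1 / sqrt 2 at p = 2. The bound 3/4 makes every Euler factor at most 4
  in modulus.\<close>

lemma radius_bounds: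
  assumes "prime p" "s \<ge> 0"
  shows "0 < radius s p" "radius s p \<le> 3 / 4" "radius s p < 1"
proof -
  have p: "real p \<ge> 2" using prime_ge_2_nat[OF assms(1)] by simp
  then show "0 < radius s p" by (simp add: radius_def)
  have "radius s p \<le> real p powr (- 1 / 2)"
    unfolding radius_def using p assms by (intro powr_mono) auto
  also have "\<dots> \<le> 2 powr (- 1 / 2)" using p by (intro powr_mono2') auto
  also have "\<dots> = 1 / sqrt 2" by (simp add: powr_minus powr_half_sqrt[symmetric] inverse_eq_divide)
  also have "\<dots> \<le> 3 / 4"
  proof -
    have "(4 / 3 :: real) \<le> sqrt 2" by (rule real_le_rsqrt) (simp add: power2_eq_square)
    then show ?thesis by (simp add: field_simps)
  qed
  finally show "radius s p \<le> 3 / 4" .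
  then show "radius s p < 1" by simp
qed

lemma radius_square: "(radius s p)\<^sup>2 = real p powr (-1 - 2 * s)"
  by (simp add: radius_def power2_eq_square powr_add[symmetric])

lemma sum_inverse_sqrt_le: "(\<Sum>n=1..N. 1 / sqrt (real n)) \<le> 2 * sqrt (real N)"
proof (induction N)
  case (Suc N)
  define a where "a = sqrt (real N)"
  define b where "b = sqrt (real (Suc N))"
  have b: "b > 0" "a \<le> b" "a \<ge> 0" by (auto simp: a_def b_def)
  have "b * b - a * a = 1" by (simp add: a_def b_def)
  then have "1 = (b - a) * (b + a)" by (simp add: algebra_simps)
  also have "\<dots> \<le> (b - a) * (2 * b)" using b by (intro mult_left_mono) auto
  finally have "1 / b \<le> 2 * b - 2 * a" using b by (simp add: field_simps)
  then show ?case using Suc by (simp add: a_def b_def)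
qed simp

context unit_steinhaus
begin

definition euler :: "nat set \<Rightarrow> real \<Rightarrow> 'a \<Rightarrow> complex" where
  "euler P s \<omega> = (\<Prod>p\<in>P. 1 / (1 - of_real (radius s p) * f p \<omega>))"

definition euler_moment :: "nat set \<Rightarrow> real \<Rightarrow> real \<Rightarrow> real" where
  "euler_moment P s q = expectation (\<lambda>\<omega>. cmod (euler P s \<omega>) powr q)"

context
  fixes P :: "nat set" and s :: real
  assumes P: "finite P" "\<And>p. p \<in> P \<Longrightarrow> prime p" and s: "s \<ge> 0"
begin

lemma measurable_euler [measurable]: "euler P s \<in> borel_measurable M"
proof -
  have "(\<lambda>\<omega>. 1 / (1 - of_real (radius s p) * f p \<omega>)) \<in> borel_measurable M" if "p \<in> P" for p
    using measurable_f[OF P(2)[OF that]] by measurable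
  then show ?thesis unfolding euler_def[abs_def] by (intro borel_measurable_prod)
qed

lemma factor_ge:
  assumes "p \<in> P"
  shows "cmod (1 - of_real (radius s p) * f p \<omega>) \<ge> 1 / 4"
  using norm_one_minus_ge[OF P(2)[OF assms], of "radius s p" \<omega>] radius_bounds[OF P(2)[OF assms] s] by linarith

lemma factor_nz: "p \<in> P \<Longrightarrow> 1 - of_real (radius s p) * f p \<omega> \<noteq> 0"
  using factor_ge[of p \<omega>] by auto

text \<open>A crude bound depending on P; it serves integrability and dominated convergence only and
  does not enter the final estimates.\<close>

lemma norm_euler_le: "cmod (euler P s \<omega>) \<le> 4 ^ card P"
proof -
  have "cmod (euler P s \<omega>) = (\<Prod>p\<in>P. 1 / cmod (1 - of_real (radius s p) * f p \<omega>))"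
    by (simp add: euler_def prod_norm[symmetric] norm_divide)
  also have "\<dots> \<le> (\<Prod>p\<in>P. 4)"
  proof (intro prod_mono conjI)
    fix p assume "p \<in> P"
    from factor_ge[OF this, of \<omega>] show "1 / cmod (1 - of_real (radius s p) * f p \<omega>) \<le> 4"
      by (subst pos_divide_le_eq) linarith+
  qed auto
  finally show ?thesis by simp
qed

lemma integrable_euler_powr:
  assumes "q \<ge> 0"
  shows "integrable M (\<lambda>\<omega>. cmod (euler P s \<omega>) powr q)"
  by (rule integrable_const_bound[of _ "(4 ^ card P) powr q"])
     (use norm_euler_le assms in \<open>auto intro!: powr_mono2\<close>)

lemma euler_moment_eq_prod:
  assumes q: "q \<ge> 0"
  shows "euler_moment P s q = (\<Prod>p\<in>P. local_moment p q (radius s p))"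
proof -
  have "cmod (euler P s \<omega>) powr q = (\<Prod>p\<in>P. cmod (1 - of_real (radius s p) * f p \<omega>) powr (- q))" for \<omega>
    unfolding euler_def prod_norm[symmetric] using factor_nz
    by (subst prod_powr_distrib) (auto intro!: prod.cong simp: norm_divide powr_divide powr_minus inverse_eq_divide)
  then have "euler_moment P s q = expectation (\<lambda>\<omega>. \<Prod>p\<in>P. cmod (1 - of_real (radius s p) * f p \<omega>) powr (- q))"
    by (simp add: euler_moment_def)
  also have "\<dots> = (\<Prod>p\<in>P. expectation (\<lambda>\<omega>. cmod (1 - of_real (radius s p) * f p \<omega>) powr (- q)))"
  proof (rule indep_vars_prime_functions[OF P, of "\<lambda>p z. cmod (1 - of_real (radius s p) * z) powr (- q)" "\<lambda>_. (1 / 4) powr (- q)"])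
    show "norm (cmod (1 - of_real (radius s p) * f p \<omega>) powr (- q)) \<le> (1 / 4) powr (- q)" if "p \<in> P" for p \<omega>
      using factor_ge[OF that, of \<omega>] q by (auto intro!: powr_mono2')
  qed auto
  finally show ?thesis by (simp add: local_moment_def)
qed

lemma local_moment_radius_pos:
  assumes "k \<ge> 0" "p \<in> P"
  shows "0 < local_moment p (2 * k) (radius s p)"
proof -
  have p: "prime p" using P assms by auto
  have "0 < 1 + (k * radius s p)\<^sup>2" by (intro add_pos_nonneg) auto
  also have "\<dots> \<le> local_moment p (2 * k) (radius s p)"
    using radius_bounds[OF p s] assms by (intro local_moment_ge p) auto
  finally show ?thesis .
qed

lemma euler_moment_pos: "k \<ge> 0 \<Longrightarrow> euler_moment P s (2 * k) > 0"
  by (subst euler_moment_eq_prod) (auto intro!: prod_pos local_moment_radius_pos)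

lemma ln_euler_moment:
  assumes k: "k \<ge> 0"
  shows "ln (euler_moment P s (2 * k)) = (\<Sum>p\<in>P. ln (local_moment p (2 * k) (radius s p)))"
proof -
  have "local_moment p (2 * k) (radius s p) \<noteq> 0" if "p \<in> P" for p
    using local_moment_radius_pos[OF k that] by simp
  then show ?thesis using k P by (subst euler_moment_eq_prod) (auto intro: ln_prod)
qed

text \<open>Controls the quadratic error of the logarithm: the tail of 1/n^2 beyond floor (2 k^2) >=
  k^2 is at most 1 / k^2, which leaves k^4 / k^2.\<close>

lemma sum_inverse_squares_above:
  assumes k: "k \<ge> 1"
  shows "(\<Sum>p\<in>P - primes_upto (2 * k\<^sup>2). (k\<^sup>2 * real p powr (-1 - 2 * s))\<^sup>2) \<le> k\<^sup>2"
proof -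
  define N where "N = nat \<lfloor>2 * k\<^sup>2\<rfloor>"
  have k2: "k\<^sup>2 \<ge> 1" using k by simp
  have N: "real N \<ge> k\<^sup>2" "N \<ge> 1" using k2 by (auto simp: N_def le_nat_iff le_floor_iff intro: order_trans) linarith
  have "(\<Sum>p\<in>P - primes_upto (2 * k\<^sup>2). (k\<^sup>2 * real p powr (-1 - 2 * s))\<^sup>2)
     \<le> (\<Sum>p\<in>P - primes_upto (2 * k\<^sup>2). (k\<^sup>2)\<^sup>2 * (1 / (real p)\<^sup>2))"
  proof (rule sum_mono)
    fix p assume "p \<in> P - primes_upto (2 * k\<^sup>2)"
    then have p: "real p \<ge> 1" using P prime_ge_1_nat by auto
    have "real p powr (-1 - 2 * s) \<le> real p powr (-1)" using p s by (intro powr_mono) auto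
    then have "(real p powr (-1 - 2 * s))\<^sup>2 \<le> (real p powr (-1))\<^sup>2" by (intro power_mono) auto
    then show "(k\<^sup>2 * real p powr (-1 - 2 * s))\<^sup>2 \<le> (k\<^sup>2)\<^sup>2 * (1 / (real p)\<^sup>2)"
      unfolding power_mult_distrib by (intro mult_left_mono) (auto simp: powr_minus inverse_eq_divide power_divide)
  qed
  also have "\<dots> = (k\<^sup>2)\<^sup>2 * (\<Sum>p\<in>P - primes_upto (2 * k\<^sup>2). 1 / (real p)\<^sup>2)" by (simp add: sum_distrib_left)
  also have "(\<Sum>p\<in>P - primes_upto (2 * k\<^sup>2). 1 / (real p)\<^sup>2) \<le> (\<Sum>n\<in>{N<..Max (insert 0 P)}. 1 / (real n)\<^sup>2)"
  proof (intro sum_mono2 subsetI)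
    fix p assume "p \<in> P - primes_upto (2 * k\<^sup>2)"
    then have "real p > 2 * k\<^sup>2" "p \<in> P" using P by (auto simp: primes_upto_def)
    moreover have "real N \<le> 2 * k\<^sup>2" using k2 by (simp add: N_def)
    ultimately show "p \<in> {N<..Max (insert 0 P)}" using P by (auto simp: of_nat_less_iff[symmetric, where 'a = real] simp del: of_nat_less_iff)
  qed auto
  also have "\<dots> \<le> 1 / real N" by (rule sum_inverse_squares_le[OF N(2)])
  also have "\<dots> \<le> 1 / k\<^sup>2" using N k2 by (intro divide_left_mono mult_pos_pos) auto
  finally show ?thesis using k by (simp add: power2_eq_square)
qed

lemma above_threshold:
  assumes k: "k \<ge> 1" and p: "p \<in> P - primes_upto (2 * k\<^sup>2)"
  shows "(k * radius s p)\<^sup>2 \<le> 1 / 2" "k * radius s p < 1"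
    "(k * radius s p)\<^sup>2 = k\<^sup>2 * real p powr (-1 - 2 * s)"
proof -
  have pr: "prime p" using p P by auto
  then have p1: "real p \<ge> 1" using prime_ge_1_nat by auto
  have pk: "real p > 2 * k\<^sup>2" using p pr by (auto simp: primes_upto_def)
  show eq: "(k * radius s p)\<^sup>2 = k\<^sup>2 * real p powr (-1 - 2 * s)"
    by (simp add: power_mult_distrib radius_square)
  have "real p powr (-1 - 2 * s) \<le> real p powr (-1)" using p1 s by (intro powr_mono) auto
  also have "\<dots> = 1 / real p" by (simp add: powr_minus inverse_eq_divide)
  also have "\<dots> \<le> 1 / (2 * k\<^sup>2)" using pk k p1 by (intro divide_left_mono) (auto intro!: mult_pos_pos)
  finally have "k\<^sup>2 * real p powr (-1 - 2 * s) \<le> k\<^sup>2 * (1 / (2 * k\<^sup>2))" by (intro mult_left_mono) auto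
  then show le: "(k * radius s p)\<^sup>2 \<le> 1 / 2" using k unfolding eq by simp
  then have "(k * radius s p)\<^sup>2 < 1\<^sup>2" by simp
  then show "k * radius s p < 1" by (rule power2_less_imp_less) simp
qed

text \<open>Primes below the threshold contribute nonnegative logarithms and are dropped; above it
  ln (1 + x) >= x - x^2 is used with x <= 1/2.\<close>

lemma ln_euler_moment_ge:
  assumes k: "k \<ge> 1"
  shows "ln (euler_moment P s (2 * k)) \<ge> k\<^sup>2 * (\<Sum>p\<in>P - primes_upto (2 * k\<^sup>2). real p powr (-1 - 2 * s)) - k\<^sup>2"
proof -
  have ge: "ln (1 + (k * radius s p)\<^sup>2) \<le> ln (local_moment p (2 * k) (radius s p))" if "p \<in> P" for p
  proof -
    have p: "prime p" using P that by auto
    have pos: "0 < 1 + (k * radius s p)\<^sup>2" by (intro add_pos_nonneg) auto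
    have "1 + (k * radius s p)\<^sup>2 \<le> local_moment p (2 * k) (radius s p)"
      using radius_bounds[OF p s] k by (intro local_moment_ge p) auto
    then show ?thesis using pos by simp
  qed
  have "(\<Sum>p\<in>P - primes_upto (2 * k\<^sup>2). k\<^sup>2 * real p powr (-1 - 2 * s) - (k\<^sup>2 * real p powr (-1 - 2 * s))\<^sup>2)
      \<le> (\<Sum>p\<in>P - primes_upto (2 * k\<^sup>2). ln (local_moment p (2 * k) (radius s p)))"
  proof (rule sum_mono)
    fix p assume p: "p \<in> P - primes_upto (2 * k\<^sup>2)"
    have "(k * radius s p)\<^sup>2 - ((k * radius s p)\<^sup>2)\<^sup>2 \<le> ln (1 + (k * radius s p)\<^sup>2)"
      using above_threshold(1)[OF k p] by (intro ln_one_plus_pos_lower_bound) auto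
    also have "\<dots> \<le> ln (local_moment p (2 * k) (radius s p))" using ge p by auto
    finally show "k\<^sup>2 * real p powr (-1 - 2 * s) - (k\<^sup>2 * real p powr (-1 - 2 * s))\<^sup>2
      \<le> ln (local_moment p (2 * k) (radius s p))" unfolding above_threshold(3)[OF k p] .
  qed
  also have "\<dots> \<le> (\<Sum>p\<in>P. ln (local_moment p (2 * k) (radius s p)))"
  proof (rule sum_mono2)
    fix p assume "p \<in> P - (P - primes_upto (2 * k\<^sup>2))"
    then have "p \<in> P" by auto
    have "0 \<le> ln (1 + (k * radius s p)\<^sup>2)" by (intro ln_ge_zero) auto
    also have "\<dots> \<le> ln (local_moment p (2 * k) (radius s p))" using ge \<open>p \<in> P\<close> by auto
    finally show "0 \<le> ln (local_moment p (2 * k) (radius s p))" .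
  qed (use P in auto)
  also have "\<dots> = ln (euler_moment P s (2 * k))" using k by (intro ln_euler_moment[symmetric]) auto
  finally show ?thesis using sum_inverse_squares_above[OF k]
    by (simp add: sum_subtractf sum_distrib_left)
qed

text \<open>Below the threshold the pointwise bound gives at most 8 k / sqrt p for each prime; even
  summed over all integers up to 2 k^2 this is 8 k * 2 * (3/2) k = 24 k^2. The remaining 2 k^2 is
  the quadratic error above the threshold.\<close>

lemma ln_euler_moment_le:
  assumes k: "k \<ge> 1"
  shows "ln (euler_moment P s (2 * k)) \<le> k\<^sup>2 * (\<Sum>p\<in>P - primes_upto (2 * k\<^sup>2). real p powr (-1 - 2 * s)) + 26 * k\<^sup>2"
proof -
  let ?w = "2 * k\<^sup>2"
  have pos: "local_moment p (2 * k) (radius s p) > 0" if "p \<in> P" for p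
    using local_moment_radius_pos[of k p] that k by simp
  have small: "(\<Sum>p\<in>P \<inter> primes_upto ?w. ln (local_moment p (2 * k) (radius s p))) \<le> 24 * k\<^sup>2"
  proof -
    define N where "N = nat \<lfloor>?w\<rfloor>"
    have "(\<Sum>p\<in>P \<inter> primes_upto ?w. ln (local_moment p (2 * k) (radius s p)))
      \<le> (\<Sum>p\<in>P \<inter> primes_upto ?w. 8 * k * (1 / sqrt (real p)))"
    proof (rule sum_mono)
      fix p assume "p \<in> P \<inter> primes_upto ?w"
      then have pP: "p \<in> P" and p: "prime p" using P by auto
      note r = radius_bounds[OF p s]
      have "ln (local_moment p (2 * k) (radius s p)) \<le> ln ((1 - radius s p) powr (- (2 * k)))"
        using local_moment_le'[OF p, of "radius s p" "2 * k"] pos[OF pP] r k by (subst ln_le_cancel_iff) auto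
      also have "\<dots> = 2 * k * ln (1 / (1 - radius s p))" using r by (simp add: ln_powr ln_div)
      also have "ln (1 / (1 - radius s p)) \<le> 1 / (1 - radius s p) - 1" using r by (intro ln_le_minus_one) auto
      also have "\<dots> = radius s p / (1 - radius s p)" using r by (simp add: field_simps)
      also have "\<dots> \<le> radius s p / (1 / 4)" using r by (intro divide_left_mono) auto
      also have "\<dots> = 4 * radius s p" by simp
      also have "radius s p \<le> real p powr (- (1 / 2))"
        unfolding radius_def using s prime_ge_1_nat[OF p] by (intro powr_mono) auto
      also have "\<dots> = 1 / sqrt (real p)" by (simp add: powr_minus powr_half_sqrt inverse_eq_divide)
      finally show "ln (local_moment p (2 * k) (radius s p)) \<le> 8 * k * (1 / sqrt (real p))"
        using k by (simp add: mult_left_mono)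
    qed
    also have "\<dots> = 8 * k * (\<Sum>p\<in>P \<inter> primes_upto ?w. 1 / sqrt (real p))" by (simp only: sum_distrib_left)
    also have "(\<Sum>p\<in>P \<inter> primes_upto ?w. 1 / sqrt (real p)) \<le> (\<Sum>n=1..N. 1 / sqrt (real n))"
      by (intro sum_mono2) (auto simp: primes_upto_def N_def le_nat_floor Suc_le_eq prime_gt_0_nat)
    also have "\<dots> \<le> 2 * sqrt (real N)" by (rule sum_inverse_sqrt_le)
    also have "sqrt (real N) \<le> sqrt ((3 / 2 * k)\<^sup>2)"
    proof (rule real_sqrt_le_mono)
      have "real N \<le> 2 * k\<^sup>2" by (simp add: N_def)
      also have "\<dots> \<le> (3 / 2 * k)\<^sup>2" by (simp add: power2_eq_square)
      finally show "real N \<le> (3 / 2 * k)\<^sup>2" .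
    qed
    also have "\<dots> = 3 / 2 * k" using k by simp
    finally show ?thesis using k by (simp add: power2_eq_square mult_left_mono)
  qed
  have large: "(\<Sum>p\<in>P - primes_upto ?w. ln (local_moment p (2 * k) (radius s p)))
     \<le> (\<Sum>p\<in>P - primes_upto ?w. k\<^sup>2 * real p powr (-1 - 2 * s) + 2 * (k\<^sup>2 * real p powr (-1 - 2 * s))\<^sup>2)"
  proof (rule sum_mono)
    fix p assume p: "p \<in> P - primes_upto ?w"
    then have pr: "prime p" and pP: "p \<in> P" using P by auto
    note r = radius_bounds[OF pr s]
    define x where "x = (k * radius s p)\<^sup>2"
    have x: "x \<le> 1 / 2" "x \<ge> 0" using above_threshold(1)[OF k p] by (auto simp: x_def)
    have "local_moment p (2 * k) (radius s p) \<le> 1 / (1 - x)"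
      unfolding x_def using above_threshold(2)[OF k p] r k by (intro local_moment_le pr) auto
    then have "ln (local_moment p (2 * k) (radius s p)) \<le> ln (1 / (1 - x))" using pos[OF pP] x by (subst ln_le_cancel_iff) auto
    also have "\<dots> \<le> x + 2 * x\<^sup>2" using ln_one_minus_pos_lower_bound[of x] x by (simp add: ln_div)
    finally show "ln (local_moment p (2 * k) (radius s p))
       \<le> k\<^sup>2 * real p powr (-1 - 2 * s) + 2 * (k\<^sup>2 * real p powr (-1 - 2 * s))\<^sup>2"
      unfolding x_def above_threshold(3)[OF k p] .
  qed
  have "ln (euler_moment P s (2 * k)) = (\<Sum>p\<in>P. ln (local_moment p (2 * k) (radius s p)))"
    using k by (intro ln_euler_moment) auto
  also have "\<dots> = (\<Sum>p\<in>P \<inter> primes_upto ?w. ln (local_moment p (2 * k) (radius s p)))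
      + (\<Sum>p\<in>P - primes_upto ?w. ln (local_moment p (2 * k) (radius s p)))"
    using P by (subst sum.union_disjoint[symmetric]) (auto intro!: sum.cong)
  finally show ?thesis using small large sum_inverse_squares_above[OF k]
    by (simp add: sum.distrib sum_distrib_left[symmetric])
qed

end

end

section \<open>Truncation in mean\<close>

lemma ln_eq_sum_multiplicity:
  assumes "n > (0::nat)"
  shows "ln (real n) = (\<Sum>p\<in>prime_factors n. real (multiplicity p n) * ln (real p))"
proof -
  have "ln (real n) = ln (\<Prod>p\<in>prime_factors n. real p ^ multiplicity p n)"
    using prod_prime_factors[of n] assms by (simp flip: of_nat_power of_nat_prod)
  also have "\<dots> = (\<Sum>p\<in>prime_factors n. ln (real p ^ multiplicity p n))"
    by (rule ln_prod) (auto intro!: prime_gt_0_nat)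
  also have "\<dots> = (\<Sum>p\<in>prime_factors n. real (multiplicity p n) * ln (real p))"
    by (intro sum.cong refl ln_realpow)
  finally show ?thesis .
qed

text \<open>Rounding \<open>R ln p\<close> for large \<open>R\<close> gives integer frequencies that separate the integers up to
  \<open>N\<close> from the larger ones, so that truncation becomes a half-line projection on the circle.\<close>

lemma integer_frequencies:
  fixes A :: "nat set" and N :: nat
  assumes A: "finite A" "\<And>n. n \<in> A \<Longrightarrow> n > 0" and N: "N \<ge> 1"
  obtains h :: "nat \<Rightarrow> int" and h0 :: int where
    "\<And>n. n \<in> A \<Longrightarrow> (\<Sum>p\<in>prime_factors n. int (multiplicity p n) * h p) - h0 \<noteq> 0"
    "\<And>n. n \<in> A \<Longrightarrow> (\<Sum>p\<in>prime_factors n. int (multiplicity p n) * h p) - h0 < 0 \<longleftrightarrow> n \<le> N"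
proof -
  define \<Omega> where "\<Omega> n = (\<Sum>p\<in>prime_factors n. real (multiplicity p n))" for n :: nat
  define K where "K = sum \<Omega> A"
  have \<Omega>0: "\<Omega> n \<ge> 0" for n by (simp add: \<Omega>_def sum_nonneg)
  have K: "\<Omega> n \<le> K" if "n \<in> A" for n
    unfolding K_def using A \<Omega>0 that by (intro member_le_sum) auto
  have K0: "K \<ge> 0" using \<Omega>0 by (simp add: K_def sum_nonneg)
  define c where "c = ln (real (N + 1)) - ln (real N)"
  have c: "c > 0" using N by (simp add: c_def)
  \<comment> \<open>Rounding the angles down lowers H n by at most \<Omega>(n) <= K. With this R the
    gap between ln N and ln (N + 1) is stretched to K + 2, which absorbs that loss and the rounding
    in \<open>h0\<close>.\<close>
  define R where "R = (K + 2) / c"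
  have R: "R \<ge> 0" "R * c = K + 2" using c K0 by (auto simp: R_def)
  define h where "h p = \<lfloor>R * ln (real p)\<rfloor>" for p :: nat
  define H where "H n = (\<Sum>p\<in>prime_factors n. int (multiplicity p n) * h p)" for n
  \<comment> \<open>The extra 1 puts \<open>h0\<close> strictly above H n for every n <= N, so the
    frequency 0 never occurs.\<close>
  define h0 where "h0 = \<lfloor>R * ln (real N)\<rfloor> + 1"
  have up: "of_int (H n) \<le> R * ln (real n)" if "n > 0" for n
  proof -
    have "of_int (H n) = (\<Sum>p\<in>prime_factors n. real (multiplicity p n) * of_int (h p))" by (simp add: H_def)
    also have "\<dots> \<le> (\<Sum>p\<in>prime_factors n. real (multiplicity p n) * (R * ln (real p)))"
      by (intro sum_mono mult_left_mono) (auto simp: h_def)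
    also have "\<dots> = R * ln (real n)"
      unfolding ln_eq_sum_multiplicity[OF that] by (simp add: sum_distrib_left mult_ac)
    finally show ?thesis .
  qed
  have low: "of_int (H n) \<ge> R * ln (real n) - \<Omega> n" if "n > 0" for n
  proof -
    have "R * ln (real n) - \<Omega> n = (\<Sum>p\<in>prime_factors n. real (multiplicity p n) * (R * ln (real p) - 1))"
      unfolding ln_eq_sum_multiplicity[OF that] \<Omega>_def
      by (simp add: sum_distrib_left sum_subtractf[symmetric] algebra_simps)
    also have "\<dots> \<le> (\<Sum>p\<in>prime_factors n. real (multiplicity p n) * of_int (h p))"
    proof (intro sum_mono mult_left_mono)
      show "R * ln (real p) - 1 \<le> of_int (h p)" for p unfolding h_def by linarith
    qed auto
    also have "\<dots> = of_int (H n)" by (simp add: H_def)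
    finally show ?thesis .
  qed
  have le: "H n < h0" if "n \<in> A" "n \<le> N" for n
  proof -
    have "of_int (H n) \<le> R * ln (real n)" using up A that by auto
    also have "\<dots> \<le> R * ln (real N)" using A(2)[OF that(1)] that R by (intro mult_left_mono) auto
    finally have "H n \<le> \<lfloor>R * ln (real N)\<rfloor>" by (simp add: le_floor_iff)
    then show ?thesis by (simp add: h0_def)
  qed
  have gt: "H n > h0" if "n \<in> A" "\<not> n \<le> N" for n
  proof -
    have n: "n \<ge> N + 1" "n > 0" using that by auto
    have "R * ln (real N) + 2 \<le> R * ln (real (N + 1)) - K" using R(2) by (simp add: c_def algebra_simps)
    also have "\<dots> \<le> R * ln (real n) - \<Omega> n"
    proof -
      have "R * ln (real (N + 1)) \<le> R * ln (real n)" using n R by (intro mult_left_mono) auto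
      then show ?thesis using K[OF that(1)] by linarith
    qed
    also have "\<dots> \<le> of_int (H n)" using low n by auto
    finally have "of_int h0 < (of_int (H n) :: real)" unfolding h0_def by linarith
    then show ?thesis by simp
  qed
  show ?thesis
  proof (rule that[of h h0])
    fix n assume n: "n \<in> A"
    show "(\<Sum>p\<in>prime_factors n. int (multiplicity p n) * h p) - h0 \<noteq> 0"
      using le[OF n] gt[OF n] by (cases "n \<le> N") (auto simp: H_def)
    show "(\<Sum>p\<in>prime_factors n. int (multiplicity p n) * h p) - h0 < 0 \<longleftrightarrow> n \<le> N"
      using le[OF n] gt[OF n] by (cases "n \<le> N") (auto simp: H_def)
  qed
qed

text \<open>Jensen's inequality up to the harmless factor 2^r. With l the weighted r-th power mean,
  y <= l + l^(1-r) y^r holds termwise, and the two parts each sum to W l.\<close>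

lemma weighted_power_mean:
  fixes w y :: "'i \<Rightarrow> real"
  assumes I: "finite I" and w: "\<And>i. i \<in> I \<Longrightarrow> w i \<ge> 0" and y: "\<And>i. i \<in> I \<Longrightarrow> y i \<ge> 0"
    and r: "r \<ge> 1" and W: "sum w I > 0"
  shows "(\<Sum>i\<in>I. w i * y i) powr r \<le> 2 powr r * (sum w I) powr (r - 1) * (\<Sum>i\<in>I. w i * y i powr r)"
proof -
  define W where "W = sum w I"
  define Y where "Y = (\<Sum>i\<in>I. w i * y i powr r) / W"
  have Y0: "Y \<ge> 0" using w W unfolding Y_def W_def by (intro divide_nonneg_pos sum_nonneg) auto
  have W0: "W > 0" using W by (simp add: W_def)
  have sY: "(\<Sum>i\<in>I. w i * y i powr r) = W * Y" using W0 by (simp add: Y_def)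
  have "(\<Sum>i\<in>I. w i * y i) \<le> 2 * W * Y powr (1 / r)"
  proof (cases "Y = 0")
    case True
    then have "\<forall>i\<in>I. w i * y i powr r = 0"
      using sY I w by (subst sum_nonneg_eq_0_iff[symmetric]) auto
    then have "\<forall>i\<in>I. w i * y i = 0" by auto
    then have "(\<Sum>i\<in>I. w i * y i) = 0" by (intro sum.neutral) auto
    then show ?thesis using W0 by simp
  next
    case False
    then have Y: "Y > 0" using Y0 by simp
    define l where "l = Y powr (1 / r)"
    have l: "l > 0" "l powr r = Y" using Y r by (auto simp: l_def powr_powr)
    have "(\<Sum>i\<in>I. w i * y i) \<le> (\<Sum>i\<in>I. w i * (l + l powr (1 - r) * y i powr r))"
    proof (intro sum_mono mult_left_mono)
      fix i assume i: "i \<in> I"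
      show "y i \<le> l + l powr (1 - r) * y i powr r"
      proof (cases "y i \<le> l")
        case True
        moreover have "l powr (1 - r) * y i powr r \<ge> 0" by simp
        ultimately show ?thesis by linarith
      next
        case False
        then have yi: "y i > 0" "l < y i" using l by auto
        have "y i = y i powr (1 - r) * y i powr r" using yi by (simp add: powr_add[symmetric])
        also have "\<dots> \<le> l powr (1 - r) * y i powr r"
          using yi l r by (intro mult_right_mono powr_mono2') auto
        finally show ?thesis using l by linarith
      qed
    qed (use w in auto)
    also have "\<dots> = W * l + l powr (1 - r) * (\<Sum>i\<in>I. w i * y i powr r)"
      unfolding W_def by (simp add: distrib_left sum.distrib sum_distrib_left sum_distrib_right mult_ac)
    also note sY
    also have "l powr (1 - r) * (W * Y) = W * (l powr (1 - r) * l powr r)" using l by simp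
    also have "l powr (1 - r) * l powr r = l" using l(1) by (simp add: powr_add[symmetric])
    finally show ?thesis by (simp add: l_def)
  qed
  then have "(\<Sum>i\<in>I. w i * y i) powr r \<le> (2 * W * Y powr (1 / r)) powr r"
    using r w y by (intro powr_mono2 sum_nonneg) auto
  also have "\<dots> = 2 powr r * W powr r * Y"
    using W0 Y0 r by (simp add: powr_mult powr_powr)
  also have "W powr r = W powr (r - 1) * W" using W0 by (simp add: powr_diff)
  finally show ?thesis using sY by (simp add: W_def mult_ac)
qed

text \<open>Young's inequality with a free parameter and crude constants: the first term covers a <=
  t b, the second a > t b. It stands in for Hoelder's inequality in the duality argument.\<close>

lemma young_powr:
  fixes a b t r :: real
  assumes "a \<ge> 0" "b \<ge> 0" "t > 0" "r > 1"
  shows "a * b powr (r - 1) \<le> t * b powr r + t powr (1 - r) * a powr r"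
proof (cases "a \<le> t * b")
  case True
  have "a * b powr (r - 1) \<le> (t * b) * b powr (r - 1)" using True by (intro mult_right_mono) auto
  also have "\<dots> = t * b powr r" using assms by (cases "b = 0") (auto simp: powr_diff)
  finally have "a * b powr (r - 1) \<le> t * b powr r" .
  moreover have "0 \<le> t powr (1 - r) * a powr r" by simp
  ultimately show ?thesis by linarith
next
  case False
  then have a: "a > 0" "b \<le> a / t" using assms by (auto simp: field_simps) (meson mult_nonneg_nonneg less_le_trans not_le order_trans less_imp_le)
  have "a * b powr (r - 1) \<le> a * (a / t) powr (r - 1)"
    using a assms by (intro mult_left_mono powr_mono2) auto
  also have "\<dots> = t powr (1 - r) * a powr r"
    using a assms by (simp add: powr_divide powr_diff field_simps)
  finally have "a * b powr (r - 1) \<le> t powr (1 - r) * a powr r" .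
  moreover have "0 \<le> t * b powr r" using assms by simp
  ultimately show ?thesis by linarith
qed

section \<open>Transfer of the circle inequality to the random sums\<close>

context unit_steinhaus
begin

lemma cmod_sum_mult_ext_le: "cmod (\<Sum>n\<in>A. b n * mult_ext f n \<omega>) \<le> (\<Sum>n\<in>A. cmod (b n))"
  by (rule sum_norm_le) (simp add: norm_mult)

lemma integrable_sum_mult_ext:
  assumes "r \<ge> 0"
  shows "integrable M (\<lambda>\<omega>. cmod (\<Sum>n\<in>A. b n * mult_ext f n \<omega>) powr r)"
  by (rule integrable_const_bound[of _ "(\<Sum>n\<in>A. cmod (b n)) powr r"])
     (use assms cmod_sum_mult_ext_le in \<open>auto intro!: powr_mono2\<close>)

text \<open>For fixed t the twist by cis (H n t) is a rotation of the f(p), up to the common factor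
  cis (-h0 t) of modulus 1, so the expectation does not depend on t. Fubini for nonnegative
  functions then integrates over the period.\<close>

lemma nn_integral_circle_average:
  fixes b :: "nat \<Rightarrow> complex" and h :: "nat \<Rightarrow> int" and h0 :: int
  assumes r: "r > 0"
  defines "H \<equiv> \<lambda>n. (\<Sum>p\<in>prime_factors n. int (multiplicity p n) * h p) - h0"
  shows "(\<integral>\<^sup>+\<omega>. ennreal (integral {0..2*pi} (\<lambda>t. cmod (\<Sum>n\<in>A. (b n * mult_ext f n \<omega>) * cis (of_int (H n) * t)) powr r)) \<partial>M)
     = ennreal (2 * pi * expectation (\<lambda>\<omega>. cmod (\<Sum>n\<in>A. b n * mult_ext f n \<omega>) powr r))"
proof -
  define g where "g \<omega> t = cmod (\<Sum>n\<in>A. (b n * mult_ext f n \<omega>) * cis (of_int (H n) * t)) powr r" for \<omega> t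
  define e where "e = expectation (\<lambda>\<omega>. cmod (\<Sum>n\<in>A. b n * mult_ext f n \<omega>) powr r)"
  have e0: "e \<ge> 0" by (simp add: e_def)
  have avg: "expectation (\<lambda>\<omega>. g \<omega> t) = e" for t
  proof -
    have "g \<omega> t = cmod (\<Sum>n\<in>A. b n * (mult_ext f n \<omega> *
           cis (\<Sum>p\<in>prime_factors n. real (multiplicity p n) * (of_int (h p) * t)))) powr r" for \<omega>
    proof -
      have "(\<Sum>n\<in>A. (b n * mult_ext f n \<omega>) * cis (of_int (H n) * t)) = cis (- of_int h0 * t) * (\<Sum>n\<in>A. b n * (mult_ext f n \<omega> *
           cis (\<Sum>p\<in>prime_factors n. real (multiplicity p n) * (of_int (h p) * t))))"
        unfolding sum_distrib_left
        by (intro sum.cong refl) (simp add: H_def cis_mult left_diff_distrib right_diff_distrib sum_distrib_right sum_distrib_left mult_ac)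
      then show ?thesis by (simp add: g_def norm_mult)
    qed
    then show ?thesis unfolding e_def using expectation_rotate[where A = A and b = b and h = "\<lambda>p. of_int (h p) * t" and r = r] by simp
  qed
  have [measurable]: "(\<lambda>(\<omega>, t). g \<omega> t) \<in> borel_measurable (M \<Otimes>\<^sub>M lborel)"
    unfolding g_def by measurable
  have gint: "integrable M (\<lambda>\<omega>. g \<omega> t)" for t
  proof -
    have "g \<omega> t = cmod (\<Sum>n\<in>A. (b n * cis (of_int (H n) * t)) * mult_ext f n \<omega>) powr r" for \<omega>
      by (simp add: g_def mult_ac)
    then show ?thesis using integrable_sum_mult_ext[where r = r and A = A and b = "\<lambda>n. b n * cis (of_int (H n) * t)"] r by simp
  qed
  interpret pair_sigma_finite M lborel ..
  have inner: "ennreal (integral {0..2*pi} (g \<omega>)) = (\<integral>\<^sup>+t. ennreal (indicator {0..2*pi} t * g \<omega> t) \<partial>lborel)" for \<omega>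
  proof -
    have "g \<omega> integrable_on {0..2*pi}"
      unfolding g_def cis_conv_exp
      by (rule integrable_continuous_real, rule continuous_on_powr') (use r in \<open>auto intro!: continuous_intros\<close>)
    then have "(g \<omega> has_integral integral {0..2*pi} (g \<omega>)) {0..2*pi}" by (rule integrable_integral)
    from nn_integral_has_integral_lebesgue[OF _ this] show ?thesis by (simp add: g_def)
  qed
  have "(\<integral>\<^sup>+\<omega>. ennreal (integral {0..2*pi} (g \<omega>)) \<partial>M)
     = (\<integral>\<^sup>+\<omega>. (\<integral>\<^sup>+t. ennreal (indicator {0..2*pi} t * g \<omega> t) \<partial>lborel) \<partial>M)"
    unfolding inner ..
  also have "\<dots> = (\<integral>\<^sup>+t. (\<integral>\<^sup>+\<omega>. ennreal (indicator {0..2*pi} t * g \<omega> t) \<partial>M) \<partial>lborel)"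
    by (rule Fubini'[symmetric]) measurable
  also have "\<dots> = (\<integral>\<^sup>+t. ennreal e * indicator {0..2*pi} t \<partial>lborel)"
  proof (rule nn_integral_cong)
    fix t :: real
    have "(\<integral>\<^sup>+\<omega>. ennreal (g \<omega> t) \<partial>M) = ennreal e"
      unfolding avg[of t, symmetric] by (rule nn_integral_eq_integral[OF gint]) (simp add: g_def)
    then show "(\<integral>\<^sup>+\<omega>. ennreal (indicator {0..2*pi} t * g \<omega> t) \<partial>M) = ennreal e * indicator {0..2*pi} t"
      by (auto simp: indicator_def)
  qed
  also have "\<dots> = ennreal e * ennreal (2 * pi)" by (subst nn_integral_cmult_indicator) auto
  also have "\<dots> = ennreal (2 * pi * e)" using e0 by (simp add: ennreal_mult[symmetric] mult_ac)
  finally show ?thesis by (simp add: g_def[abs_def] e_def)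
qed

text \<open>For each fixed outcome the twisted sum is a trigonometric polynomial in t whose negative
  frequencies are exactly those with n <= N. The M. Riesz inequality is applied there, and averaging
  over outcomes removes the twist.\<close>

lemma expectation_truncation_le:
  fixes b :: "nat \<Rightarrow> complex" and N :: nat
  assumes A: "finite A" "\<And>n. n \<in> A \<Longrightarrow> n > 0" and r: "r > 6"
  shows "expectation (\<lambda>\<omega>. cmod (\<Sum>n\<in>{n\<in>A. n \<le> N}. b n * mult_ext f n \<omega>) powr r)
     \<le> 2 * r powr r * expectation (\<lambda>\<omega>. cmod (\<Sum>n\<in>A. b n * mult_ext f n \<omega>) powr r)" (is "?l \<le> _ * ?r")
proof (cases "N \<ge> 1")
  case False
  then have e: "{n \<in> A. n \<le> N} = {}" using A by force
  show ?thesis unfolding e by simp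
next
  case True
  obtain h h0 where h: "\<And>n. n \<in> A \<Longrightarrow> (\<Sum>p\<in>prime_factors n. int (multiplicity p n) * h p) - h0 \<noteq> 0"
    "\<And>n. n \<in> A \<Longrightarrow> (\<Sum>p\<in>prime_factors n. int (multiplicity p n) * h p) - h0 < 0 \<longleftrightarrow> n \<le> N"
    using integer_frequencies[OF A True] by metis
  define H where "H n = (\<Sum>p\<in>prime_factors n. int (multiplicity p n) * h p) - h0" for n
  have eq: "{n \<in> A. n \<le> N} = {n \<in> A. H n < 0}" using h by (auto simp: H_def)
  have r0: "r > 0" and c0: "2 * r powr r \<ge> 0" using r by auto
  have "ennreal (2 * pi * ?l) = (\<integral>\<^sup>+\<omega>. ennreal (integral {0..2*pi} (\<lambda>t. cmod (\<Sum>n\<in>{n\<in>A. n \<le> N}. (b n * mult_ext f n \<omega>) * cis (of_int (H n) * t)) powr r)) \<partial>M)"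
    unfolding H_def by (rule nn_integral_circle_average[OF r0, symmetric])
  also have "\<dots> \<le> (\<integral>\<^sup>+\<omega>. ennreal (2 * r powr r) * ennreal (integral {0..2*pi} (\<lambda>t. cmod (\<Sum>n\<in>A. (b n * mult_ext f n \<omega>) * cis (of_int (H n) * t)) powr r)) \<partial>M)"
  proof (rule nn_integral_mono)
    fix \<omega>
    show "ennreal (integral {0..2*pi} (\<lambda>t. cmod (\<Sum>n\<in>{n\<in>A. n \<le> N}. (b n * mult_ext f n \<omega>) * cis (of_int (H n) * t)) powr r))
      \<le> ennreal (2 * r powr r) * ennreal (integral {0..2*pi} (\<lambda>t. cmod (\<Sum>n\<in>A. (b n * mult_ext f n \<omega>) * cis (of_int (H n) * t)) powr r))"
      unfolding eq ennreal_mult'[OF c0, symmetric]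
      by (intro ennreal_leI riesz_trigonometric A r) (use h in \<open>auto simp: H_def\<close>)
  qed
  also have "\<dots> = ennreal (2 * r powr r) * (\<integral>\<^sup>+\<omega>. ennreal (integral {0..2*pi} (\<lambda>t. cmod (\<Sum>n\<in>A. (b n * mult_ext f n \<omega>) * cis (of_int (H n) * t)) powr r)) \<partial>M)"
  proof (rule nn_integral_cmult)
    have "(\<lambda>\<omega>. \<integral>\<^sup>+t. ennreal (indicator {0..2*pi} t * cmod (\<Sum>n\<in>A. (b n * mult_ext f n \<omega>) * cis (of_int (H n) * t)) powr r) \<partial>lborel) \<in> borel_measurable M"
      by measurable
    moreover have "(\<integral>\<^sup>+t. ennreal (indicator {0..2*pi} t * cmod (\<Sum>n\<in>A. (b n * mult_ext f n \<omega>) * cis (of_int (H n) * t)) powr r) \<partial>lborel)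
      = ennreal (integral {0..2*pi} (\<lambda>t. cmod (\<Sum>n\<in>A. (b n * mult_ext f n \<omega>) * cis (of_int (H n) * t)) powr r))" for \<omega>
    proof (rule nn_integral_has_integral_lebesgue[OF _ integrable_integral])
      show "(\<lambda>t. cmod (\<Sum>n\<in>A. (b n * mult_ext f n \<omega>) * cis (of_int (H n) * t)) powr r) integrable_on {0..2*pi}"
        unfolding cis_conv_exp
        by (rule integrable_continuous_real, rule continuous_on_powr') (use r in \<open>auto intro!: continuous_intros\<close>)
    qed simp
    ultimately show "(\<lambda>\<omega>. ennreal (integral {0..2*pi} (\<lambda>t. cmod (\<Sum>n\<in>A. (b n * mult_ext f n \<omega>) * cis (of_int (H n) * t)) powr r))) \<in> borel_measurable M"
      by simp
  qed
  also have "\<dots> = ennreal (2 * r powr r) * ennreal (2 * pi * ?r)"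
    unfolding H_def by (subst nn_integral_circle_average[OF r0]) simp
  also have "\<dots> = ennreal (2 * r powr r * (2 * pi * ?r))" by (rule ennreal_mult'[OF c0, symmetric])
  finally have "2 * pi * ?l \<le> 2 * r powr r * (2 * pi * ?r)"
    by (subst (asm) ennreal_le_iff) (auto intro!: mult_nonneg_nonneg)
  then have "2 * pi * ?l \<le> 2 * pi * (2 * r powr r * ?r)" by (simp add: mult_ac)
  then show ?thesis by (subst (asm) mult_le_cancel_left_pos) auto
qed

end

section \<open>The upper bound\<close>

context unit_steinhaus
begin

definition dpoly :: "nat set \<Rightarrow> real \<Rightarrow> 'a \<Rightarrow> complex" where
  "dpoly A s \<omega> = (\<Sum>n\<in>A. of_real (real n powr (- 1 / 2 - s)) * mult_ext f n \<omega>)"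

lemma measurable_dpoly [measurable]: "dpoly A s \<in> borel_measurable M"
  unfolding dpoly_def[abs_def] by measurable

lemma integrable_dpoly_powr: "q \<ge> 0 \<Longrightarrow> integrable M (\<lambda>\<omega>. cmod (dpoly A s \<omega>) powr q)"
  unfolding dpoly_def by (rule integrable_sum_mult_ext)

lemma M_sum_eq_dpoly:
  assumes "x \<ge> 0"
  shows "M_sum f x \<omega> = dpoly {1..nat \<lfloor>x\<rfloor>} 0 \<omega>"
proof -
  have eq: "{n::nat. 1 \<le> n \<and> real n \<le> x} = {1..nat \<lfloor>x\<rfloor>}"
    using assms by (auto simp: le_nat_floor le_nat_iff le_floor_iff)
  have "real n powr (- 1 / 2 - 0) = 1 / sqrt (real n)" for n
  proof -
    have "real n powr (- 1 / 2 - 0) = real n powr (- (1 / 2))" by simp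
    also have "\<dots> = inverse (real n powr (1 / 2))" by (rule powr_minus)
    also have "\<dots> = 1 / sqrt (real n)" by (simp only: powr_half_sqrt[OF of_nat_0_le_iff] inverse_eq_divide)
    finally show ?thesis .
  qed
  then show ?thesis unfolding M_sum_def dpoly_def eq
    by (intro sum.cong refl) simp
qed

context
  fixes P :: "nat set"
  assumes P: "finite P" "\<And>p. p \<in> P \<Longrightarrow> prime p"
begin

lemma mult_ext_eq_prod:
  assumes "n > 0" "prime_factors n \<subseteq> P"
  shows "mult_ext f n \<omega> = (\<Prod>p\<in>P. f p \<omega> ^ multiplicity p n)"
  unfolding mult_ext_def by (rule prod_multiplicity[symmetric]) (use P assms in auto)

lemma dpoly_smooth_nats:
  "dpoly (smooth_nats P J) s \<omega> = (\<Prod>p\<in>P. \<Sum>j\<le>J. (of_real (radius s p) * f p \<omega>) ^ j)"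
proof -
  have "(\<Prod>p\<in>P. \<Sum>j\<le>J. (of_real (radius s p) * f p \<omega>) ^ j)
     = (\<Sum>n\<in>smooth_nats P J. \<Prod>p\<in>P. (of_real (radius s p) * f p \<omega>) ^ multiplicity p n)"
    by (rule prod_sum_smooth_nats[OF P])
  also have "\<dots> = dpoly (smooth_nats P J) s \<omega>"
    unfolding dpoly_def
  proof (intro sum.cong refl)
    fix n assume "n \<in> smooth_nats P J"
    then have n: "n > 0" "prime_factors n \<subseteq> P" by (auto simp: smooth_nats_def)
    have "(\<Prod>p\<in>P. (of_real (radius s p) * f p \<omega>) ^ multiplicity p n)
       = of_real (\<Prod>p\<in>P. radius s p ^ multiplicity p n) * (\<Prod>p\<in>P. f p \<omega> ^ multiplicity p n)"
      by (simp add: power_mult_distrib prod.distrib)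
    also have "(\<Prod>p\<in>P. radius s p ^ multiplicity p n) = real n powr (- 1 / 2 - s)"
      unfolding radius_def by (rule prod_powr_multiplicity[OF P n])
    finally show "(\<Prod>p\<in>P. (of_real (radius s p) * f p \<omega>) ^ multiplicity p n)
       = of_real (real n powr (- 1 / 2 - s)) * mult_ext f n \<omega>"
      unfolding mult_ext_eq_prod[OF n] .
  qed
  finally show ?thesis by simp
qed

context
  fixes s :: real
  assumes s: "s \<ge> 0"
begin

lemma dpoly_smooth_tendsto: "(\<lambda>J. dpoly (smooth_nats P J) s \<omega>) \<longlonglongrightarrow> euler P s \<omega>"
  unfolding dpoly_smooth_nats euler_def
proof (intro tendsto_prod geometric_sums[unfolded sums_def_le])
  fix p assume "p \<in> P"
  then have "prime p" using P by auto
  then show "norm (of_real (radius s p) * f p \<omega>) < 1"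
    using radius_bounds[of p s] s by (simp add: norm_mult)
qed

lemma norm_dpoly_smooth_le: "cmod (dpoly (smooth_nats P J) s \<omega>) \<le> 4 ^ card P"
proof -
  have "cmod (dpoly (smooth_nats P J) s \<omega>) = (\<Prod>p\<in>P. cmod (\<Sum>j\<le>J. (of_real (radius s p) * f p \<omega>) ^ j))"
    unfolding dpoly_smooth_nats by (simp add: prod_norm)
  also have "\<dots> \<le> (\<Prod>p\<in>P. 4)"
  proof (intro prod_mono conjI)
    fix p assume "p \<in> P"
    then have p: "prime p" using P by auto
    note r = radius_bounds[OF p s]
    have "cmod (\<Sum>j\<le>J. (of_real (radius s p) * f p \<omega>) ^ j) \<le> (\<Sum>j\<le>J. radius s p ^ j)"
      by (rule sum_norm_le) (use r p in \<open>simp add: norm_mult norm_power\<close>)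
    also have "\<dots> \<le> (\<Sum>j. radius s p ^ j)"
      by (rule sum_le_suminf[OF summable_geometric]) (use r in auto)
    also have "\<dots> = 1 / (1 - radius s p)" by (rule suminf_geometric) (use r in auto)
    also have "\<dots> \<le> 4" using r by (simp add: field_simps)
    finally show "cmod (\<Sum>j\<le>J. (of_real (radius s p) * f p \<omega>) ^ j) \<le> 4" .
  qed auto
  finally show ?thesis by simp
qed

lemma expectation_dpoly_smooth_tendsto:
  assumes q: "q > 0"
  shows "(\<lambda>J. expectation (\<lambda>\<omega>. cmod (dpoly (smooth_nats P J) s \<omega>) powr q)) \<longlonglongrightarrow> euler_moment P s q"
  unfolding euler_moment_def
proof (rule integral_dominated_convergence[where w = "\<lambda>_. (4 ^ card P) powr q"])
  note [measurable] = measurable_euler[OF P s]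
  show "(\<lambda>\<omega>. cmod (euler P s \<omega>) powr q) \<in> borel_measurable M" by measurable
  show "AE \<omega> in M. (\<lambda>J. cmod (dpoly (smooth_nats P J) s \<omega>) powr q) \<longlonglongrightarrow> cmod (euler P s \<omega>) powr q"
    using q by (intro AE_I2 tendsto_powr' tendsto_norm dpoly_smooth_tendsto tendsto_const) auto
  show "AE \<omega> in M. norm (cmod (dpoly (smooth_nats P J) s \<omega>) powr q) \<le> (4 ^ card P) powr q" for J
    using q norm_dpoly_smooth_le by (auto intro!: powr_mono2)
qed auto

lemma expectation_dpoly_smooth_mult_tendsto:
  fixes W :: "'a \<Rightarrow> complex"
  assumes [measurable]: "W \<in> borel_measurable M" and W: "\<And>\<omega>. cmod (W \<omega>) \<le> B"
  shows "(\<lambda>J. expectation (\<lambda>\<omega>. dpoly (smooth_nats P J) s \<omega> * W \<omega>)) \<longlonglongrightarrow> expectation (\<lambda>\<omega>. euler P s \<omega> * W \<omega>)"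
proof (rule integral_dominated_convergence[where w = "\<lambda>_. 4 ^ card P * B"])
  note [measurable] = measurable_euler[OF P s]
  show "(\<lambda>\<omega>. euler P s \<omega> * W \<omega>) \<in> borel_measurable M" by measurable
  show "AE \<omega> in M. (\<lambda>J. dpoly (smooth_nats P J) s \<omega> * W \<omega>) \<longlonglongrightarrow> euler P s \<omega> * W \<omega>"
    by (intro AE_I2 tendsto_mult dpoly_smooth_tendsto tendsto_const)
  show "AE \<omega> in M. norm (dpoly (smooth_nats P J) s \<omega> * W \<omega>) \<le> 4 ^ card P * B" for J
    unfolding norm_mult using norm_dpoly_smooth_le W by (intro AE_I2 mult_mono) auto
qed auto

end

end

text \<open>The truncation constant does not depend on J, so J may tend to infinity, which turns the
  smooth sum into the Euler product. Since N <= x, every n <= N is a smooth number for the primes up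
  to x.\<close>

lemma expectation_partial_sum_le:
  assumes s: "s \<ge> 0" and q: "q > 6" and N: "real N \<le> x"
  shows "expectation (\<lambda>\<omega>. cmod (dpoly {1..N} s \<omega>) powr q) \<le> 2 * q powr q * euler_moment (primes_upto x) s q"
proof -
  let ?P = "primes_upto x"
  have "expectation (\<lambda>\<omega>. cmod (dpoly {1..N} s \<omega>) powr q)
    \<le> 2 * q powr q * expectation (\<lambda>\<omega>. cmod (dpoly (smooth_nats ?P J) s \<omega>) powr q)" if J: "J \<ge> N" for J
  proof -
    have sub: "{1..N} \<subseteq> smooth_nats ?P J" by (rule atLeastAtMost_subset_smooth_nats[OF J N])
    have eq: "{n \<in> smooth_nats ?P J. n \<le> N} = {1..N}" using sub by (auto simp: smooth_nats_def)
    have "expectation (\<lambda>\<omega>. cmod (dpoly {n \<in> smooth_nats ?P J. n \<le> N} s \<omega>) powr q)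
      \<le> 2 * q powr q * expectation (\<lambda>\<omega>. cmod (dpoly (smooth_nats ?P J) s \<omega>) powr q)"
      unfolding dpoly_def
    proof (rule expectation_truncation_le[OF _ _ q])
      show "finite (smooth_nats ?P J)" by (rule finite_smooth_nats) (auto simp: prime_primes_upto)
    qed (simp add: smooth_nats_def)
    then show ?thesis unfolding eq .
  qed
  moreover have "(\<lambda>J. 2 * q powr q * expectation (\<lambda>\<omega>. cmod (dpoly (smooth_nats ?P J) s \<omega>) powr q))
      \<longlonglongrightarrow> 2 * q powr q * euler_moment ?P s q"
    by (intro tendsto_mult tendsto_const expectation_dpoly_smooth_tendsto)
       (use s q in \<open>auto simp: prime_primes_upto\<close>)
  ultimately show ?thesis by (intro LIMSEQ_le_const) auto
qed

text \<open>Writes n^s as the sum of its increments up to n. Summing over tails makes all weights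
  nonnegative with total mass N^s, and each tail is a difference of two partial sums of the shifted
  series.\<close>

lemma dpoly_abel:
  assumes "s \<ge> 0"
  shows "dpoly {1..N} 0 \<omega> =
    (\<Sum>m=1..N. of_real (real m powr s - real (m - 1) powr s) * (dpoly {1..N} s \<omega> - dpoly {1..m-1} s \<omega>))"
proof -
  define a where "a n = of_real (real n powr (- 1 / 2 - s)) * mult_ext f n \<omega>" for n
  have tail: "dpoly {1..N} s \<omega> - dpoly {1..m-1} s \<omega> = (\<Sum>n\<in>{m..N}. a n)" if "1 \<le> m" "m \<le> N" for m
  proof -
    have "{1..N} = {1..m-1} \<union> {m..N}" using that by auto
    then have "(\<Sum>n\<in>{1..N}. a n) = (\<Sum>n\<in>{1..m-1}. a n) + (\<Sum>n\<in>{m..N}. a n)"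
      by (simp only:) (rule sum.union_disjoint; auto)
    then show ?thesis by (simp add: dpoly_def a_def)
  qed
  \<comment> \<open>At m = 1 the subtracted value is 0 powr s, which is 0 even for s = 0.\<close>
  have tele: "(\<Sum>m=1..n. real m powr s - real (m - 1) powr s) = real n powr s" for n
    by (induction n) auto
  have "(\<Sum>m=1..N. of_real (real m powr s - real (m - 1) powr s) * (dpoly {1..N} s \<omega> - dpoly {1..m-1} s \<omega>))
     = (\<Sum>m=1..N. \<Sum>n | n \<in> {1..N} \<and> m \<le> n. of_real (real m powr s - real (m - 1) powr s) * a n)"
  proof (intro sum.cong refl)
    fix m assume m: "m \<in> {1..N}"
    then have "{n. n \<in> {1..N} \<and> m \<le> n} = {m..N}" by auto
    then show "of_real (real m powr s - real (m - 1) powr s) * (dpoly {1..N} s \<omega> - dpoly {1..m-1} s \<omega>)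
      = (\<Sum>n | n \<in> {1..N} \<and> m \<le> n. of_real (real m powr s - real (m - 1) powr s) * a n)"
      using tail[of m] m by (simp add: sum_distrib_left)
  qed
  also have "\<dots> = (\<Sum>n=1..N. \<Sum>m | m \<in> {1..N} \<and> m \<le> n. of_real (real m powr s - real (m - 1) powr s) * a n)"
    by (rule sum.swap_restrict) auto
  also have "\<dots> = (\<Sum>n=1..N. of_real (real n powr s) * a n)"
  proof (intro sum.cong refl)
    fix n assume n: "n \<in> {1..N}"
    then have "{m. m \<in> {1..N} \<and> m \<le> n} = {1..n}" by auto
    then have "(\<Sum>m | m \<in> {1..N} \<and> m \<le> n. of_real (real m powr s - real (m - 1) powr s) * a n)
       = of_real (\<Sum>m=1..n. real m powr s - real (m - 1) powr s) * a n"
      by (simp only: of_real_sum sum_distrib_right)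
    then show "(\<Sum>m | m \<in> {1..N} \<and> m \<le> n. of_real (real m powr s - real (m - 1) powr s) * a n)
      = of_real (real n powr s) * a n" unfolding tele .
  qed
  also have "\<dots> = dpoly {1..N} 0 \<omega>"
    unfolding dpoly_def a_def
    by (intro sum.cong refl) (simp add: mult.assoc[symmetric] powr_add[symmetric] flip: of_real_mult)
  finally show ?thesis by simp
qed

text \<open>One factor 2^q comes from the power mean and one from splitting a tail into two partial
  sums; the two partial sums cost a further 2, and the truncation constant is 2 q^q. The total
  weight N^s, raised to the power q, gives x^(s q).\<close>

lemma expectation_M_sum_le:
  assumes s: "s \<ge> 0" and q: "q > 6" and x: "x \<ge> 1"
  shows "expectation (\<lambda>\<omega>. cmod (M_sum f x \<omega>) powr q)
    \<le> 4 powr (q + 1) * q powr q * x powr (s * q) * euler_moment (primes_upto x) s q"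
proof -
  define N where "N = nat \<lfloor>x\<rfloor>"
  have N: "real N \<le> x" "N \<ge> 1" using x by (auto simp: N_def le_nat_floor)
  define w where "w m = real m powr s - real (m - 1) powr s" for m :: nat
  define y where "y m \<omega> = cmod (dpoly {1..N} s \<omega> - dpoly {1..m-1} s \<omega>)" for m \<omega>
  have w: "w m \<ge> 0" for m unfolding w_def using s by (simp add: powr_mono2)
  have sw: "sum w {1..N} = real N powr s" unfolding w_def by (induction N) auto
  have sw0: "sum w {1..N} > 0" unfolding sw using N by simp
  define B where "B = 2 * q powr q * euler_moment (primes_upto x) s q"
  have B: "expectation (\<lambda>\<omega>. cmod (dpoly {1..n} s \<omega>) powr q) \<le> B" if "n \<le> N" for n
    unfolding B_def by (rule expectation_partial_sum_le) (use s q N that in auto)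
  have B0: "B \<ge> 0" by (rule order_trans[OF _ B[of N]]) auto
  have ydom: "y m \<omega> powr q \<le> 2 powr q * (cmod (dpoly {1..N} s \<omega>) powr q + cmod (dpoly {1..m-1} s \<omega>) powr q)" for m \<omega>
  proof -
    define a b where "a = cmod (dpoly {1..N} s \<omega>)" and "b = cmod (dpoly {1..m-1} s \<omega>)"
    have "y m \<omega> \<le> a + b" unfolding y_def a_def b_def by (rule norm_triangle_ineq4)
    also have "\<dots> \<le> 2 * max a b" by simp
    finally have "y m \<omega> powr q \<le> (2 * max a b) powr q" using q by (intro powr_mono2) (auto simp: y_def)
    also have "\<dots> = 2 powr q * max a b powr q" by (simp add: powr_mult a_def b_def)
    also have "max a b powr q \<le> a powr q + b powr q" by (simp add: max_def)
    finally show ?thesis by (simp add: a_def b_def)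
  qed
  have yint: "integrable M (\<lambda>\<omega>. y m \<omega> powr q)" for m
  proof (rule Bochner_Integration.integrable_bound)
    show "integrable M (\<lambda>\<omega>. 2 powr q * (cmod (dpoly {1..N} s \<omega>) powr q + cmod (dpoly {1..m-1} s \<omega>) powr q))"
      using q by (intro integrable_mult_right Bochner_Integration.integrable_add integrable_dpoly_powr) auto
    show "(\<lambda>\<omega>. y m \<omega> powr q) \<in> borel_measurable M" unfolding y_def by measurable
    show "AE \<omega> in M. norm (y m \<omega> powr q) \<le> norm (2 powr q * (cmod (dpoly {1..N} s \<omega>) powr q + cmod (dpoly {1..m-1} s \<omega>) powr q))"
      using ydom by (auto intro!: AE_I2 order_trans[OF ydom])
  qed
  have yB: "expectation (\<lambda>\<omega>. y m \<omega> powr q) \<le> 2 powr q * (2 * B)" if m: "m \<in> {1..N}" for m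
  proof -
    have "expectation (\<lambda>\<omega>. y m \<omega> powr q)
      \<le> expectation (\<lambda>\<omega>. 2 powr q * (cmod (dpoly {1..N} s \<omega>) powr q + cmod (dpoly {1..m-1} s \<omega>) powr q))"
      by (intro integral_mono yint ydom integrable_mult_right Bochner_Integration.integrable_add integrable_dpoly_powr)
         (use q in auto)
    also have "\<dots> = 2 powr q * (expectation (\<lambda>\<omega>. cmod (dpoly {1..N} s \<omega>) powr q) + expectation (\<lambda>\<omega>. cmod (dpoly {1..m-1} s \<omega>) powr q))"
      using q by (simp add: integrable_dpoly_powr)
    also have "\<dots> \<le> 2 powr q * (B + B)"
      using m by (intro mult_left_mono add_mono B) auto
    finally show ?thesis by simp
  qed
  have "cmod (M_sum f x \<omega>) powr q \<le> 2 powr q * (sum w {1..N}) powr (q - 1) * (\<Sum>m=1..N. w m * y m \<omega> powr q)" for \<omega>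
  proof -
    have "M_sum f x \<omega> = (\<Sum>m=1..N. of_real (w m) * (dpoly {1..N} s \<omega> - dpoly {1..m-1} s \<omega>))"
      using dpoly_abel[OF s, of N \<omega>] M_sum_eq_dpoly[of x \<omega>] x by (simp add: N_def w_def)
    also have "cmod \<dots> \<le> (\<Sum>m=1..N. w m * y m \<omega>)"
      by (rule sum_norm_le) (use w in \<open>simp add: norm_mult y_def\<close>)
    finally have "cmod (M_sum f x \<omega>) powr q \<le> (\<Sum>m=1..N. w m * y m \<omega>) powr q"
      using q by (intro powr_mono2) auto
    also have "\<dots> \<le> 2 powr q * (sum w {1..N}) powr (q - 1) * (\<Sum>m=1..N. w m * y m \<omega> powr q)"
      by (rule weighted_power_mean) (use w sw0 q in \<open>auto simp: y_def\<close>)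
    finally show ?thesis .
  qed
  moreover have "integrable M (\<lambda>\<omega>. cmod (M_sum f x \<omega>) powr q)"
    using M_sum_eq_dpoly x q by (simp add: integrable_dpoly_powr)
  ultimately have "expectation (\<lambda>\<omega>. cmod (M_sum f x \<omega>) powr q)
     \<le> expectation (\<lambda>\<omega>. 2 powr q * (sum w {1..N}) powr (q - 1) * (\<Sum>m=1..N. w m * y m \<omega> powr q))"
    by (intro integral_mono integrable_mult_right Bochner_Integration.integrable_sum yint)
  also have "\<dots> = 2 powr q * (sum w {1..N}) powr (q - 1) * (\<Sum>m=1..N. w m * expectation (\<lambda>\<omega>. y m \<omega> powr q))"
    by (simp add: yint)
  also have "\<dots> \<le> 2 powr q * (sum w {1..N}) powr (q - 1) * (\<Sum>m=1..N. w m * (2 powr q * (2 * B)))"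
    using w yB by (intro mult_left_mono sum_mono) auto
  also have "\<dots> = 2 powr q * 2 powr q * (2 * B) * ((sum w {1..N}) powr (q - 1) * sum w {1..N})"
    by (simp only: sum_distrib_right[symmetric]) (simp only: mult_ac)
  also have "(sum w {1..N}) powr (q - 1) * sum w {1..N} = (sum w {1..N}) powr q"
    using sw0 by (simp add: powr_diff)
  also have "\<dots> = real N powr (s * q)" unfolding sw by (simp add: powr_powr)
  also have "2 powr q * 2 powr q = (4 :: real) powr q" by (simp add: powr_mult[symmetric])
  also have "4 powr q * (2 * B) * real N powr (s * q) \<le> 4 powr q * (2 * B) * x powr (s * q)"
    using N s q B0 by (intro mult_left_mono powr_mono2) auto
  also have "\<dots> = 4 powr (q + 1) * q powr q * x powr (s * q) * euler_moment (primes_upto x) s q"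
    by (simp add: B_def powr_add mult_ac)
  finally show ?thesis .
qed

end

section \<open>The lower bound\<close>

text \<open>Given as a series of measurable terms, hence measurable on the whole plane. On the unit
  circle with 0 <= r < 1 it equals (1 - r z)^(-\<kappa>).\<close>

definition neg_binom_series :: "real \<Rightarrow> real \<Rightarrow> complex \<Rightarrow> complex" where
  "neg_binom_series \<kappa> r z = (\<Sum>j. of_real (neg_binom \<kappa> j * r ^ j) * z ^ j)"

lemma measurable_neg_binom_series [measurable]: "neg_binom_series \<kappa> r \<in> borel_measurable borel"
  unfolding neg_binom_series_def[abs_def] by measurable

lemma neg_binom_series_eq:
  assumes "cmod z = 1" "0 \<le> r" "r < 1"
  shows "neg_binom_series \<kappa> r z = (1 - of_real r * z) powr (- of_real \<kappa>)"
  using neg_binom_sums[of "of_real r * z" \<kappa>] assms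
  by (simp add: neg_binom_series_def sums_iff norm_mult power_mult_distrib mult_ac)

context unit_steinhaus
begin

text \<open>The extremal weight for exponent 2k: with F the Euler product its modulus is |F|^(2k-1),
  and F times it equals |F|^(2k). For real k the powers are taken factor by factor, on the principal
  branch.\<close>

definition dual_weight :: "nat set \<Rightarrow> real \<Rightarrow> real \<Rightarrow> 'a \<Rightarrow> complex" where
  "dual_weight P s k \<omega> = (\<Prod>p\<in>P. neg_binom_series (k - 1) (radius s p) (f p \<omega>)
      * cnj (neg_binom_series k (radius s p) (f p \<omega>)))"

context
  fixes P :: "nat set" and s k :: real
  assumes P: "finite P" "\<And>p. p \<in> P \<Longrightarrow> prime p" and s: "s \<ge> 0" and k: "k \<ge> 1"
begin

lemma measurable_dual_weight [measurable]: "dual_weight P s k \<in> borel_measurable M"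
  unfolding dual_weight_def[abs_def]
proof (rule borel_measurable_prod)
  fix p assume "p \<in> P"
  then have [measurable]: "f p \<in> borel_measurable M" using P by auto
  show "(\<lambda>\<omega>. neg_binom_series (k - 1) (radius s p) (f p \<omega>)
      * cnj (neg_binom_series k (radius s p) (f p \<omega>))) \<in> borel_measurable M" by measurable
qed

lemma series_factor:
  assumes "p \<in> P"
  shows "neg_binom_series q (radius s p) (f p \<omega>) = (1 - of_real (radius s p) * f p \<omega>) powr (- of_real q)"
  using radius_bounds[OF P(2)[OF assms] s] P(2)[OF assms] by (intro neg_binom_series_eq) auto

lemma norm_series_factor:
  assumes "p \<in> P"
  shows "cmod (neg_binom_series q (radius s p) (f p \<omega>)) = cmod (1 - of_real (radius s p) * f p \<omega>) powr (- q)"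
  unfolding series_factor[OF assms] by (simp add: norm_powr_real_powr')

lemma norm_dual_weight: "cmod (dual_weight P s k \<omega>) = cmod (euler P s \<omega>) powr (2 * k - 1)"
proof -
  have "cmod (dual_weight P s k \<omega>) = (\<Prod>p\<in>P. (1 / cmod (1 - of_real (radius s p) * f p \<omega>)) powr (2 * k - 1))"
    unfolding dual_weight_def prod_norm[symmetric] norm_mult complex_mod_cnj
  proof (intro prod.cong refl)
    fix p assume p: "p \<in> P"
    define c where "c = cmod (1 - of_real (radius s p) * f p \<omega>)"
    have c: "c > 0" using factor_nz[OF P s p] by (simp add: c_def)
    have "c powr (- (k - 1)) * c powr (- k) = (1 / c) powr (2 * k - 1)"
      using c by (simp add: powr_add[symmetric] powr_divide powr_minus_divide[symmetric] algebra_simps)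
    then show "cmod (neg_binom_series (k - 1) (radius s p) (f p \<omega>)) * cmod (neg_binom_series k (radius s p) (f p \<omega>))
      = (1 / cmod (1 - of_real (radius s p) * f p \<omega>)) powr (2 * k - 1)"
      unfolding norm_series_factor[OF p] c_def .
  qed
  also have "\<dots> = cmod (euler P s \<omega>) powr (2 * k - 1)"
    unfolding euler_def prod_norm[symmetric] by (subst prod_powr_distrib) (auto simp: norm_divide)
  finally show ?thesis .
qed

lemma norm_dual_weight_le: "cmod (dual_weight P s k \<omega>) \<le> (4 ^ card P) powr (2 * k - 1)"
  unfolding norm_dual_weight using k norm_euler_le[OF P s] by (intro powr_mono2) auto

lemma euler_times_dual_weight:
  "euler P s \<omega> * dual_weight P s k \<omega> = of_real (cmod (euler P s \<omega>) powr (2 * k))"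
proof -
  have "euler P s \<omega> * dual_weight P s k \<omega>
     = (\<Prod>p\<in>P. of_real ((1 / cmod (1 - of_real (radius s p) * f p \<omega>)) powr (2 * k)))"
    unfolding euler_def dual_weight_def prod.distrib[symmetric]
  proof (intro prod.cong refl)
    fix p assume p: "p \<in> P"
    define z where "z = 1 - of_real (radius s p) * f p \<omega>"
    have z: "z \<noteq> 0" using factor_nz[OF P s p] by (simp add: z_def)
    have "1 / z * z powr (- of_real (k - 1)) = z powr (- 1 + - of_real (k - 1))"
      using z by (simp only: powr_add) (simp add: powr_minus divide_inverse)
    also have "- 1 + - of_real (k - 1) = - complex_of_real k" by simp
    finally have "1 / z * (z powr (- of_real (k - 1)) * cnj (z powr (- of_real k))) = of_real (cmod z powr (- (2 * k)))"
      unfolding powr_neg_times_cnj[symmetric] by (simp add: mult.assoc[symmetric])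
    also have "cmod z powr (- (2 * k)) = (1 / cmod z) powr (2 * k)"
      using z by (simp add: powr_divide powr_minus_divide)
    finally show "1 / (1 - of_real (radius s p) * f p \<omega>) * (neg_binom_series (k - 1) (radius s p) (f p \<omega>)
        * cnj (neg_binom_series k (radius s p) (f p \<omega>)))
      = of_real ((1 / cmod (1 - of_real (radius s p) * f p \<omega>)) powr (2 * k))"
      unfolding series_factor[OF p] z_def .
  qed
  also have "\<dots> = of_real (\<Prod>p\<in>P. (1 / cmod (1 - of_real (radius s p) * f p \<omega>)) powr (2 * k))"
    by (rule of_real_prod[symmetric])
  also have "(\<Prod>p\<in>P. (1 / cmod (1 - of_real (radius s p) * f p \<omega>)) powr (2 * k)) = cmod (euler P s \<omega>) powr (2 * k)"
    unfolding euler_def prod_norm[symmetric] by (subst prod_powr_distrib) (auto simp: norm_divide)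
  finally show ?thesis .
qed

text \<open>By independence the coefficient is a product of local ones, each a nonnegative real by
  \<open>expectation_neg_binom_nonneg\<close>.\<close>

lemma dual_coefficient_nonneg:
  assumes n: "n > 0" "prime_factors n \<subseteq> P"
  shows "Re (expectation (\<lambda>\<omega>. mult_ext f n \<omega> * dual_weight P s k \<omega>)) \<ge> 0"
proof -
  define g where "g p z = z ^ multiplicity p n * neg_binom_series (k - 1) (radius s p) z
      * cnj (neg_binom_series k (radius s p) z)" for p z
  have "mult_ext f n \<omega> * dual_weight P s k \<omega> = (\<Prod>p\<in>P. g p (f p \<omega>))" for \<omega>
    using mult_ext_eq_prod[OF P n, of \<omega>] by (simp add: dual_weight_def g_def prod.distrib mult.assoc)
  then have "expectation (\<lambda>\<omega>. mult_ext f n \<omega> * dual_weight P s k \<omega>) = expectation (\<lambda>\<omega>. \<Prod>p\<in>P. g p (f p \<omega>))"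
    by simp
  also have "\<dots> = (\<Prod>p\<in>P. expectation (\<lambda>\<omega>. g p (f p \<omega>)))"
  proof (rule indep_vars_prime_functions[OF P])
    show "g p \<in> borel_measurable borel" for p unfolding g_def by measurable
    show "norm (g p (f p \<omega>)) \<le> (1 / 4) powr (- (k - 1)) * (1 / 4) powr (- k)" if p: "p \<in> P" for p \<omega>
      unfolding g_def norm_mult complex_mod_cnj norm_series_factor[OF p]
      using P(2)[OF p] factor_ge[OF P s p, of \<omega>] k
      by (auto simp: norm_power intro!: mult_mono powr_mono2')
  qed
  also obtain x where "\<And>p. p \<in> P \<Longrightarrow> x p \<ge> 0 \<and> expectation (\<lambda>\<omega>. g p (f p \<omega>)) = complex_of_real (x p)"
  proof -
    have "\<exists>x\<ge>0. expectation (\<lambda>\<omega>. g p (f p \<omega>)) = complex_of_real x" if p: "p \<in> P" for p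
      unfolding g_def series_factor[OF p]
      using radius_bounds[OF P(2)[OF p] s] k by (intro expectation_neg_binom_nonneg P p) auto
    then show ?thesis using that by metis
  qed
  note x = this
  then have "(\<Prod>p\<in>P. expectation (\<lambda>\<omega>. g p (f p \<omega>))) = of_real (\<Prod>p\<in>P. x p)" by simp
  finally show ?thesis using x by (simp add: prod_nonneg del: of_real_prod)
qed

lemma expectation_dpoly_dual_weight:
  "Re (expectation (\<lambda>\<omega>. dpoly A u \<omega> * dual_weight P s k \<omega>))
     = (\<Sum>n\<in>A. real n powr (- 1 / 2 - u) * Re (expectation (\<lambda>\<omega>. mult_ext f n \<omega> * dual_weight P s k \<omega>)))"
proof -
  have int: "integrable M (\<lambda>\<omega>. mult_ext f n \<omega> * dual_weight P s k \<omega>)" for n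
    by (rule integrable_const_bound[of _ "(4 ^ card P) powr (2 * k - 1)"])
       (use norm_dual_weight_le in \<open>auto simp: norm_mult\<close>)
  have "expectation (\<lambda>\<omega>. dpoly A u \<omega> * dual_weight P s k \<omega>)
     = expectation (\<lambda>\<omega>. \<Sum>n\<in>A. of_real (real n powr (- 1 / 2 - u)) * (mult_ext f n \<omega> * dual_weight P s k \<omega>))"
    unfolding dpoly_def sum_distrib_right by (simp add: mult.assoc)
  also have "\<dots> = (\<Sum>n\<in>A. of_real (real n powr (- 1 / 2 - u)) * expectation (\<lambda>\<omega>. mult_ext f n \<omega> * dual_weight P s k \<omega>))"
    using int by simp
  finally show ?thesis by (simp add: Re_sum)
qed

text \<open>Pointwise Young for |g| |F|^(2k-1); the parameter t decides which of the two moments is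
  kept small.\<close>

lemma Re_expectation_dual_weight_le:
  assumes [measurable]: "g \<in> borel_measurable M" and t: "t > 0"
    and int: "integrable M (\<lambda>\<omega>. cmod (g \<omega>) powr (2 * k))"
  shows "Re (expectation (\<lambda>\<omega>. g \<omega> * dual_weight P s k \<omega>))
     \<le> t * euler_moment P s (2 * k) + t powr (1 - 2 * k) * expectation (\<lambda>\<omega>. cmod (g \<omega>) powr (2 * k))"
proof -
  have "Re (expectation (\<lambda>\<omega>. g \<omega> * dual_weight P s k \<omega>)) \<le> cmod (expectation (\<lambda>\<omega>. g \<omega> * dual_weight P s k \<omega>))"
    by (rule complex_Re_le_cmod)
  also have "\<dots> \<le> expectation (\<lambda>\<omega>. cmod (g \<omega> * dual_weight P s k \<omega>))" by (rule integral_norm_bound)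
  also have "\<dots> \<le> expectation (\<lambda>\<omega>. t * cmod (euler P s \<omega>) powr (2 * k) + t powr (1 - 2 * k) * cmod (g \<omega>) powr (2 * k))"
  proof (rule integral_mono')
    show "integrable M (\<lambda>\<omega>. t * cmod (euler P s \<omega>) powr (2 * k) + t powr (1 - 2 * k) * cmod (g \<omega>) powr (2 * k))"
      using int integrable_euler_powr[OF P s, of "2 * k"] k by simp
    show "cmod (g \<omega> * dual_weight P s k \<omega>) \<le> t * cmod (euler P s \<omega>) powr (2 * k) + t powr (1 - 2 * k) * cmod (g \<omega>) powr (2 * k)" for \<omega>
      unfolding norm_mult norm_dual_weight using k t by (intro young_powr) auto
  qed (use t in auto)
  also have "\<dots> = t * euler_moment P s (2 * k) + t powr (1 - 2 * k) * expectation (\<lambda>\<omega>. cmod (g \<omega>) powr (2 * k))"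
    using int integrable_euler_powr[OF P s, of "2 * k"] k by (simp add: euler_moment_def)
  finally show ?thesis .
qed

end

text \<open>Duality against \<open>F^(k-1)\<close> and the conjugate of \<open>F^k\<close>, where \<open>F\<close> is the Euler product: since all
  Fourier coefficients of this weight are nonnegative, the terms \<open>n > x\<close> missing in the partial
  sum can be bounded by Rankin's trick.\<close>

lemma euler_moment_le_M_sum:
  assumes s: "s > 0" and k: "k \<ge> 1" and x: "x \<ge> 1" and t: "t > 0"
  defines "P \<equiv> primes_upto x"
  shows "euler_moment P s (2 * k) \<le> euler_moment P s (2 * k) / 4
      + 4 powr (2 * k - 1) * expectation (\<lambda>\<omega>. cmod (M_sum f x \<omega>) powr (2 * k))
      + x powr (- s / 2) * (t * euler_moment P s (2 * k) + t powr (1 - 2 * k) * euler_moment P (s / 2) (2 * k))"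
proof -
  define N where "N = nat \<lfloor>x\<rfloor>"
  have N: "real N \<le> x" "x < real N + 1" using x by (auto simp: N_def)
  have P: "finite P" "\<And>p. p \<in> P \<Longrightarrow> prime p" by (auto simp: P_def prime_primes_upto)
  have s0: "s \<ge> 0" "s / 2 \<ge> 0" using s by auto
  define c where "c n = Re (expectation (\<lambda>\<omega>. mult_ext f n \<omega> * dual_weight P s k \<omega>))" for n
  define W where "W = dual_weight P s k"
  define D where "D A u = Re (expectation (\<lambda>\<omega>. dpoly A u \<omega> * W \<omega>))" for A u
  have D: "D A u = (\<Sum>n\<in>A. real n powr (- 1 / 2 - u) * c n)" for A u
    unfolding D_def W_def c_def by (rule expectation_dpoly_dual_weight[OF P s0(1) k])
  note mW [measurable] = measurable_dual_weight[OF P s0(1) k, folded W_def]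
  note W_le = norm_dual_weight_le[OF P s0(1) k, folded W_def]
  \<comment> \<open>Termwise, using c n >= 0: for n <= N the factor n^(-s) is dropped, and for n > x
    it is at most x^(-s/2) n^(-s/2). The second kind is then extended to all smooth n.\<close>
  have step: "D (smooth_nats P J) s \<le> D {1..N} 0 + x powr (- s / 2) * D (smooth_nats P J) (s / 2)" if J: "J \<ge> N" for J
  proof -
    have fin: "finite (smooth_nats P J)" by (rule finite_smooth_nats[OF P])
    have sub: "{1..N} \<subseteq> smooth_nats P J"
      unfolding P_def by (rule atLeastAtMost_subset_smooth_nats[OF J N(1)])
    have c: "c n \<ge> 0" if "n \<in> smooth_nats P J" for n
      unfolding c_def using that by (intro dual_coefficient_nonneg[OF P s0(1) k]) (auto simp: smooth_nats_def)
    have "D (smooth_nats P J) s = (\<Sum>n\<in>smooth_nats P J. real n powr (- 1 / 2 - s) * c n)" by (rule D)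
    also have "\<dots> \<le> (\<Sum>n\<in>smooth_nats P J. (if n \<in> {1..N} then real n powr (- 1 / 2 - 0) * c n else 0)
        + x powr (- s / 2) * (real n powr (- 1 / 2 - s / 2) * c n))"
    proof (rule sum_mono)
      fix n assume n: "n \<in> smooth_nats P J"
      then have n1: "real n \<ge> 1" by (auto simp: smooth_nats_def)
      show "real n powr (- 1 / 2 - s) * c n \<le> (if n \<in> {1..N} then real n powr (- 1 / 2 - 0) * c n else 0)
        + x powr (- s / 2) * (real n powr (- 1 / 2 - s / 2) * c n)"
      proof (cases "n \<in> {1..N}")
        case True
        have "real n powr (- 1 / 2 - s) * c n \<le> real n powr (- 1 / 2 - 0) * c n"
          using n1 s c[OF n] by (intro mult_right_mono powr_mono) auto
        moreover have "x powr (- s / 2) * (real n powr (- 1 / 2 - s / 2) * c n) \<ge> 0" using c[OF n] by simp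
        ultimately show ?thesis using True by simp
      next
        case False
        then have "n \<ge> N + 1" using n by (auto simp: smooth_nats_def)
        then have "real n \<ge> real N + 1" by (metis of_nat_1 of_nat_add of_nat_mono)
        then have xn: "x \<le> real n" using N by linarith
        have "real n powr (- 1 / 2 - s) = real n powr (- s / 2) * real n powr (- 1 / 2 - s / 2)"
          by (simp add: powr_add[symmetric] algebra_simps)
        also have "\<dots> \<le> x powr (- s / 2) * real n powr (- 1 / 2 - s / 2)"
          using xn x s by (intro mult_right_mono powr_mono2') auto
        finally have "real n powr (- 1 / 2 - s) * c n \<le> x powr (- s / 2) * real n powr (- 1 / 2 - s / 2) * c n"
          using c[OF n] by (intro mult_right_mono) auto
        then show ?thesis using False by (auto simp: mult.assoc)
      qed
    qed
    also have "\<dots> = (\<Sum>n\<in>smooth_nats P J. if n \<in> {1..N} then real n powr (- 1 / 2 - 0) * c n else 0)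
        + x powr (- s / 2) * D (smooth_nats P J) (s / 2)"
      unfolding D by (simp add: sum.distrib sum_distrib_left)
    also have "(\<Sum>n\<in>smooth_nats P J. if n \<in> {1..N} then real n powr (- 1 / 2 - 0) * c n else 0)
        = (\<Sum>n\<in>smooth_nats P J \<inter> {1..N}. real n powr (- 1 / 2 - 0) * c n)"
      by (rule sum.inter_restrict[OF fin, symmetric])
    also have "smooth_nats P J \<inter> {1..N} = {1..N}" using sub by auto
    also have "(\<Sum>n\<in>{1..N}. real n powr (- 1 / 2 - 0) * c n) = D {1..N} 0" by (rule D[symmetric])
    finally show ?thesis .
  qed
  have lim: "(\<lambda>J. D (smooth_nats P J) u) \<longlonglongrightarrow> Re (expectation (\<lambda>\<omega>. euler P u \<omega> * W \<omega>))" if "u \<ge> 0" for u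
    unfolding D_def by (intro tendsto_Re expectation_dpoly_smooth_mult_tendsto[OF P that mW W_le])
  have "Re (expectation (\<lambda>\<omega>. euler P s \<omega> * W \<omega>))
     \<le> D {1..N} 0 + x powr (- s / 2) * Re (expectation (\<lambda>\<omega>. euler P (s / 2) \<omega> * W \<omega>))"
  proof (rule LIMSEQ_le[OF lim])
    show "(\<lambda>J. D {1..N} 0 + x powr (- s / 2) * D (smooth_nats P J) (s / 2))
      \<longlonglongrightarrow> D {1..N} 0 + x powr (- s / 2) * Re (expectation (\<lambda>\<omega>. euler P (s / 2) \<omega> * W \<omega>))"
      by (intro tendsto_intros lim s0)
  qed (use step s0 in auto)
  also have "Re (expectation (\<lambda>\<omega>. euler P s \<omega> * W \<omega>)) = euler_moment P s (2 * k)"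
  proof -
    have "euler P s \<omega> * W \<omega> = of_real (cmod (euler P s \<omega>) powr (2 * k))" for \<omega>
      unfolding W_def by (rule euler_times_dual_weight[OF P s0(1) k])
    then show ?thesis by (simp add: euler_moment_def)
  qed
  also have "D {1..N} 0 = Re (expectation (\<lambda>\<omega>. M_sum f x \<omega> * W \<omega>))"
    using M_sum_eq_dpoly x by (simp add: D_def N_def)
  \<comment> \<open>The parameter 1/4 leaves only a quarter of the Euler moment on the right, to be
    absorbed on the left later.\<close>
  also have "\<dots> \<le> 1 / 4 * euler_moment P s (2 * k) + (1 / 4) powr (1 - 2 * k) * expectation (\<lambda>\<omega>. cmod (M_sum f x \<omega>) powr (2 * k))"
    unfolding W_def
  proof (rule Re_expectation_dual_weight_le[OF P s0(1) k])
    show "M_sum f x \<in> borel_measurable M" "integrable M (\<lambda>\<omega>. cmod (M_sum f x \<omega>) powr (2 * k))"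
      using M_sum_eq_dpoly x k measurable_dpoly integrable_dpoly_powr[of "2 * k"] by (simp_all cong: measurable_cong)
    show "(0 :: real) < 1 / 4" by simp
  qed
  also have "(1 / 4 :: real) powr (1 - 2 * k) = 4 powr (2 * k - 1)"
    by (simp add: powr_divide powr_minus_divide[symmetric])
  also have "Re (expectation (\<lambda>\<omega>. euler P (s / 2) \<omega> * W \<omega>))
     \<le> t * euler_moment P s (2 * k) + t powr (1 - 2 * k) * euler_moment P (s / 2) (2 * k)"
    unfolding W_def euler_moment_def[of P "s / 2"]
    by (rule Re_expectation_dual_weight_le[OF P s0(1) k _ t])
       (use k integrable_euler_powr[OF P s0(2)] measurable_euler[OF P s0(2)] in auto)
  finally show ?thesis by (simp add: mult_left_mono)
qed

end

section \<open>Asymptotics\<close>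

context unit_steinhaus
begin

text \<open>38 = 26 + 11 + 1: the errors of the upper and lower estimates of the moment, and the
  O(1) change of the prime sum in between.\<close>

lemma euler_moment_half_le:
  assumes k: "k \<ge> 1" and s: "0 < s" "s \<le> 1"
  shows "euler_moment (primes_upto x) (s / 2) (2 * k) \<le> exp (38 * k\<^sup>2) * euler_moment (primes_upto x) s (2 * k)"
proof -
  let ?P = "primes_upto x"
  let ?Q = "?P - primes_upto (2 * k\<^sup>2)"
  have P: "finite ?P" "\<And>p. p \<in> ?P \<Longrightarrow> prime p" by (auto simp: prime_primes_upto)
  have pos: "euler_moment ?P s (2 * k) > 0" "euler_moment ?P (s / 2) (2 * k) > 0"
    using k s by (auto intro!: euler_moment_pos P)
  have "ln (euler_moment ?P (s / 2) (2 * k)) \<le> k\<^sup>2 * (\<Sum>p\<in>?Q. real p powr (-1 - 2 * (s / 2))) + 26 * k\<^sup>2"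
    using s by (intro ln_euler_moment_le P k) auto
  moreover have "ln (euler_moment ?P s (2 * k)) \<ge> k\<^sup>2 * (\<Sum>p\<in>?Q. real p powr (-1 - 2 * s)) - k\<^sup>2"
    using s by (intro ln_euler_moment_ge P k) auto
  moreover have "(\<Sum>p\<in>?Q. real p powr (-1 - s) - real p powr (-1 - 2 * s)) \<le> 11"
    using s by (intro sum_primes_powr_diff_le) (auto simp: prime_primes_upto)
  then have "k\<^sup>2 * (\<Sum>p\<in>?Q. real p powr (-1 - s) - real p powr (-1 - 2 * s)) \<le> k\<^sup>2 * 11"
    by (intro mult_left_mono) auto
  then have "k\<^sup>2 * (\<Sum>p\<in>?Q. real p powr (-1 - s)) - k\<^sup>2 * (\<Sum>p\<in>?Q. real p powr (-1 - 2 * s)) \<le> 11 * k\<^sup>2"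
    by (simp add: sum_subtractf right_diff_distrib)
  ultimately have "ln (euler_moment ?P (s / 2) (2 * k)) \<le> 38 * k\<^sup>2 + ln (euler_moment ?P s (2 * k))"
    by simp
  then have "exp (ln (euler_moment ?P (s / 2) (2 * k))) \<le> exp (38 * k\<^sup>2 + ln (euler_moment ?P s (2 * k)))"
    by simp
  then show ?thesis using pos by (simp add: exp_add)
qed

lemma M_sum_moment_ge:
  assumes k: "k \<ge> 10" and T: "T > 1" and s: "s = 80 * k / ln T" "s \<le> 1"
  shows "euler_moment (primes_upto T) s (2 * k)
    \<le> exp (4 * k\<^sup>2) * expectation (\<lambda>\<omega>. cmod (M_sum f T \<omega>) powr (2 * k))"
proof -
  define X where "X = euler_moment (primes_upto T) s (2 * k)"
  define Y where "Y = euler_moment (primes_upto T) (s / 2) (2 * k)"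
  define m where "m = expectation (\<lambda>\<omega>. cmod (M_sum f T \<omega>) powr (2 * k))"
  \<comment> \<open>Chosen so that t^(1-2k) exp (38 k^2) = exp (38 k - 38 k^2) <= 1, which cancels
    the loss from halving the shift.\<close>
  define t where "t = exp (38 * k)"
  have L: "ln T > 0" using T by simp
  have s0: "s > 0" using s L k by simp
  have m0: "m \<ge> 0" by (simp add: m_def)
  have X: "X > 0" unfolding X_def using k s0 by (intro euler_moment_pos) (auto simp: prime_primes_upto)
  have kk: "k \<le> k\<^sup>2" using k by (simp add: power2_eq_square)
  have "X \<le> X / 4 + 4 powr (2 * k - 1) * m + T powr (- s / 2) * (t * X + t powr (1 - 2 * k) * Y)"
    unfolding X_def Y_def m_def using k T s0 by (intro euler_moment_le_M_sum) (auto simp: t_def)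
  moreover have "T powr (- s / 2) * (t * X + t powr (1 - 2 * k) * Y) \<le> X / 4"
  proof -
    have "t powr (1 - 2 * k) * Y \<le> t powr (1 - 2 * k) * (exp (38 * k\<^sup>2) * X)"
      unfolding Y_def X_def using k s0 s by (intro mult_left_mono euler_moment_half_le) auto
    also have "\<dots> = exp (38 * k * (1 - 2 * k)) * (exp (38 * k\<^sup>2) * X)" by (simp add: t_def exp_powr_real)
    also have "exp (38 * k * (1 - 2 * k)) * (exp (38 * k\<^sup>2) * X) = exp (38 * k - 38 * k\<^sup>2) * X"
      by (simp add: mult.assoc[symmetric] exp_add[symmetric]) (simp add: algebra_simps power2_eq_square)
    also have "\<dots> \<le> 1 * X" using kk X by (intro mult_right_mono) auto
    finally have "t powr (1 - 2 * k) * Y \<le> 1 * X" .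
    then have "t * X + t powr (1 - 2 * k) * Y \<le> (t + 1) * X" unfolding distrib_right by linarith
    also have "\<dots> = (exp (38 * k) + 1) * X" by (simp add: t_def)
    also have "\<dots> \<le> (exp (38 * k) * exp k) * X"
    proof (intro mult_right_mono)
      have "exp (38 * k) + 1 \<le> exp (38 * k) * 2" using k by simp
      also have "\<dots> \<le> exp (38 * k) * exp k"
        by (intro mult_left_mono exp_ge_zero) (use exp_ge_add_one_self[of k] k in linarith)
      finally show "exp (38 * k) + 1 \<le> exp (38 * k) * exp k" .
    qed (use X in auto)
    finally have "T powr (- s / 2) * (t * X + t powr (1 - 2 * k) * Y) \<le> T powr (- s / 2) * ((exp (38 * k) * exp k) * X)"
      by (intro mult_left_mono) auto
    \<comment> \<open>This is where 80 is spent: 40 k exceeds the 38 k from t, plus k for the added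
      1, by the k needed to get below 1/4.\<close>
    also have "\<dots> = exp (- (40 * k)) * ((exp (38 * k) * exp k) * X)" using T L s by (simp add: powr_def)
    also have "exp (- (40 * k)) * ((exp (38 * k) * exp k) * X) = exp (- k) * X"
      by (simp add: mult.assoc[symmetric] exp_add[symmetric])
    also have "\<dots> \<le> 1 / 4 * X"
    proof (intro mult_right_mono)
      have "4 \<le> exp k" using exp_ge_add_one_self[of k] k by linarith
      then show "exp (- k) \<le> 1 / 4" by (simp add: exp_minus field_simps)
    qed (use X in auto)
    finally show ?thesis by simp
  qed
  \<comment> \<open>Two quarters of X are absorbed on the left.\<close>
  ultimately have "X \<le> 2 * 4 powr (2 * k - 1) * m" by simp
  also have "\<dots> \<le> exp (4 * k\<^sup>2) * m"
  proof (intro mult_right_mono m0)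
    have "2 * 4 powr (2 * k - 1) \<le> 4 * 4 powr (2 * k - 1)" by simp
    also have "\<dots> = 4 powr (2 * k)" by (simp add: powr_diff)
    also have "\<dots> = exp (2 * k * ln 4)" by (simp add: powr_def)
    also have "\<dots> \<le> exp (2 * k * 2)"
    proof -
      have "ln (4 :: real) = ln (2 ^ 2)" by simp
      also have "\<dots> = 2 * ln 2" by (subst ln_realpow) auto
      finally show ?thesis using ln_2_less_1 k by simp
    qed
    also have "\<dots> \<le> exp (4 * k\<^sup>2)" using kk by simp
    finally show "2 * 4 powr (2 * k - 1) \<le> exp (4 * k\<^sup>2)" .
  qed
  finally show ?thesis by (simp add: X_def m_def)
qed

text \<open>The shift turns T^(2 k s) into exactly exp (160 k^2); the constants 4^(2k+1) and
  (2k)^(2k) of the truncation fit into exp (6 k^2) and exp (4 k^2).\<close>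

lemma M_sum_moment_le:
  assumes k: "k \<ge> 10" and T: "T > 1" and s: "s = 80 * k / ln T"
  shows "expectation (\<lambda>\<omega>. cmod (M_sum f T \<omega>) powr (2 * k))
    \<le> exp (170 * k\<^sup>2) * euler_moment (primes_upto T) s (2 * k)"
proof -
  have L: "ln T > 0" using T by simp
  have s0: "s > 0" using s L k by simp
  have kk: "k \<le> k\<^sup>2" "1 \<le> k" using k by (auto simp: power2_eq_square)
  have X: "euler_moment (primes_upto T) s (2 * k) > 0"
    using k s0 by (intro euler_moment_pos) (auto simp: prime_primes_upto)
  have "expectation (\<lambda>\<omega>. cmod (M_sum f T \<omega>) powr (2 * k))
    \<le> 4 powr (2 * k + 1) * (2 * k) powr (2 * k) * T powr (s * (2 * k)) * euler_moment (primes_upto T) s (2 * k)"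
    using s0 k T by (intro expectation_M_sum_le) auto
  also have "\<dots> \<le> exp (6 * k\<^sup>2) * exp (4 * k\<^sup>2) * exp (160 * k\<^sup>2) * euler_moment (primes_upto T) s (2 * k)"
  proof (intro mult_right_mono mult_mono)
    have "ln (4 :: real) = ln (2 ^ 2)" by simp
    also have "\<dots> = 2 * ln 2" by (subst ln_realpow) auto
    finally have l4: "ln (4 :: real) \<le> 2" using ln_2_less_1 by simp
    have "4 powr (2 * k + 1) = exp ((2 * k + 1) * ln 4)" by (simp add: powr_def)
    also have "(2 * k + 1) * ln 4 \<le> (3 * k) * 2" using l4 kk by (intro mult_mono) auto
    also have "\<dots> \<le> 6 * k\<^sup>2" using kk by simp
    finally show "4 powr (2 * k + 1) \<le> exp (6 * k\<^sup>2)" by simp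
    have "ln (2 * k) \<le> 2 * k" using ln_le_minus_one[of "2 * k"] k by simp
    then have "2 * k * ln (2 * k) \<le> 2 * k * (2 * k)" using k by (intro mult_left_mono) auto
    then show "(2 * k) powr (2 * k) \<le> exp (4 * k\<^sup>2)"
      using k by (simp add: powr_def power2_eq_square)
    show "T powr (s * (2 * k)) \<le> exp (160 * k\<^sup>2)"
      using T L s by (simp add: powr_def power2_eq_square)
  qed (use X in auto)
  also have "exp (6 * k\<^sup>2) * exp (4 * k\<^sup>2) * exp (160 * k\<^sup>2) = exp (170 * k\<^sup>2)"
    by (simp add: exp_add[symmetric])
  finally show ?thesis .
qed

lemma M_sum_moment_asymptotics:
  assumes C: "C > 0" and T: "T \<ge> exp (exp (80 * C + 1))"
    and k: "10 \<le> k" "k \<le> C * ln T / ln (ln T)"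
  shows "\<exists>r. \<bar>r\<bar> \<le> (203 + \<bar>ln (2 * C)\<bar>) * k\<^sup>2 \<and>
    expectation (\<lambda>\<omega>. cmod (M_sum f T \<omega>) powr (2 * k)) =
      ln T powr k\<^sup>2 * exp (- k\<^sup>2 * ln k - k\<^sup>2 * ln (ln k) + r)"
proof -
  define L where "L = ln T"
  define m where "m = expectation (\<lambda>\<omega>. cmod (M_sum f T \<omega>) powr (2 * k))"
  define s where "s = 80 * k / L"
  define X where "X = euler_moment (primes_upto T) s (2 * k)"
  define w where "w = 2 * k\<^sup>2"
  \<comment> \<open>k^2 g is the main exponent: the target is exp (k^2 g + r), so everything reduces
    to comparing ln m with k^2 g.\<close>
  define g where "g = ln L - ln k - ln (ln k)"
  define B where "B = \<bar>ln (2 * C)\<bar>"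
  have T0: "T > 0" using T less_le_trans[OF exp_gt_zero] by blast
  have L: "L \<ge> exp (80 * C + 1)" unfolding L_def using T T0 by (subst ln_ge_iff) auto
  have L0: "L > 0" using L less_le_trans[OF exp_gt_zero] by blast
  have lL: "ln L \<ge> 80 * C + 1" using L L0 by (subst ln_ge_iff) auto
  have L1: "L \<ge> 1" using exp_ge_add_one_self[of "80 * C + 1"] C L by linarith
  have T1: "T > 1" using L0 T0 unfolding L_def by (simp add: ln_gt_zero_iff)
  have kL: "k * ln L \<le> C * L" using k(2) lL C unfolding L_def[symmetric] by (simp add: field_simps)
  have k0: "k > 0" using k by simp
  have s0: "s > 0" using k0 L0 by (simp add: s_def)
  \<comment> \<open>The lower limit on T makes ln (ln T) at least 80 C + 1, hence k <= ln T /
    80.\<close>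
  have s1: "s \<le> 1"
  proof -
    have "k * (80 * C) \<le> k * ln L" using lL k0 by (intro mult_left_mono) auto
    then have "C * (80 * k) \<le> C * L" using kL by (simp add: mult_ac)
    then have "80 * k \<le> L" using C by (subst (asm) mult_le_cancel_left_pos) auto
    then show ?thesis using L0 by (simp add: s_def)
  qed
  have X: "X > 0" unfolding X_def using k0 s0 by (intro euler_moment_pos) (auto simp: prime_primes_upto)
  have lo: "X \<le> exp (4 * k\<^sup>2) * m" unfolding X_def m_def
    by (rule M_sum_moment_ge[OF k(1) T1 _ s1]) (simp add: s_def L_def)
  have up: "m \<le> exp (170 * k\<^sup>2) * X" unfolding X_def m_def
    by (rule M_sum_moment_le[OF k(1) T1]) (simp add: s_def L_def)
  have m: "m > 0" using less_le_trans[OF X lo] by (simp add: zero_less_mult_iff)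
  have "ln X \<le> ln (exp (4 * k\<^sup>2) * m)" using lo X m by (subst ln_le_cancel_iff) auto
  then have lnlo: "ln X \<le> 4 * k\<^sup>2 + ln m" using m by (simp add: ln_mult)
  have "ln m \<le> ln (exp (170 * k\<^sup>2) * X)" using up X m by (subst ln_le_cancel_iff) auto
  then have lnup: "ln m \<le> 170 * k\<^sup>2 + ln X" using X by (simp add: ln_mult)
  have lk: "ln k \<ge> 1"
  proof -
    have "exp 1 \<le> k" using exp_le k(1) by linarith
    then show ?thesis using k0 by (subst ln_ge_iff) auto
  qed
  have lw: "ln w = ln 2 + 2 * ln k" unfolding w_def using k0 by (simp add: ln_mult ln_realpow)
  have w: "w \<ge> 2" "ln w \<ge> 1"
  proof -
    have "1 \<le> k\<^sup>2" using k by simp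
    then show "w \<ge> 2" by (simp add: w_def)
    show "ln w \<ge> 1" unfolding lw using lk ln_gt_zero[of "2 :: real"] by linarith
  qed
  have l2: "(0 :: real) < ln 2" by simp
  have llw1: "ln (ln k) \<le> ln (ln w)"
    by (subst ln_le_cancel_iff) (use lk lw w l2 in linarith)+
  have "ln (ln w) \<le> ln (3 * ln k)"
    by (subst ln_le_cancel_iff) (use lk lw w ln_2_less_1 in linarith)+
  also have "\<dots> = ln 3 + ln (ln k)" using lk by (subst ln_mult) auto
  also have "ln (3 :: real) \<le> 2" using ln_le_minus_one[of "3 :: real"] by simp
  finally have llw2: "ln (ln w) \<le> 2 + ln (ln k)" by simp
  have ls: "ln (1 / s) = ln L - ln 80 - ln k"
    using k0 L0 by (simp add: s_def ln_div ln_mult)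
  have l80: "0 \<le> ln (80 :: real)" "ln (80 :: real) \<le> 79" using ln_le_minus_one[of "80 :: real"] by auto
  \<comment> \<open>At the top of the range of k, g may be negative, whereas the upper bound for the
    prime sum contains a maximum with 0. Here k ln k <= 2 C L keeps g above -B, so that the maximum
    costs only B.\<close>
  have gB: "g \<ge> - B"
  proof -
    have "ln k \<le> 2 * ln L"
    proof -
      have "k * 1 \<le> k * ln L" using lL C k0 by (intro mult_left_mono) auto
      then have "k \<le> C * L" using kL by simp
      then have "ln k \<le> ln (C * L)" using k0 C L0 by (subst ln_le_cancel_iff) auto
      also have "\<dots> = ln C + ln L" using C L0 by (subst ln_mult) auto
      also have "ln C \<le> ln L" using ln_le_minus_one[OF C] lL C by linarith
      finally show ?thesis by simp
    qed
    then have "k * ln k \<le> k * (2 * ln L)" using k0 by (intro mult_left_mono) auto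
    also have "\<dots> \<le> 2 * C * L" using kL by simp
    finally have "ln (k * ln k) \<le> ln (2 * C * L)" using k k0 lk C L0
      by (subst ln_le_cancel_iff) (auto intro!: mult_pos_pos)
    also have "\<dots> = ln (2 * C) + ln L" using C L0 by (subst ln_mult) auto
    also have "ln (k * ln k) = ln k + ln (ln k)" using k0 lk by (subst ln_mult) auto
    finally show ?thesis unfolding g_def B_def by linarith
  qed
  have P: "finite (primes_upto T)" "\<And>p. p \<in> primes_upto T \<Longrightarrow> prime p" by (auto simp: prime_primes_upto)
  let ?S = "\<Sum>p\<in>primes_upto T - primes_upto w. real p powr (-1 - 2 * s)"
  have B0: "B \<ge> 0" by (simp add: B_def)
  have "ln (1 / s) - ln (ln w) \<le> g + B" "0 \<le> g + B"
    using ls l80 llw1 B0 gB unfolding g_def by linarith+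
  then have max: "max 0 (ln (1 / s) - ln (ln w)) \<le> g + B" by simp
  have "?S \<le> max 0 (ln (1 / s) - ln (ln w)) + 7"
    by (rule sum_primes_powr_above_le'[OF P w(1) s0 s1])
  also have "\<dots> \<le> g + B + 7" using max by simp
  finally have "k\<^sup>2 * ?S \<le> k\<^sup>2 * (g + B + 7)" by (intro mult_left_mono) auto
  then have Xup: "ln X \<le> k\<^sup>2 * (g + B + 33)"
    using ln_euler_moment_le[OF P, of s k] s0 k unfolding X_def w_def by (simp add: algebra_simps)
  have "1 / s \<le> ln T" using k(1) L0 by (simp add: s_def L_def[symmetric] field_simps)
  from sum_primes_powr_above_ge[OF w s0 s1 this T0]
  have "g - 90 \<le> ?S" using ls l80 llw2 unfolding g_def by linarith
  then have "k\<^sup>2 * (g - 90) \<le> k\<^sup>2 * ?S" by (intro mult_left_mono) auto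
  then have Xlo: "ln X \<ge> k\<^sup>2 * (g - 91)"
    using ln_euler_moment_ge[OF P, of s k] s0 k unfolding X_def w_def by (simp add: algebra_simps)
  define r where "r = ln m - k\<^sup>2 * g"
  \<comment> \<open>203 = 170 + 26 + 7 from the truncation, the Euler moment and the prime sum. In
    the other direction 95 = 4 + 1 + 90, with 90 = 79 + 2 + 9 from ln 80, ln (ln w) and the prime
    sum.\<close>
  have "r \<le> k\<^sup>2 * (203 + B)" unfolding r_def using lnup Xup by (simp add: algebra_simps)
  moreover have "- r \<le> k\<^sup>2 * 95" unfolding r_def using lnlo Xlo by (simp add: algebra_simps)
  moreover have "k\<^sup>2 * 95 \<le> k\<^sup>2 * (203 + B)" by (intro mult_left_mono) (auto simp: B_def)
  ultimately have "\<bar>r\<bar> \<le> (203 + B) * k\<^sup>2" by (simp add: abs_le_iff mult.commute)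
  moreover have "m = ln T powr k\<^sup>2 * exp (- k\<^sup>2 * ln k - k\<^sup>2 * ln (ln k) + r)"
  proof -
    have "m = exp (k\<^sup>2 * g + r)" using m by (simp add: r_def)
    also have "\<dots> = exp (k\<^sup>2 * ln L) * exp (- k\<^sup>2 * ln k - k\<^sup>2 * ln (ln k) + r)"
      by (simp add: exp_add[symmetric] g_def algebra_simps)
    also have "exp (k\<^sup>2 * ln L) = ln T powr k\<^sup>2" using L0 by (simp add: powr_def L_def)
    finally show ?thesis .
  qed
  ultimately show ?thesis unfolding m_def B_def by blast
qed

end

theorem theorem2:
  fixes M :: "'a measure" and f :: "nat \<Rightarrow> 'a \<Rightarrow> complex" and C :: real
  assumes "steinhaus M f" and "C > 0"
  shows "\<exists>K::real. \<exists>T0::real. \<forall>T\<ge>T0. \<forall>k::real. 10 \<le> k \<and> k \<le> C * ln T / ln (ln T) \<longrightarrow>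
    (\<exists>r::real. \<bar>r\<bar> \<le> K * k\<^sup>2 \<and>
      integral\<^sup>L M (\<lambda>\<omega>. cmod (M_sum f T \<omega>) powr (2 * k)) =
        ln T powr k\<^sup>2 * exp (- k\<^sup>2 * ln k - k\<^sup>2 * ln (ln k) + r))"
proof -
  interpret steinhaus M f by fact
  \<comment> \<open>Replacing f by a version of modulus 1 everywhere changes M_f(T) only on a null
    set, so the moments agree.\<close>
  obtain g where g: "unit_steinhaus M g" "AE \<omega> in M. \<forall>p. prime p \<longrightarrow> g p \<omega> = f p \<omega>"
    by (rule unit_version)
  interpret g: unit_steinhaus M g by fact
  have [measurable]: "mult_ext f n \<in> borel_measurable M" for n
    unfolding mult_ext_def[abs_def] by (intro borel_measurable_prod borel_measurable_power)
      (auto intro: measurable_f in_prime_factors_imp_prime)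
  have [measurable]: "M_sum f T \<in> borel_measurable M" "M_sum g T \<in> borel_measurable M" for T
    unfolding M_sum_def[abs_def] by measurable
  have eq: "integral\<^sup>L M (\<lambda>\<omega>. cmod (M_sum f T \<omega>) powr q) = integral\<^sup>L M (\<lambda>\<omega>. cmod (M_sum g T \<omega>) powr q)" for T q
  proof (rule integral_cong_AE)
    show "AE \<omega> in M. cmod (M_sum f T \<omega>) powr q = cmod (M_sum g T \<omega>) powr q"
      using g(2)
    proof eventually_elim
      case (elim \<omega>)
      then have "mult_ext f n \<omega> = mult_ext g n \<omega>" for n by (intro mult_ext_cong) auto
      then show ?case by (simp add: M_sum_def)
    qed
  qed measurable
  show ?thesis
    unfolding eq
    by (rule exI[of _ "203 + \<bar>ln (2 * C)\<bar>"], rule exI[of _ "exp (exp (80 * C + 1))"])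
       (intro allI impI g.M_sum_moment_asymptotics[OF assms(2)]; simp)
qed

end
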